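(* Let $\mathcal B$ be a braided tensor category. There is a canonical $2$-equivalence $\mathbf{Mod_{br}}(\mathcal B)\cong\mathbf A(\mathcal B)$ between the $2$-category of braided $\mathcal B$-module categories and the $2$-category of pairs $(\mathcal M,\eta)$, where $\mathcal M$ is a $\mathcal B$-module category and $\eta:\alpha^+_{\mathcal M}\xrightarrow{\sim}\alpha^-_{\mathcal M}$ is an isomorphism of tensor functors between the $\alpha$-inductions of $\mathcal M$.
   Context: $k$ is an algebraically closed field; tensor categories are $k$-linear and finite; $c$ is the braiding of $\mathcal B$. A (left) $\mathcal B$-module category is a finite abelian $k$-linear category $\mathcal M$ with action $*$ exact in each variable and associativity isomorphisms $m_{X,Y,M}:(X\otimes Y)*M\to X*(Y*M)$ satisfying pentagon and unit axioms; module functors have coherent natural isomorphisms $F_{X,M}:X*F(M)\to F(X*M)$. $\mathrm{End}_{\mathcal B}(\mathcal M)$ is the category of right exact $\mathcal B$-module endofunctors of $\mathcal M$, with tensor product given by composition. $\mathcal B^{op}$ is $\mathcal B$ with opposite tensor product. All module functors considered are right exact. $\mathbf{Mod_{br}}(\mathcal B)$: objects are braided $\mathcal B$-module categories, i.e. pairs $(\mathcal M,\sigma)$ with $\sigma_{X,M}:X*M\to X*M$ a natural isomorphism, $\sigma_{\mathbf 1,M}=\mathrm{id}$ and $$m_{Y,X,M}(c_{Y,X}^{-1}*\mathrm{id})m_{X,Y,M}^{-1}\sigma_{X,Y*M}=(\mathrm{id}_Y*\sigma_{X,M})m_{Y,X,M}(c_{X,Y}*\mathrm{id})m_{X,Y,M}^{-1},$$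 $$m_{Y,X,M}(c_{X,Y}*\mathrm{id})\sigma_{X\otimes Y,M}=\sigma_{Y,X*M}(\mathrm{id}_Y*\sigma_{X,M})m_{Y,X,M}(c_{Y,X}^{-1}*\mathrm{id});$$ $1$-cells are module functors $F$ with $F_{X,M}\sigma_{X,F(M)}=F(\sigma_{X,M})F_{X,M}$; $2$-cells are module natural transformations. $\alpha$-inductions: $\alpha^\pm_{\mathcal M}:\mathcal B^{op}\to\mathrm{End}_{\mathcal B}(\mathcal M)$ are the tensor functors with $\alpha^\pm_{\mathcal M}(X)(M)=X*M$; the module structure $Y*(X*M)\to X*(Y*M)$ of $\alpha^+_{\mathcal M}(X)$ is $m_{X,Y,M}(c_{X,Y}^{-1}*\mathrm{id})m_{Y,X,M}^{-1}$ and that of $\alpha^-_{\mathcal M}(X)$ is $m_{X,Y,M}(c_{Y,X}*\mathrm{id})m_{Y,X,M}^{-1}$; the monoidal structures $\alpha^\pm_{\mathcal M}(Y)\alpha^\pm_{\mathcal M}(X)(M)=Y*(X*M)\to(X\otimes Y)*M=\alpha^\pm_{\mathcal M}(X\otimes Y)(M)$ are $(c_{Y,X}*\mathrm{id})m_{Y,X,M}^{-1}$ for $\alpha^+$ and $(c_{X,Y}^{-1}*\mathrm{id})m_{Y,X,M}^{-1}$ for $\alpha^-$. $\mathbf A(\mathcal B)$: objects are pairs $(\mathcal M,\eta)$ as in the claim; $1$-cells $(\mathcal M,\eta^{\mathcal M})\to(\mathcal N,\eta^{\mathcal N})$ are $\mathcal B$-module functors $F:\mathcal M\to\mathcal N$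 such that $F_{X,M}\circ\eta^{\mathcal N}_X(F(M))=F(\eta^{\mathcal M}_X(M))\circ F_{X,M}$ for all $X\in\mathcal B$, $M\in\mathcal M$; $2$-cells are $\mathcal B$-module natural transformations. *)

theory Defs
  imports "HOL-Algebra.Algebraic_Closure" "HOL-Algebra.Module"
begin

section \<open>Categories\<close>

text \<open>Categories are carrier based: objects and arrows form subsets of arbitrary types, and
  composition is only meaningful for composable arrows. \<open>g \<cdot>\<^bsub>C\<^esub> f\<close> is \<open>g\<close> after \<open>f\<close>.\<close>

record ('o, 'a) category =
  Ob :: "'o set"
  Arr :: "'a set"
  Dom :: "'a \<Rightarrow> 'o"
  Cod :: "'a \<Rightarrow> 'o"
  Ide :: "'o \<Rightarrow> 'a"
  Comp :: "'a \<Rightarrow> 'a \<Rightarrow> 'a"  (infixl \<open>\<cdot>\<index>\<close> 70)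

definition Hom :: "('o, 'a, 'z) category_scheme \<Rightarrow> 'o \<Rightarrow> 'o \<Rightarrow> 'a set" where
  "Hom C x y = {f \<in> Arr C. Dom C f = x \<and> Cod C f = y}"

locale category =
  fixes C :: "('o, 'a, 'z) category_scheme"
  assumes dom_closed: "f \<in> Arr C \<Longrightarrow> Dom C f \<in> Ob C"
    and cod_closed: "f \<in> Arr C \<Longrightarrow> Cod C f \<in> Ob C"
    and ide_closed: "x \<in> Ob C \<Longrightarrow> Ide C x \<in> Hom C x x"
    and comp_closed: "\<lbrakk>f \<in> Hom C x y; g \<in> Hom C y z\<rbrakk> \<Longrightarrow> g \<cdot>\<^bsub>C\<^esub> f \<in> Hom C x z"
    and comp_assoc: "\<lbrakk>f \<in> Hom C x y; g \<in> Hom C y z; h \<in> Hom C z w\<rbrakk>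
      \<Longrightarrow> (h \<cdot>\<^bsub>C\<^esub> g) \<cdot>\<^bsub>C\<^esub> f = h \<cdot>\<^bsub>C\<^esub> (g \<cdot>\<^bsub>C\<^esub> f)"
    and comp_ide_right: "f \<in> Hom C x y \<Longrightarrow> f \<cdot>\<^bsub>C\<^esub> Ide C x = f"
    and comp_ide_left: "f \<in> Hom C x y \<Longrightarrow> Ide C y \<cdot>\<^bsub>C\<^esub> f = f"

definition inverse_arrows :: "('o, 'a, 'z) category_scheme \<Rightarrow> 'a \<Rightarrow> 'a \<Rightarrow> bool" where
  "inverse_arrows C f g \<longleftrightarrow> f \<in> Arr C \<and> g \<in> Hom C (Cod C f) (Dom C f)
     \<and> g \<cdot>\<^bsub>C\<^esub> f = Ide C (Dom C f) \<and> f \<cdot>\<^bsub>C\<^esub> g = Ide C (Cod C f)"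

definition iso_arrow :: "('o, 'a, 'z) category_scheme \<Rightarrow> 'a \<Rightarrow> bool" where
  "iso_arrow C f \<longleftrightarrow> (\<exists>g. inverse_arrows C f g)"

definition inv_arrow :: "('o, 'a, 'z) category_scheme \<Rightarrow> 'a \<Rightarrow> 'a" where
  "inv_arrow C f = (THE g. inverse_arrows C f g)"

definition iso_objects :: "('o, 'a, 'z) category_scheme \<Rightarrow> 'o \<Rightarrow> 'o \<Rightarrow> bool" where
  "iso_objects C x y \<longleftrightarrow> (\<exists>f \<in> Hom C x y. iso_arrow C f)"

definition mono_arrow :: "('o, 'a, 'z) category_scheme \<Rightarrow> 'a \<Rightarrow> bool" where
  "mono_arrow C f \<longleftrightarrow> f \<in> Arr C \<and>
     (\<forall>w g h. g \<in> Hom C w (Dom C f) \<longrightarrow> h \<in> Hom C w (Dom C f) \<longrightarrow> f \<cdot>\<^bsub>C\<^esub> g = f \<cdot>\<^bsub>C\<^esub> h \<longrightarrow> g = h)"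

definition epi_arrow :: "('o, 'a, 'z) category_scheme \<Rightarrow> 'a \<Rightarrow> bool" where
  "epi_arrow C f \<longleftrightarrow> f \<in> Arr C \<and>
     (\<forall>w g h. g \<in> Hom C (Cod C f) w \<longrightarrow> h \<in> Hom C (Cod C f) w \<longrightarrow> g \<cdot>\<^bsub>C\<^esub> f = h \<cdot>\<^bsub>C\<^esub> f \<longrightarrow> g = h)"

definition zero_object :: "('o, 'a, 'z) category_scheme \<Rightarrow> 'o \<Rightarrow> bool" where
  "zero_object C z \<longleftrightarrow> z \<in> Ob C \<and>
     (\<forall>x \<in> Ob C. (\<exists>!f. f \<in> Hom C x z) \<and> (\<exists>!f. f \<in> Hom C z x))"

definition full_subcategory ::
    "('o, 'a, 'z) category_scheme \<Rightarrow> ('o \<Rightarrow> bool) \<Rightarrow> ('o, 'a) category" where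
  "full_subcategory C P =
     \<lparr>Ob = {x \<in> Ob C. P x}, Arr = {f \<in> Arr C. P (Dom C f) \<and> P (Cod C f)},
      Dom = Dom C, Cod = Cod C, Ide = Ide C, Comp = Comp C\<rparr>"


section \<open>Functors and natural transformations\<close>

record ('o, 'a, 'p, 'b) ftor =
  FO :: "'o \<Rightarrow> 'p"
  FA :: "'a \<Rightarrow> 'b"

locale cat_functor = dom: category C + cod: category D
  for C :: "('o, 'a, 'y) category_scheme" and D :: "('p, 'b, 'z) category_scheme" +
  fixes F :: "('o, 'a, 'p, 'b, 'x) ftor_scheme"
  assumes ob_closed: "x \<in> Ob C \<Longrightarrow> FO F x \<in> Ob D"
    and arr_closed: "f \<in> Hom C x y \<Longrightarrow> FA F f \<in> Hom D (FO F x) (FO F y)"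
    and preserves_ide: "x \<in> Ob C \<Longrightarrow> FA F (Ide C x) = Ide D (FO F x)"
    and preserves_comp: "\<lbrakk>f \<in> Hom C x y; g \<in> Hom C y z\<rbrakk>
      \<Longrightarrow> FA F (g \<cdot>\<^bsub>C\<^esub> f) = FA F g \<cdot>\<^bsub>D\<^esub> FA F f"

definition nat_transformation ::
    "('o, 'a, 'y) category_scheme \<Rightarrow> ('p, 'b, 'z) category_scheme \<Rightarrow>
     ('o, 'a, 'p, 'b, 'u) ftor_scheme \<Rightarrow> ('o, 'a, 'p, 'b, 'v) ftor_scheme \<Rightarrow> ('o \<Rightarrow> 'b) \<Rightarrow> bool" where
  "nat_transformation C D F G t \<longleftrightarrow>
     (\<forall>x \<in> Ob C. t x \<in> Hom D (FO F x) (FO G x)) \<and>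
     (\<forall>x y f. f \<in> Hom C x y \<longrightarrow> t y \<cdot>\<^bsub>D\<^esub> FA F f = FA G f \<cdot>\<^bsub>D\<^esub> t x)"


section \<open>Finite abelian linear categories\<close>

record ('o, 'a, 'k) lin_category = "('o, 'a) category" +
  Plus :: "'a \<Rightarrow> 'a \<Rightarrow> 'a"
  Zer :: "'o \<Rightarrow> 'o \<Rightarrow> 'a"
  Scale :: "'k \<Rightarrow> 'a \<Rightarrow> 'a"

text \<open>The Hom spaces are packaged as modules of \<open>HOL-Algebra\<close>; the multiplicative components of the
  record play no role in the locale of modules.\<close>

definition Hom_module :: "('o, 'a, 'k, 'z) lin_category_scheme \<Rightarrow> 'o \<Rightarrow> 'o \<Rightarrow> ('k, 'a) module" where
  "Hom_module C x y =
     \<lparr>carrier = Hom C x y, monoid.mult = (\<lambda>_ _. undefined), one = undefined,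
      zero = Zer C x y, add = Plus C, smult = Scale C\<rparr>"

locale linear_category = field K + category C
  for K :: "'k ring" and C :: "('o, 'a, 'k, 'z) lin_category_scheme" +
  assumes hom_module: "\<lbrakk>x \<in> Ob C; y \<in> Ob C\<rbrakk> \<Longrightarrow> Module.module K (Hom_module C x y)"
    and comp_plus_left: "\<lbrakk>f \<in> Hom C x y; g \<in> Hom C y z; g' \<in> Hom C y z\<rbrakk>
      \<Longrightarrow> Plus C g g' \<cdot>\<^bsub>C\<^esub> f = Plus C (g \<cdot>\<^bsub>C\<^esub> f) (g' \<cdot>\<^bsub>C\<^esub> f)"
    and comp_plus_right: "\<lbrakk>f \<in> Hom C x y; f' \<in> Hom C x y; g \<in> Hom C y z\<rbrakk>
      \<Longrightarrow> g \<cdot>\<^bsub>C\<^esub> Plus C f f' = Plus C (g \<cdot>\<^bsub>C\<^esub> f) (g \<cdot>\<^bsub>C\<^esub> f')"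
    and comp_scale_left: "\<lbrakk>a \<in> carrier K; f \<in> Hom C x y; g \<in> Hom C y z\<rbrakk>
      \<Longrightarrow> Scale C a g \<cdot>\<^bsub>C\<^esub> f = Scale C a (g \<cdot>\<^bsub>C\<^esub> f)"
    and comp_scale_right: "\<lbrakk>a \<in> carrier K; f \<in> Hom C x y; g \<in> Hom C y z\<rbrakk>
      \<Longrightarrow> g \<cdot>\<^bsub>C\<^esub> Scale C a f = Scale C a (g \<cdot>\<^bsub>C\<^esub> f)"

definition is_kernel :: "('o, 'a, 'k, 'z) lin_category_scheme \<Rightarrow> 'a \<Rightarrow> 'a \<Rightarrow> bool" where
  "is_kernel C f i \<longleftrightarrow> f \<in> Arr C \<and> i \<in> Arr C \<and> Cod C i = Dom C f \<and>
     f \<cdot>\<^bsub>C\<^esub> i = Zer C (Dom C i) (Cod C f) \<and>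
     (\<forall>w h. h \<in> Hom C w (Dom C f) \<longrightarrow> f \<cdot>\<^bsub>C\<^esub> h = Zer C w (Cod C f) \<longrightarrow>
        (\<exists>!u. u \<in> Hom C w (Dom C i) \<and> i \<cdot>\<^bsub>C\<^esub> u = h))"

definition is_cokernel :: "('o, 'a, 'k, 'z) lin_category_scheme \<Rightarrow> 'a \<Rightarrow> 'a \<Rightarrow> bool" where
  "is_cokernel C f q \<longleftrightarrow> f \<in> Arr C \<and> q \<in> Arr C \<and> Dom C q = Cod C f \<and>
     q \<cdot>\<^bsub>C\<^esub> f = Zer C (Dom C f) (Cod C q) \<and>
     (\<forall>w h. h \<in> Hom C (Cod C f) w \<longrightarrow> h \<cdot>\<^bsub>C\<^esub> f = Zer C (Dom C f) w \<longrightarrow>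
        (\<exists>!u. u \<in> Hom C (Cod C q) w \<and> u \<cdot>\<^bsub>C\<^esub> q = h))"

definition is_biproduct ::
    "('o, 'a, 'k, 'z) lin_category_scheme \<Rightarrow> 'o \<Rightarrow> 'o \<Rightarrow> 'o \<Rightarrow> 'a \<Rightarrow> 'a \<Rightarrow> 'a \<Rightarrow> 'a \<Rightarrow> bool" where
  "is_biproduct C x y s i1 i2 p1 p2 \<longleftrightarrow> s \<in> Ob C \<and>
     i1 \<in> Hom C x s \<and> i2 \<in> Hom C y s \<and> p1 \<in> Hom C s x \<and> p2 \<in> Hom C s y \<and>
     p1 \<cdot>\<^bsub>C\<^esub> i1 = Ide C x \<and> p2 \<cdot>\<^bsub>C\<^esub> i2 = Ide C y \<and>
     p1 \<cdot>\<^bsub>C\<^esub> i2 = Zer C y x \<and> p2 \<cdot>\<^bsub>C\<^esub> i1 = Zer C x y \<and>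
     Plus C (i1 \<cdot>\<^bsub>C\<^esub> p1) (i2 \<cdot>\<^bsub>C\<^esub> p2) = Ide C s"

locale abelian_category = linear_category K C
  for K :: "'k ring" and C :: "('o, 'a, 'k, 'z) lin_category_scheme" +
  assumes ex_zero_object: "\<exists>z. zero_object C z"
    and ex_biproduct: "\<lbrakk>x \<in> Ob C; y \<in> Ob C\<rbrakk> \<Longrightarrow> \<exists>s i1 i2 p1 p2. is_biproduct C x y s i1 i2 p1 p2"
    and ex_kernel: "f \<in> Arr C \<Longrightarrow> \<exists>i. is_kernel C f i"
    and ex_cokernel: "f \<in> Arr C \<Longrightarrow> \<exists>q. is_cokernel C f q"
    and mono_is_kernel: "mono_arrow C i \<Longrightarrow> \<exists>f. is_kernel C f i"
    and epi_is_cokernel: "epi_arrow C q \<Longrightarrow> \<exists>f. is_cokernel C f q"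

definition simple_object :: "('o, 'a, 'z) category_scheme \<Rightarrow> 'o \<Rightarrow> bool" where
  "simple_object C s \<longleftrightarrow> s \<in> Ob C \<and> \<not> zero_object C s \<and>
     (\<forall>i. mono_arrow C i \<longrightarrow> Cod C i = s \<longrightarrow> zero_object C (Dom C i) \<or> iso_arrow C i)"

definition projective_object :: "('o, 'a, 'z) category_scheme \<Rightarrow> 'o \<Rightarrow> bool" where
  "projective_object C p \<longleftrightarrow> p \<in> Ob C \<and>
     (\<forall>e f. epi_arrow C e \<longrightarrow> f \<in> Hom C p (Cod C e) \<longrightarrow> (\<exists>g \<in> Hom C p (Dom C e). e \<cdot>\<^bsub>C\<^esub> g = f))"

text \<open>An object has finite length if it has a Jordan--Hoelder series; the second rule appends one
  step with simple quotient to such a series.\<close>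

inductive finite_length :: "('o, 'a, 'k, 'z) lin_category_scheme \<Rightarrow> 'o \<Rightarrow> bool"
  for C :: "('o, 'a, 'k, 'z) lin_category_scheme" where
    zero: "zero_object C x \<Longrightarrow> finite_length C x"
  | step: "\<lbrakk>finite_length C y; mono_arrow C i; i \<in> Hom C y x; is_cokernel C i q;
             simple_object C (Cod C q)\<rbrakk> \<Longrightarrow> finite_length C x"

locale finite_abelian_category = abelian_category K C
  for K :: "'k ring" and C :: "('o, 'a, 'k, 'z) lin_category_scheme" +
  assumes hom_finite_dim: "\<lbrakk>x \<in> Ob C; y \<in> Ob C\<rbrakk> \<Longrightarrow>
      \<exists>S \<subseteq> Hom C x y. finite S \<and> (\<forall>f \<in> Hom C x y. \<exists>a \<in> S \<rightarrow> carrier K.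
        f = finsum (Hom_module C x y) (\<lambda>s. Scale C (a s) s) S)"
    and ob_finite_length: "x \<in> Ob C \<Longrightarrow> finite_length C x"
    and enough_projectives:
      "x \<in> Ob C \<Longrightarrow> \<exists>p e. projective_object C p \<and> e \<in> Hom C p x \<and> epi_arrow C e"
    and finitely_many_simples:
      "\<exists>S. finite S \<and> S \<subseteq> Ob C \<and> (\<forall>x. simple_object C x \<longrightarrow> (\<exists>s \<in> S. iso_objects C x s))"

locale linear_functor =
  dom: linear_category K C + cod: linear_category K D + cat_functor C D F
  for K :: "'k ring" and C :: "('o, 'a, 'k, 'y) lin_category_scheme"
    and D :: "('p, 'b, 'k, 'z) lin_category_scheme" and F :: "('o, 'a, 'p, 'b, 'x) ftor_scheme" +
  assumes preserves_plus:
      "\<lbrakk>f \<in> Hom C x y; g \<in> Hom C x y\<rbrakk> \<Longrightarrow> FA F (Plus C f g) = Plus D (FA F f) (FA F g)"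
    and preserves_scale:
      "\<lbrakk>a \<in> carrier K; f \<in> Hom C x y\<rbrakk> \<Longrightarrow> FA F (Scale C a f) = Scale D a (FA F f)"

text \<open>For linear (hence additive) functors between abelian categories, right exactness is
  preservation of cokernels, and exactness is preservation of kernels and cokernels.\<close>

definition right_exact ::
    "('o, 'a, 'k, 'y) lin_category_scheme \<Rightarrow> ('p, 'b, 'k, 'z) lin_category_scheme \<Rightarrow>
     ('o, 'a, 'p, 'b, 'x) ftor_scheme \<Rightarrow> bool" where
  "right_exact C D F \<longleftrightarrow> (\<forall>f q. is_cokernel C f q \<longrightarrow> is_cokernel D (FA F f) (FA F q))"

definition left_exact ::
    "('o, 'a, 'k, 'y) lin_category_scheme \<Rightarrow> ('p, 'b, 'k, 'z) lin_category_scheme \<Rightarrow>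
     ('o, 'a, 'p, 'b, 'x) ftor_scheme \<Rightarrow> bool" where
  "left_exact C D F \<longleftrightarrow> (\<forall>f i. is_kernel C f i \<longrightarrow> is_kernel D (FA F f) (FA F i))"

definition exact ::
    "('o, 'a, 'k, 'y) lin_category_scheme \<Rightarrow> ('p, 'b, 'k, 'z) lin_category_scheme \<Rightarrow>
     ('o, 'a, 'p, 'b, 'x) ftor_scheme \<Rightarrow> bool" where
  "exact C D F \<longleftrightarrow> left_exact C D F \<and> right_exact C D F"

locale bilinear_bifunctor =
  first: linear_category K C + second: linear_category K D + target: linear_category K E
  for K :: "'k ring" and C :: "('o, 'a, 'k, 'x) lin_category_scheme"
    and D :: "('p, 'b, 'k, 'y) lin_category_scheme" and E :: "('q, 'c, 'k, 'z) lin_category_scheme" +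
  fixes BO :: "'o \<Rightarrow> 'p \<Rightarrow> 'q" and BA :: "'a \<Rightarrow> 'b \<Rightarrow> 'c"
  assumes bi_ob_closed: "\<lbrakk>x \<in> Ob C; y \<in> Ob D\<rbrakk> \<Longrightarrow> BO x y \<in> Ob E"
    and bi_arr_closed: "\<lbrakk>f \<in> Hom C x x'; g \<in> Hom D y y'\<rbrakk> \<Longrightarrow> BA f g \<in> Hom E (BO x y) (BO x' y')"
    and bi_ide: "\<lbrakk>x \<in> Ob C; y \<in> Ob D\<rbrakk> \<Longrightarrow> BA (Ide C x) (Ide D y) = Ide E (BO x y)"
    and bi_comp: "\<lbrakk>f \<in> Hom C x x'; f' \<in> Hom C x' x''; g \<in> Hom D y y'; g' \<in> Hom D y' y''\<rbrakk>
      \<Longrightarrow> BA (f' \<cdot>\<^bsub>C\<^esub> f) (g' \<cdot>\<^bsub>D\<^esub> g) = BA f' g' \<cdot>\<^bsub>E\<^esub> BA f g"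
    and bi_plus_left: "\<lbrakk>f \<in> Hom C x x'; f' \<in> Hom C x x'; g \<in> Hom D y y'\<rbrakk>
      \<Longrightarrow> BA (Plus C f f') g = Plus E (BA f g) (BA f' g)"
    and bi_plus_right: "\<lbrakk>f \<in> Hom C x x'; g \<in> Hom D y y'; g' \<in> Hom D y y'\<rbrakk>
      \<Longrightarrow> BA f (Plus D g g') = Plus E (BA f g) (BA f g')"
    and bi_scale_left: "\<lbrakk>a \<in> carrier K; f \<in> Hom C x x'; g \<in> Hom D y y'\<rbrakk>
      \<Longrightarrow> BA (Scale C a f) g = Scale E a (BA f g)"
    and bi_scale_right: "\<lbrakk>a \<in> carrier K; f \<in> Hom C x x'; g \<in> Hom D y y'\<rbrakk>
      \<Longrightarrow> BA f (Scale D a g) = Scale E a (BA f g)"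


section \<open>Braided tensor categories\<close>

record ('o, 'a, 'k) mon_category = "('o, 'a, 'k) lin_category" +
  TensorO :: "'o \<Rightarrow> 'o \<Rightarrow> 'o"  (infixl \<open>\<otimes>\<^sub>o\<index>\<close> 75)
  TensorA :: "'a \<Rightarrow> 'a \<Rightarrow> 'a"  (infixl \<open>\<otimes>\<^sub>a\<index>\<close> 75)
  TUnit :: "'o"
  Assoc :: "'o \<Rightarrow> 'o \<Rightarrow> 'o \<Rightarrow> 'a"
  LUnit :: "'o \<Rightarrow> 'a"
  RUnit :: "'o \<Rightarrow> 'a"

text \<open>\<open>Assoc\<close> has components \<open>(x \<otimes> y) \<otimes> z \<rightarrow> x \<otimes> (y \<otimes> z)\<close>, and the unit isomorphisms have components
  \<open>1 \<otimes> x \<rightarrow> x\<close> and \<open>x \<otimes> 1 \<rightarrow> x\<close>.\<close>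

locale linear_monoidal_category =
  linear_category K C + bilinear_bifunctor K C C C "TensorO C" "TensorA C"
  for K :: "'k ring" and C :: "('o, 'a, 'k, 'z) mon_category_scheme" +
  assumes unit_closed: "TUnit C \<in> Ob C"
    and assoc_closed: "\<lbrakk>x \<in> Ob C; y \<in> Ob C; z \<in> Ob C\<rbrakk> \<Longrightarrow>
      Assoc C x y z \<in> Hom C ((x \<otimes>\<^sub>o\<^bsub>C\<^esub> y) \<otimes>\<^sub>o\<^bsub>C\<^esub> z) (x \<otimes>\<^sub>o\<^bsub>C\<^esub> (y \<otimes>\<^sub>o\<^bsub>C\<^esub> z))"
    and assoc_iso: "\<lbrakk>x \<in> Ob C; y \<in> Ob C; z \<in> Ob C\<rbrakk> \<Longrightarrow> iso_arrow C (Assoc C x y z)"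
    and assoc_natural: "\<lbrakk>f \<in> Hom C x x'; g \<in> Hom C y y'; h \<in> Hom C z z'\<rbrakk> \<Longrightarrow>
      Assoc C x' y' z' \<cdot>\<^bsub>C\<^esub> ((f \<otimes>\<^sub>a\<^bsub>C\<^esub> g) \<otimes>\<^sub>a\<^bsub>C\<^esub> h)
        = (f \<otimes>\<^sub>a\<^bsub>C\<^esub> (g \<otimes>\<^sub>a\<^bsub>C\<^esub> h)) \<cdot>\<^bsub>C\<^esub> Assoc C x y z"
    and lunit_closed: "x \<in> Ob C \<Longrightarrow> LUnit C x \<in> Hom C (TUnit C \<otimes>\<^sub>o\<^bsub>C\<^esub> x) x"
    and lunit_iso: "x \<in> Ob C \<Longrightarrow> iso_arrow C (LUnit C x)"
    and lunit_natural: "f \<in> Hom C x y \<Longrightarrow>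
      LUnit C y \<cdot>\<^bsub>C\<^esub> (Ide C (TUnit C) \<otimes>\<^sub>a\<^bsub>C\<^esub> f) = f \<cdot>\<^bsub>C\<^esub> LUnit C x"
    and runit_closed: "x \<in> Ob C \<Longrightarrow> RUnit C x \<in> Hom C (x \<otimes>\<^sub>o\<^bsub>C\<^esub> TUnit C) x"
    and runit_iso: "x \<in> Ob C \<Longrightarrow> iso_arrow C (RUnit C x)"
    and runit_natural: "f \<in> Hom C x y \<Longrightarrow>
      RUnit C y \<cdot>\<^bsub>C\<^esub> (f \<otimes>\<^sub>a\<^bsub>C\<^esub> Ide C (TUnit C)) = f \<cdot>\<^bsub>C\<^esub> RUnit C x"
    and pentagon: "\<lbrakk>x \<in> Ob C; y \<in> Ob C; z \<in> Ob C; w \<in> Ob C\<rbrakk> \<Longrightarrow>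
      Assoc C x y (z \<otimes>\<^sub>o\<^bsub>C\<^esub> w) \<cdot>\<^bsub>C\<^esub> Assoc C (x \<otimes>\<^sub>o\<^bsub>C\<^esub> y) z w
        = (Ide C x \<otimes>\<^sub>a\<^bsub>C\<^esub> Assoc C y z w) \<cdot>\<^bsub>C\<^esub> Assoc C x (y \<otimes>\<^sub>o\<^bsub>C\<^esub> z) w
            \<cdot>\<^bsub>C\<^esub> (Assoc C x y z \<otimes>\<^sub>a\<^bsub>C\<^esub> Ide C w)"
    and triangle: "\<lbrakk>x \<in> Ob C; y \<in> Ob C\<rbrakk> \<Longrightarrow>
      (Ide C x \<otimes>\<^sub>a\<^bsub>C\<^esub> LUnit C y) \<cdot>\<^bsub>C\<^esub> Assoc C x (TUnit C) y = RUnit C x \<otimes>\<^sub>a\<^bsub>C\<^esub> Ide C y"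

text \<open>\<open>is_left_dual C x' x ev coev\<close>: \<open>x'\<close> is a left dual of \<open>x\<close> (equivalently, \<open>x\<close> is a right dual
  of \<open>x'\<close>) with evaluation \<open>x' \<otimes> x \<rightarrow> 1\<close> and coevaluation \<open>1 \<rightarrow> x \<otimes> x'\<close>.\<close>

definition is_left_dual ::
    "('o, 'a, 'k, 'z) mon_category_scheme \<Rightarrow> 'o \<Rightarrow> 'o \<Rightarrow> 'a \<Rightarrow> 'a \<Rightarrow> bool" where
  "is_left_dual C x' x ev coev \<longleftrightarrow> x' \<in> Ob C \<and> x \<in> Ob C \<and>
     ev \<in> Hom C (x' \<otimes>\<^sub>o\<^bsub>C\<^esub> x) (TUnit C) \<and> coev \<in> Hom C (TUnit C) (x \<otimes>\<^sub>o\<^bsub>C\<^esub> x') \<and>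
     RUnit C x \<cdot>\<^bsub>C\<^esub> (Ide C x \<otimes>\<^sub>a\<^bsub>C\<^esub> ev) \<cdot>\<^bsub>C\<^esub> Assoc C x x' x \<cdot>\<^bsub>C\<^esub> (coev \<otimes>\<^sub>a\<^bsub>C\<^esub> Ide C x) = LUnit C x \<and>
     LUnit C x' \<cdot>\<^bsub>C\<^esub> (ev \<otimes>\<^sub>a\<^bsub>C\<^esub> Ide C x') \<cdot>\<^bsub>C\<^esub> inv_arrow C (Assoc C x' x x')
       \<cdot>\<^bsub>C\<^esub> (Ide C x' \<otimes>\<^sub>a\<^bsub>C\<^esub> coev) = RUnit C x'"

locale tensor_category = finite_abelian_category K C + linear_monoidal_category K C
  for K :: "'k ring" and C :: "('o, 'a, 'k, 'z) mon_category_scheme" +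
  assumes left_rigid: "x \<in> Ob C \<Longrightarrow> \<exists>x' ev coev. is_left_dual C x' x ev coev"
    and right_rigid: "x \<in> Ob C \<Longrightarrow> \<exists>x' ev coev. is_left_dual C x x' ev coev"
    and end_unit: "bij_betw (\<lambda>a. Scale C a (Ide C (TUnit C))) (carrier K) (Hom C (TUnit C) (TUnit C))"

record ('o, 'a, 'k) br_category = "('o, 'a, 'k) mon_category" +
  Braid :: "'o \<Rightarrow> 'o \<Rightarrow> 'a"

locale braided_tensor_category = tensor_category K B
  for K :: "'k ring" and B :: "('o, 'a, 'k, 'z) br_category_scheme" +
  assumes braid_closed: "\<lbrakk>x \<in> Ob B; y \<in> Ob B\<rbrakk> \<Longrightarrow>
      Braid B x y \<in> Hom B (x \<otimes>\<^sub>o\<^bsub>B\<^esub> y) (y \<otimes>\<^sub>o\<^bsub>B\<^esub> x)"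
    and braid_iso: "\<lbrakk>x \<in> Ob B; y \<in> Ob B\<rbrakk> \<Longrightarrow> iso_arrow B (Braid B x y)"
    and braid_natural: "\<lbrakk>f \<in> Hom B x x'; g \<in> Hom B y y'\<rbrakk> \<Longrightarrow>
      Braid B x' y' \<cdot>\<^bsub>B\<^esub> (f \<otimes>\<^sub>a\<^bsub>B\<^esub> g) = (g \<otimes>\<^sub>a\<^bsub>B\<^esub> f) \<cdot>\<^bsub>B\<^esub> Braid B x y"
    and hexagon1: "\<lbrakk>x \<in> Ob B; y \<in> Ob B; z \<in> Ob B\<rbrakk> \<Longrightarrow>
      Assoc B y z x \<cdot>\<^bsub>B\<^esub> Braid B x (y \<otimes>\<^sub>o\<^bsub>B\<^esub> z) \<cdot>\<^bsub>B\<^esub> Assoc B x y z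
        = (Ide B y \<otimes>\<^sub>a\<^bsub>B\<^esub> Braid B x z) \<cdot>\<^bsub>B\<^esub> Assoc B y x z \<cdot>\<^bsub>B\<^esub> (Braid B x y \<otimes>\<^sub>a\<^bsub>B\<^esub> Ide B z)"
    and hexagon2: "\<lbrakk>x \<in> Ob B; y \<in> Ob B; z \<in> Ob B\<rbrakk> \<Longrightarrow>
      inv_arrow B (Assoc B z x y) \<cdot>\<^bsub>B\<^esub> Braid B (x \<otimes>\<^sub>o\<^bsub>B\<^esub> y) z \<cdot>\<^bsub>B\<^esub> inv_arrow B (Assoc B x y z)
        = (Braid B x z \<otimes>\<^sub>a\<^bsub>B\<^esub> Ide B y) \<cdot>\<^bsub>B\<^esub> inv_arrow B (Assoc B x z y)
            \<cdot>\<^bsub>B\<^esub> (Ide B x \<otimes>\<^sub>a\<^bsub>B\<^esub> Braid B y z)"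

abbreviation inv_braid :: "('o, 'a, 'k, 'z) br_category_scheme \<Rightarrow> 'o \<Rightarrow> 'o \<Rightarrow> 'a" where
  "inv_braid B x y \<equiv> inv_arrow B (Braid B x y)"

definition op_tensor :: "('o, 'a, 'k, 'z) mon_category_scheme \<Rightarrow> ('o, 'a, 'k) mon_category" where
  "op_tensor C =
     \<lparr>Ob = Ob C, Arr = Arr C, Dom = Dom C, Cod = Cod C, Ide = Ide C, Comp = Comp C,
      Plus = Plus C, Zer = Zer C, Scale = Scale C,
      TensorO = (\<lambda>x y. y \<otimes>\<^sub>o\<^bsub>C\<^esub> x), TensorA = (\<lambda>f g. g \<otimes>\<^sub>a\<^bsub>C\<^esub> f), TUnit = TUnit C,
      Assoc = (\<lambda>x y z. inv_arrow C (Assoc C z y x)), LUnit = RUnit C, RUnit = LUnit C\<rparr>"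


section \<open>Tensor functors and their isomorphisms\<close>

text \<open>\<open>FJ x y : F x \<otimes> F y \<rightarrow> F (x \<otimes> y)\<close> and \<open>FU : 1 \<rightarrow> F 1\<close>.\<close>

record ('o, 'a, 'p, 'b) tensor_ftor = "('o, 'a, 'p, 'b) ftor" +
  FJ :: "'o \<Rightarrow> 'o \<Rightarrow> 'b"
  FU :: "'b"

locale tensor_functor =
  dom: linear_monoidal_category K C + cod: linear_monoidal_category K D + linear_functor K C D F
  for K :: "'k ring" and C :: "('o, 'a, 'k, 'y) mon_category_scheme"
    and D :: "('p, 'b, 'k, 'z) mon_category_scheme" and F :: "('o, 'a, 'p, 'b) tensor_ftor" +
  assumes J_closed: "\<lbrakk>x \<in> Ob C; y \<in> Ob C\<rbrakk> \<Longrightarrow>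
      FJ F x y \<in> Hom D (FO F x \<otimes>\<^sub>o\<^bsub>D\<^esub> FO F y) (FO F (x \<otimes>\<^sub>o\<^bsub>C\<^esub> y))"
    and J_iso: "\<lbrakk>x \<in> Ob C; y \<in> Ob C\<rbrakk> \<Longrightarrow> iso_arrow D (FJ F x y)"
    and J_natural: "\<lbrakk>f \<in> Hom C x x'; g \<in> Hom C y y'\<rbrakk> \<Longrightarrow>
      FJ F x' y' \<cdot>\<^bsub>D\<^esub> (FA F f \<otimes>\<^sub>a\<^bsub>D\<^esub> FA F g) = FA F (f \<otimes>\<^sub>a\<^bsub>C\<^esub> g) \<cdot>\<^bsub>D\<^esub> FJ F x y"
    and J_assoc: "\<lbrakk>x \<in> Ob C; y \<in> Ob C; z \<in> Ob C\<rbrakk> \<Longrightarrow>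
      FA F (Assoc C x y z) \<cdot>\<^bsub>D\<^esub> FJ F (x \<otimes>\<^sub>o\<^bsub>C\<^esub> y) z \<cdot>\<^bsub>D\<^esub> (FJ F x y \<otimes>\<^sub>a\<^bsub>D\<^esub> Ide D (FO F z))
        = FJ F x (y \<otimes>\<^sub>o\<^bsub>C\<^esub> z) \<cdot>\<^bsub>D\<^esub> (Ide D (FO F x) \<otimes>\<^sub>a\<^bsub>D\<^esub> FJ F y z)
            \<cdot>\<^bsub>D\<^esub> Assoc D (FO F x) (FO F y) (FO F z)"
    and U_closed: "FU F \<in> Hom D (TUnit D) (FO F (TUnit C))"
    and U_iso: "iso_arrow D (FU F)"
    and U_left: "x \<in> Ob C \<Longrightarrow>
      FA F (LUnit C x) \<cdot>\<^bsub>D\<^esub> FJ F (TUnit C) x \<cdot>\<^bsub>D\<^esub> (FU F \<otimes>\<^sub>a\<^bsub>D\<^esub> Ide D (FO F x)) = LUnit D (FO F x)"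
    and U_right: "x \<in> Ob C \<Longrightarrow>
      FA F (RUnit C x) \<cdot>\<^bsub>D\<^esub> FJ F x (TUnit C) \<cdot>\<^bsub>D\<^esub> (Ide D (FO F x) \<otimes>\<^sub>a\<^bsub>D\<^esub> FU F) = RUnit D (FO F x)"

locale tensor_isomorphism =
  source: tensor_functor K C D F + target: tensor_functor K C D G
  for K :: "'k ring" and C :: "('o, 'a, 'k, 'y) mon_category_scheme"
    and D :: "('p, 'b, 'k, 'z) mon_category_scheme" and F G :: "('o, 'a, 'p, 'b) tensor_ftor" +
  fixes \<eta> :: "'o \<Rightarrow> 'b"
  assumes natural: "nat_transformation C D F G \<eta>"
    and iso: "x \<in> Ob C \<Longrightarrow> iso_arrow D (\<eta> x)"
    and monoidal: "\<lbrakk>x \<in> Ob C; y \<in> Ob C\<rbrakk> \<Longrightarrow>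
      \<eta> (x \<otimes>\<^sub>o\<^bsub>C\<^esub> y) \<cdot>\<^bsub>D\<^esub> FJ F x y = FJ G x y \<cdot>\<^bsub>D\<^esub> (\<eta> x \<otimes>\<^sub>a\<^bsub>D\<^esub> \<eta> y)"
    and monoidal_unit: "\<eta> (TUnit C) \<cdot>\<^bsub>D\<^esub> FU F = FU G"


section \<open>Module categories, module functors and module natural transformations\<close>

record ('m, 'n, 'k, 'o, 'a) mod_category = "('m, 'n, 'k) lin_category" +
  ActO :: "'o \<Rightarrow> 'm \<Rightarrow> 'm"  (infixr \<open>\<star>\<^sub>o\<index>\<close> 75)
  ActA :: "'a \<Rightarrow> 'n \<Rightarrow> 'n"  (infixr \<open>\<star>\<^sub>a\<index>\<close> 75)
  MAssoc :: "'o \<Rightarrow> 'o \<Rightarrow> 'm \<Rightarrow> 'n"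
  MUnit :: "'m \<Rightarrow> 'n"

text \<open>\<open>MAssoc\<close> has components \<open>(x \<otimes> y) \<star> m \<rightarrow> x \<star> (y \<star> m)\<close> and \<open>MUnit\<close> has components \<open>1 \<star> m \<rightarrow> m\<close>.\<close>

locale module_category =
  base: tensor_category K B + finite_abelian_category K M +
  act: bilinear_bifunctor K B M M "ActO M" "ActA M"
  for K :: "'k ring" and B :: "('o, 'a, 'k, 'y) mon_category_scheme"
    and M :: "('m, 'n, 'k, 'o, 'a) mod_category" +
  assumes act_exact_right: "x \<in> Ob B \<Longrightarrow>
      exact M M \<lparr>FO = (\<lambda>m. x \<star>\<^sub>o\<^bsub>M\<^esub> m), FA = (\<lambda>f. Ide B x \<star>\<^sub>a\<^bsub>M\<^esub> f)\<rparr>"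
    and act_exact_left: "m \<in> Ob M \<Longrightarrow>
      exact B M \<lparr>FO = (\<lambda>x. x \<star>\<^sub>o\<^bsub>M\<^esub> m), FA = (\<lambda>f. f \<star>\<^sub>a\<^bsub>M\<^esub> Ide M m)\<rparr>"
    and massoc_closed: "\<lbrakk>x \<in> Ob B; y \<in> Ob B; m \<in> Ob M\<rbrakk> \<Longrightarrow>
      MAssoc M x y m \<in> Hom M ((x \<otimes>\<^sub>o\<^bsub>B\<^esub> y) \<star>\<^sub>o\<^bsub>M\<^esub> m) (x \<star>\<^sub>o\<^bsub>M\<^esub> y \<star>\<^sub>o\<^bsub>M\<^esub> m)"
    and massoc_iso: "\<lbrakk>x \<in> Ob B; y \<in> Ob B; m \<in> Ob M\<rbrakk> \<Longrightarrow> iso_arrow M (MAssoc M x y m)"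
    and massoc_natural: "\<lbrakk>f \<in> Hom B x x'; g \<in> Hom B y y'; h \<in> Hom M m m'\<rbrakk> \<Longrightarrow>
      MAssoc M x' y' m' \<cdot>\<^bsub>M\<^esub> ((f \<otimes>\<^sub>a\<^bsub>B\<^esub> g) \<star>\<^sub>a\<^bsub>M\<^esub> h) = (f \<star>\<^sub>a\<^bsub>M\<^esub> g \<star>\<^sub>a\<^bsub>M\<^esub> h) \<cdot>\<^bsub>M\<^esub> MAssoc M x y m"
    and munit_closed: "m \<in> Ob M \<Longrightarrow> MUnit M m \<in> Hom M (TUnit B \<star>\<^sub>o\<^bsub>M\<^esub> m) m"
    and munit_iso: "m \<in> Ob M \<Longrightarrow> iso_arrow M (MUnit M m)"
    and munit_natural: "h \<in> Hom M m m' \<Longrightarrow>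
      MUnit M m' \<cdot>\<^bsub>M\<^esub> (Ide B (TUnit B) \<star>\<^sub>a\<^bsub>M\<^esub> h) = h \<cdot>\<^bsub>M\<^esub> MUnit M m"
    and mpentagon: "\<lbrakk>x \<in> Ob B; y \<in> Ob B; z \<in> Ob B; m \<in> Ob M\<rbrakk> \<Longrightarrow>
      MAssoc M x y (z \<star>\<^sub>o\<^bsub>M\<^esub> m) \<cdot>\<^bsub>M\<^esub> MAssoc M (x \<otimes>\<^sub>o\<^bsub>B\<^esub> y) z m
        = (Ide B x \<star>\<^sub>a\<^bsub>M\<^esub> MAssoc M y z m) \<cdot>\<^bsub>M\<^esub> MAssoc M x (y \<otimes>\<^sub>o\<^bsub>B\<^esub> z) m
            \<cdot>\<^bsub>M\<^esub> (Assoc B x y z \<star>\<^sub>a\<^bsub>M\<^esub> Ide M m)"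
    and mtriangle: "\<lbrakk>x \<in> Ob B; m \<in> Ob M\<rbrakk> \<Longrightarrow>
      (Ide B x \<star>\<^sub>a\<^bsub>M\<^esub> MUnit M m) \<cdot>\<^bsub>M\<^esub> MAssoc M x (TUnit B) m = RUnit B x \<star>\<^sub>a\<^bsub>M\<^esub> Ide M m"

text \<open>\<open>FS x m : x \<star> F m \<rightarrow> F (x \<star> m)\<close>. To make equality of functors the equality of their values on
  the source category, all components of a module functor (and, below, of a natural
  transformation) are required to be \<open>undefined\<close> off their domain.\<close>

record ('m, 'n, 'p, 'q, 'o) mod_ftor = "('m, 'n, 'p, 'q) ftor" +
  FS :: "'o \<Rightarrow> 'm \<Rightarrow> 'q"

locale module_functor =
  dom: module_category K B M + cod: module_category K B N + linear_functor K M N F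
  for K :: "'k ring" and B :: "('o, 'a, 'k, 'y) mon_category_scheme"
    and M :: "('m, 'n, 'k, 'o, 'a) mod_category" and N :: "('p, 'q, 'k, 'o, 'a) mod_category"
    and F :: "('m, 'n, 'p, 'q, 'o) mod_ftor" +
  assumes str_closed: "\<lbrakk>x \<in> Ob B; m \<in> Ob M\<rbrakk> \<Longrightarrow>
      FS F x m \<in> Hom N (x \<star>\<^sub>o\<^bsub>N\<^esub> FO F m) (FO F (x \<star>\<^sub>o\<^bsub>M\<^esub> m))"
    and str_iso: "\<lbrakk>x \<in> Ob B; m \<in> Ob M\<rbrakk> \<Longrightarrow> iso_arrow N (FS F x m)"
    and str_natural: "\<lbrakk>f \<in> Hom B x x'; h \<in> Hom M m m'\<rbrakk> \<Longrightarrow>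
      FS F x' m' \<cdot>\<^bsub>N\<^esub> (f \<star>\<^sub>a\<^bsub>N\<^esub> FA F h) = FA F (f \<star>\<^sub>a\<^bsub>M\<^esub> h) \<cdot>\<^bsub>N\<^esub> FS F x m"
    and str_assoc: "\<lbrakk>x \<in> Ob B; y \<in> Ob B; m \<in> Ob M\<rbrakk> \<Longrightarrow>
      FA F (MAssoc M x y m) \<cdot>\<^bsub>N\<^esub> FS F (x \<otimes>\<^sub>o\<^bsub>B\<^esub> y) m
        = FS F x (y \<star>\<^sub>o\<^bsub>M\<^esub> m) \<cdot>\<^bsub>N\<^esub> (Ide B x \<star>\<^sub>a\<^bsub>N\<^esub> FS F y m) \<cdot>\<^bsub>N\<^esub> MAssoc N x y (FO F m)"
    and str_unit: "m \<in> Ob M \<Longrightarrow> FA F (MUnit M m) \<cdot>\<^bsub>N\<^esub> FS F (TUnit B) m = MUnit N (FO F m)"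
    and ob_extensional: "FO F \<in> extensional (Ob M)"
    and arr_extensional: "FA F \<in> extensional (Arr M)"
    and str_extensional: "FS F \<in> extensional (Ob B)"
    and str_extensional': "x \<in> Ob B \<Longrightarrow> FS F x \<in> extensional (Ob M)"

record ('f, 'm, 'q) transf =
  TDom :: 'f
  TCod :: 'f
  Cmp :: "'m \<Rightarrow> 'q"

definition module_transformation ::
    "('o, 'a, 'k, 'y) mon_category_scheme \<Rightarrow> ('m, 'n, 'k, 'o, 'a) mod_category \<Rightarrow>
     ('p, 'q, 'k, 'o, 'a) mod_category \<Rightarrow> (('m, 'n, 'p, 'q, 'o) mod_ftor, 'm, 'q) transf \<Rightarrow> bool" where
  "module_transformation B M N t \<longleftrightarrow>
     nat_transformation M N (TDom t) (TCod t) (Cmp t) \<and> Cmp t \<in> extensional (Ob M) \<and>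
     (\<forall>x \<in> Ob B. \<forall>m \<in> Ob M.
        Cmp t (x \<star>\<^sub>o\<^bsub>M\<^esub> m) \<cdot>\<^bsub>N\<^esub> FS (TDom t) x m
          = FS (TCod t) x m \<cdot>\<^bsub>N\<^esub> (Ide B x \<star>\<^sub>a\<^bsub>N\<^esub> Cmp t m))"

definition Fun_mod ::
    "'k ring \<Rightarrow> ('o, 'a, 'k, 'y) mon_category_scheme \<Rightarrow> ('m, 'n, 'k, 'o, 'a) mod_category \<Rightarrow>
     ('p, 'q, 'k, 'o, 'a) mod_category \<Rightarrow>
     (('m, 'n, 'p, 'q, 'o) mod_ftor, (('m, 'n, 'p, 'q, 'o) mod_ftor, 'm, 'q) transf, 'k) lin_category"
  where
  "Fun_mod K B M N =
     \<lparr>Ob = {F. module_functor K B M N F \<and> right_exact M N F},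
      Arr = {t. module_functor K B M N (TDom t) \<and> right_exact M N (TDom t) \<and>
                module_functor K B M N (TCod t) \<and> right_exact M N (TCod t) \<and>
                module_transformation B M N t},
      Dom = TDom, Cod = TCod,
      Ide = (\<lambda>F. \<lparr>TDom = F, TCod = F, Cmp = (\<lambda>m \<in> Ob M. Ide N (FO F m))\<rparr>),
      Comp = (\<lambda>s t. \<lparr>TDom = TDom t, TCod = TCod s, Cmp = (\<lambda>m \<in> Ob M. Cmp s m \<cdot>\<^bsub>N\<^esub> Cmp t m)\<rparr>),
      Plus = (\<lambda>s t. \<lparr>TDom = TDom s, TCod = TCod s, Cmp = (\<lambda>m \<in> Ob M. Plus N (Cmp s m) (Cmp t m))\<rparr>),
      Zer = (\<lambda>F G. \<lparr>TDom = F, TCod = G, Cmp = (\<lambda>m \<in> Ob M. Zer N (FO F m) (FO G m))\<rparr>),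
      Scale = (\<lambda>a t. \<lparr>TDom = TDom t, TCod = TCod t, Cmp = (\<lambda>m \<in> Ob M. Scale N a (Cmp t m))\<rparr>)\<rparr>"

definition id_ftor ::
    "('o, 'a, 'k, 'y) mon_category_scheme \<Rightarrow> ('m, 'n, 'k, 'o, 'a) mod_category \<Rightarrow>
     ('m, 'n, 'm, 'n, 'o) mod_ftor" where
  "id_ftor B M = \<lparr>FO = (\<lambda>m \<in> Ob M. m), FA = (\<lambda>f \<in> Arr M. f),
     FS = (\<lambda>x \<in> Ob B. \<lambda>m \<in> Ob M. Ide M (x \<star>\<^sub>o\<^bsub>M\<^esub> m))\<rparr>"

text \<open>The composite \<open>G \<circ> F\<close> of \<open>F : M \<rightarrow> N\<close> and \<open>G : N \<rightarrow> P\<close>, and the horizontal composite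
  \<open>G \<circ> F \<rightarrow> G' \<circ> F'\<close> of \<open>t : F \<rightarrow> F'\<close> and \<open>s : G \<rightarrow> G'\<close>.\<close>

definition comp_ftor ::
    "('o, 'a, 'k, 'y) mon_category_scheme \<Rightarrow> ('m, 'n, 'k, 'o, 'a) mod_category \<Rightarrow>
     ('r, 's, 'k, 'o, 'a) mod_category \<Rightarrow> ('p, 'q, 'r, 's, 'o) mod_ftor \<Rightarrow>
     ('m, 'n, 'p, 'q, 'o) mod_ftor \<Rightarrow> ('m, 'n, 'r, 's, 'o) mod_ftor" where
  "comp_ftor B M P G F =
     \<lparr>FO = (\<lambda>m \<in> Ob M. FO G (FO F m)), FA = (\<lambda>f \<in> Arr M. FA G (FA F f)),
      FS = (\<lambda>x \<in> Ob B. \<lambda>m \<in> Ob M. FA G (FS F x m) \<cdot>\<^bsub>P\<^esub> FS G x (FO F m))\<rparr>"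

definition hcomp_transf ::
    "('o, 'a, 'k, 'y) mon_category_scheme \<Rightarrow> ('m, 'n, 'k, 'o, 'a) mod_category \<Rightarrow>
     ('r, 's, 'k, 'o, 'a) mod_category \<Rightarrow>
     (('p, 'q, 'r, 's, 'o) mod_ftor, 'p, 's) transf \<Rightarrow>
     (('m, 'n, 'p, 'q, 'o) mod_ftor, 'm, 'q) transf \<Rightarrow>
     (('m, 'n, 'r, 's, 'o) mod_ftor, 'm, 's) transf" where
  "hcomp_transf B M P s t =
     \<lparr>TDom = comp_ftor B M P (TDom s) (TDom t), TCod = comp_ftor B M P (TCod s) (TCod t),
      Cmp = (\<lambda>m \<in> Ob M. Cmp s (FO (TCod t) m) \<cdot>\<^bsub>P\<^esub> FA (TDom s) (Cmp t m))\<rparr>"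

definition End_mod ::
    "'k ring \<Rightarrow> ('o, 'a, 'k, 'y) mon_category_scheme \<Rightarrow> ('m, 'n, 'k, 'o, 'a) mod_category \<Rightarrow>
     (('m, 'n, 'm, 'n, 'o) mod_ftor, (('m, 'n, 'm, 'n, 'o) mod_ftor, 'm, 'n) transf, 'k) mon_category"
  where
  "End_mod K B M = (let E = Fun_mod K B M M in
     \<lparr>Ob = Ob E, Arr = Arr E, Dom = Dom E, Cod = Cod E, Ide = Ide E, Comp = Comp E,
      Plus = Plus E, Zer = Zer E, Scale = Scale E,
      TensorO = comp_ftor B M M, TensorA = hcomp_transf B M M, TUnit = id_ftor B M,
      Assoc = (\<lambda>F G H. Ide E (comp_ftor B M M (comp_ftor B M M F G) H)),
      LUnit = Ide E, RUnit = Ide E\<rparr>)"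


section \<open>Alpha-inductions\<close>

definition alpha_plus_ob ::
    "('o, 'a, 'k, 'y) br_category_scheme \<Rightarrow> ('m, 'n, 'k, 'o, 'a) mod_category \<Rightarrow> 'o \<Rightarrow>
     ('m, 'n, 'm, 'n, 'o) mod_ftor" where
  "alpha_plus_ob B M x =
     \<lparr>FO = (\<lambda>m \<in> Ob M. x \<star>\<^sub>o\<^bsub>M\<^esub> m), FA = (\<lambda>f \<in> Arr M. Ide B x \<star>\<^sub>a\<^bsub>M\<^esub> f),
      FS = (\<lambda>y \<in> Ob B. \<lambda>m \<in> Ob M.
        MAssoc M x y m \<cdot>\<^bsub>M\<^esub> (inv_braid B x y \<star>\<^sub>a\<^bsub>M\<^esub> Ide M m) \<cdot>\<^bsub>M\<^esub> inv_arrow M (MAssoc M y x m))\<rparr>"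

definition alpha_minus_ob ::
    "('o, 'a, 'k, 'y) br_category_scheme \<Rightarrow> ('m, 'n, 'k, 'o, 'a) mod_category \<Rightarrow> 'o \<Rightarrow>
     ('m, 'n, 'm, 'n, 'o) mod_ftor" where
  "alpha_minus_ob B M x =
     \<lparr>FO = (\<lambda>m \<in> Ob M. x \<star>\<^sub>o\<^bsub>M\<^esub> m), FA = (\<lambda>f \<in> Arr M. Ide B x \<star>\<^sub>a\<^bsub>M\<^esub> f),
      FS = (\<lambda>y \<in> Ob B. \<lambda>m \<in> Ob M.
        MAssoc M x y m \<cdot>\<^bsub>M\<^esub> (Braid B y x \<star>\<^sub>a\<^bsub>M\<^esub> Ide M m) \<cdot>\<^bsub>M\<^esub> inv_arrow M (MAssoc M y x m))\<rparr>"

text \<open>The tensor structure \<open>FJ y x\<close> goes from \<open>\<alpha>(y) \<circ> \<alpha>(x)\<close> to the value of \<open>\<alpha>\<close> at the product of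
  \<open>y\<close> and \<open>x\<close> in \<open>op_tensor B\<close>, that is, to \<open>\<alpha>(x \<otimes> y)\<close>.\<close>

definition alpha_plus ::
    "('o, 'a, 'k, 'y) br_category_scheme \<Rightarrow> ('m, 'n, 'k, 'o, 'a) mod_category \<Rightarrow>
     ('o, 'a, ('m, 'n, 'm, 'n, 'o) mod_ftor, (('m, 'n, 'm, 'n, 'o) mod_ftor, 'm, 'n) transf) tensor_ftor"
  where
  "alpha_plus B M =
     \<lparr>FO = alpha_plus_ob B M,
      FA = (\<lambda>f. \<lparr>TDom = alpha_plus_ob B M (Dom B f), TCod = alpha_plus_ob B M (Cod B f),
                 Cmp = (\<lambda>m \<in> Ob M. f \<star>\<^sub>a\<^bsub>M\<^esub> Ide M m)\<rparr>),
      FJ = (\<lambda>y x. \<lparr>TDom = comp_ftor B M M (alpha_plus_ob B M y) (alpha_plus_ob B M x),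
                   TCod = alpha_plus_ob B M (x \<otimes>\<^sub>o\<^bsub>B\<^esub> y),
                   Cmp = (\<lambda>m \<in> Ob M.
                     (Braid B y x \<star>\<^sub>a\<^bsub>M\<^esub> Ide M m) \<cdot>\<^bsub>M\<^esub> inv_arrow M (MAssoc M y x m))\<rparr>),
      FU = \<lparr>TDom = id_ftor B M, TCod = alpha_plus_ob B M (TUnit B),
            Cmp = (\<lambda>m \<in> Ob M. inv_arrow M (MUnit M m))\<rparr>\<rparr>"

definition alpha_minus ::
    "('o, 'a, 'k, 'y) br_category_scheme \<Rightarrow> ('m, 'n, 'k, 'o, 'a) mod_category \<Rightarrow>
     ('o, 'a, ('m, 'n, 'm, 'n, 'o) mod_ftor, (('m, 'n, 'm, 'n, 'o) mod_ftor, 'm, 'n) transf) tensor_ftor"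
  where
  "alpha_minus B M =
     \<lparr>FO = alpha_minus_ob B M,
      FA = (\<lambda>f. \<lparr>TDom = alpha_minus_ob B M (Dom B f), TCod = alpha_minus_ob B M (Cod B f),
                 Cmp = (\<lambda>m \<in> Ob M. f \<star>\<^sub>a\<^bsub>M\<^esub> Ide M m)\<rparr>),
      FJ = (\<lambda>y x. \<lparr>TDom = comp_ftor B M M (alpha_minus_ob B M y) (alpha_minus_ob B M x),
                   TCod = alpha_minus_ob B M (x \<otimes>\<^sub>o\<^bsub>B\<^esub> y),
                   Cmp = (\<lambda>m \<in> Ob M.
                     (inv_braid B x y \<star>\<^sub>a\<^bsub>M\<^esub> Ide M m) \<cdot>\<^bsub>M\<^esub> inv_arrow M (MAssoc M y x m))\<rparr>),
      FU = \<lparr>TDom = id_ftor B M, TCod = alpha_minus_ob B M (TUnit B),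
            Cmp = (\<lambda>m \<in> Ob M. inv_arrow M (MUnit M m))\<rparr>\<rparr>"


section \<open>Strict 2-categories and 2-equivalences\<close>

text \<open>A (strict) 2-category is presented by its Hom categories, whose objects are the 1-cells, whose
  arrows are the 2-cells and whose composition is vertical composition. For \<open>f : x \<rightarrow> y\<close> and
  \<open>g : y \<rightarrow> z\<close> the composite 1-cell is \<open>HC1 C x y z g f\<close>; \<open>HC2\<close> is horizontal composition of
  2-cells.\<close>

record ('x, 'f, 't) two_category =
  Ob2 :: "'x set"
  HomC :: "'x \<Rightarrow> 'x \<Rightarrow> ('f, 't) category"
  HC1 :: "'x \<Rightarrow> 'x \<Rightarrow> 'x \<Rightarrow> 'f \<Rightarrow> 'f \<Rightarrow> 'f"
  HC2 :: "'x \<Rightarrow> 'x \<Rightarrow> 'x \<Rightarrow> 't \<Rightarrow> 't \<Rightarrow> 't"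
  Id1 :: "'x \<Rightarrow> 'f"

abbreviation Cell1 :: "('x, 'f, 't) two_category \<Rightarrow> 'x \<Rightarrow> 'x \<Rightarrow> 'f set" where
  "Cell1 C x y \<equiv> Ob (HomC C x y)"

abbreviation Cell2 :: "('x, 'f, 't) two_category \<Rightarrow> 'x \<Rightarrow> 'x \<Rightarrow> 't set" where
  "Cell2 C x y \<equiv> Arr (HomC C x y)"

abbreviation Id2 :: "('x, 'f, 't) two_category \<Rightarrow> 'x \<Rightarrow> 'x \<Rightarrow> 'f \<Rightarrow> 't" where
  "Id2 C x y f \<equiv> Ide (HomC C x y) f"

locale two_category =
  fixes C :: "('x, 'f, 't) two_category"
  assumes hom_category: "\<lbrakk>x \<in> Ob2 C; y \<in> Ob2 C\<rbrakk> \<Longrightarrow> category (HomC C x y)"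
    and id1_closed: "x \<in> Ob2 C \<Longrightarrow> Id1 C x \<in> Cell1 C x x"
    and hc1_closed: "\<lbrakk>x \<in> Ob2 C; y \<in> Ob2 C; z \<in> Ob2 C; f \<in> Cell1 C x y; g \<in> Cell1 C y z\<rbrakk> \<Longrightarrow>
      HC1 C x y z g f \<in> Cell1 C x z"
    and hc2_closed: "\<lbrakk>x \<in> Ob2 C; y \<in> Ob2 C; z \<in> Ob2 C;
        t \<in> Hom (HomC C x y) f f'; s \<in> Hom (HomC C y z) g g'\<rbrakk> \<Longrightarrow>
      HC2 C x y z s t \<in> Hom (HomC C x z) (HC1 C x y z g f) (HC1 C x y z g' f')"
    and hc2_id2: "\<lbrakk>x \<in> Ob2 C; y \<in> Ob2 C; z \<in> Ob2 C; f \<in> Cell1 C x y; g \<in> Cell1 C y z\<rbrakk> \<Longrightarrow>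
      HC2 C x y z (Id2 C y z g) (Id2 C x y f) = Id2 C x z (HC1 C x y z g f)"
    and interchange: "\<lbrakk>x \<in> Ob2 C; y \<in> Ob2 C; z \<in> Ob2 C;
        t \<in> Hom (HomC C x y) f f'; t' \<in> Hom (HomC C x y) f' f'';
        s \<in> Hom (HomC C y z) g g'; s' \<in> Hom (HomC C y z) g' g''\<rbrakk> \<Longrightarrow>
      HC2 C x y z (s' \<cdot>\<^bsub>HomC C y z\<^esub> s) (t' \<cdot>\<^bsub>HomC C x y\<^esub> t)
        = HC2 C x y z s' t' \<cdot>\<^bsub>HomC C x z\<^esub> HC2 C x y z s t"
    and hc1_assoc: "\<lbrakk>x \<in> Ob2 C; y \<in> Ob2 C; z \<in> Ob2 C; w \<in> Ob2 C;
        f \<in> Cell1 C x y; g \<in> Cell1 C y z; h \<in> Cell1 C z w\<rbrakk> \<Longrightarrow>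
      HC1 C x y w (HC1 C y z w h g) f = HC1 C x z w h (HC1 C x y z g f)"
    and hc2_assoc: "\<lbrakk>x \<in> Ob2 C; y \<in> Ob2 C; z \<in> Ob2 C; w \<in> Ob2 C;
        t \<in> Cell2 C x y; s \<in> Cell2 C y z; r \<in> Cell2 C z w\<rbrakk> \<Longrightarrow>
      HC2 C x y w (HC2 C y z w r s) t = HC2 C x z w r (HC2 C x y z s t)"
    and hc1_id_left: "\<lbrakk>x \<in> Ob2 C; y \<in> Ob2 C; f \<in> Cell1 C x y\<rbrakk> \<Longrightarrow> HC1 C x y y (Id1 C y) f = f"
    and hc1_id_right: "\<lbrakk>x \<in> Ob2 C; y \<in> Ob2 C; f \<in> Cell1 C x y\<rbrakk> \<Longrightarrow> HC1 C x x y f (Id1 C x) = f"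
    and hc2_id_left: "\<lbrakk>x \<in> Ob2 C; y \<in> Ob2 C; t \<in> Cell2 C x y\<rbrakk> \<Longrightarrow>
      HC2 C x y y (Id2 C y y (Id1 C y)) t = t"
    and hc2_id_right: "\<lbrakk>x \<in> Ob2 C; y \<in> Ob2 C; t \<in> Cell2 C x y\<rbrakk> \<Longrightarrow>
      HC2 C x x y t (Id2 C x x (Id1 C x)) = t"

record ('x, 'f, 't, 'y, 'g, 's) two_ftor =
  TO :: "'x \<Rightarrow> 'y"
  TH :: "'x \<Rightarrow> 'x \<Rightarrow> ('f, 't, 'g, 's) ftor"

locale two_functor = dom: two_category C + cod: two_category D
  for C :: "('x, 'f, 't) two_category" and D :: "('y, 'g, 's) two_category" +
  fixes T :: "('x, 'f, 't, 'y, 'g, 's) two_ftor"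
  assumes to_closed: "x \<in> Ob2 C \<Longrightarrow> TO T x \<in> Ob2 D"
    and th_functor: "\<lbrakk>x \<in> Ob2 C; y \<in> Ob2 C\<rbrakk> \<Longrightarrow>
      cat_functor (HomC C x y) (HomC D (TO T x) (TO T y)) (TH T x y)"
    and preserves_id1: "x \<in> Ob2 C \<Longrightarrow> FO (TH T x x) (Id1 C x) = Id1 D (TO T x)"
    and preserves_hc1: "\<lbrakk>x \<in> Ob2 C; y \<in> Ob2 C; z \<in> Ob2 C; f \<in> Cell1 C x y; g \<in> Cell1 C y z\<rbrakk> \<Longrightarrow>
      FO (TH T x z) (HC1 C x y z g f)
        = HC1 D (TO T x) (TO T y) (TO T z) (FO (TH T y z) g) (FO (TH T x y) f)"
    and preserves_hc2: "\<lbrakk>x \<in> Ob2 C; y \<in> Ob2 C; z \<in> Ob2 C; t \<in> Cell2 C x y; s \<in> Cell2 C y z\<rbrakk> \<Longrightarrow>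
      FA (TH T x z) (HC2 C x y z s t)
        = HC2 D (TO T x) (TO T y) (TO T z) (FA (TH T y z) s) (FA (TH T x y) t)"

definition id_two_ftor :: "('x, 'f, 't, 'x, 'f, 't) two_ftor" where
  "id_two_ftor = \<lparr>TO = (\<lambda>x. x), TH = (\<lambda>x y. \<lparr>FO = (\<lambda>f. f), FA = (\<lambda>t. t)\<rparr>)\<rparr>"

definition comp_two_ftor ::
    "('y, 'g, 's, 'z, 'h, 'r) two_ftor \<Rightarrow> ('x, 'f, 't, 'y, 'g, 's) two_ftor \<Rightarrow>
     ('x, 'f, 't, 'z, 'h, 'r) two_ftor" where
  "comp_two_ftor S T = \<lparr>TO = (\<lambda>x. TO S (TO T x)),
     TH = (\<lambda>x y. \<lparr>FO = (\<lambda>f. FO (TH S (TO T x) (TO T y)) (FO (TH T x y) f)),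
                  FA = (\<lambda>t. FA (TH S (TO T x) (TO T y)) (FA (TH T x y) t))\<rparr>)\<rparr>"

locale two_natural_isomorphism = source: two_functor C D S + target: two_functor C D T
  for C :: "('x, 'f, 't) two_category" and D :: "('y, 'g, 's) two_category"
    and S T :: "('x, 'f, 't, 'y, 'g, 's) two_ftor" +
  fixes u :: "'x \<Rightarrow> 'g"
  assumes component_closed: "x \<in> Ob2 C \<Longrightarrow> u x \<in> Cell1 D (TO S x) (TO T x)"
    and component_invertible: "x \<in> Ob2 C \<Longrightarrow> \<exists>v \<in> Cell1 D (TO T x) (TO S x).
      HC1 D (TO S x) (TO T x) (TO S x) v (u x) = Id1 D (TO S x) \<and>
      HC1 D (TO T x) (TO S x) (TO T x) (u x) v = Id1 D (TO T x)"
    and natural1: "\<lbrakk>x \<in> Ob2 C; y \<in> Ob2 C; f \<in> Cell1 C x y\<rbrakk> \<Longrightarrow>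
      HC1 D (TO S x) (TO S y) (TO T y) (u y) (FO (TH S x y) f)
        = HC1 D (TO S x) (TO T x) (TO T y) (FO (TH T x y) f) (u x)"
    and natural2: "\<lbrakk>x \<in> Ob2 C; y \<in> Ob2 C; t \<in> Cell2 C x y\<rbrakk> \<Longrightarrow>
      HC2 D (TO S x) (TO S y) (TO T y) (Id2 D (TO S y) (TO T y) (u y)) (FA (TH S x y) t)
        = HC2 D (TO S x) (TO T x) (TO T y) (FA (TH T x y) t) (Id2 D (TO S x) (TO T x) (u x))"

definition two_equivalence ::
    "('x, 'f, 't) two_category \<Rightarrow> ('y, 'g, 's) two_category \<Rightarrow>
     ('x, 'f, 't, 'y, 'g, 's) two_ftor \<Rightarrow> bool" where
  "two_equivalence C D T \<longleftrightarrow> two_functor C D T \<and>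
     (\<exists>S. two_functor D C S \<and>
        (\<exists>u. two_natural_isomorphism C C id_two_ftor (comp_two_ftor S T) u) \<and>
        (\<exists>v. two_natural_isomorphism D D (comp_two_ftor T S) id_two_ftor v))"


section \<open>The two 2-categories\<close>

text \<open>Both 2-categories consist of module categories with extra structure (the underlying module
  category of \<open>(M, s)\<close> being \<open>M\<close>), of the right exact module functors satisfying a compatibility
  condition \<open>P\<close>, and of all module natural transformations between those.\<close>

definition structured_modules ::
    "'k ring \<Rightarrow> ('o, 'a, 'k, 'y) mon_category_scheme \<Rightarrow>
     (('m, 'n, 'k, 'o, 'a) mod_category \<times> 's) set \<Rightarrow>
     (('m, 'n, 'k, 'o, 'a) mod_category \<times> 's \<Rightarrow> ('m, 'n, 'k, 'o, 'a) mod_category \<times> 's \<Rightarrow>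
        ('m, 'n, 'm, 'n, 'o) mod_ftor \<Rightarrow> bool) \<Rightarrow>
     (('m, 'n, 'k, 'o, 'a) mod_category \<times> 's, ('m, 'n, 'm, 'n, 'o) mod_ftor,
        (('m, 'n, 'm, 'n, 'o) mod_ftor, 'm, 'n) transf) two_category" where
  "structured_modules K B A P =
     \<lparr>Ob2 = A,
      HomC = (\<lambda>x y. full_subcategory (Fun_mod K B (fst x) (fst y)) (P x y)),
      HC1 = (\<lambda>x y z. comp_ftor B (fst x) (fst z)),
      HC2 = (\<lambda>x y z. hcomp_transf B (fst x) (fst z)),
      Id1 = (\<lambda>x. id_ftor B (fst x))\<rparr>"

locale braided_module_category =
  base: braided_tensor_category K B + module_category K B M
  for K :: "'k ring" and B :: "('o, 'a, 'k, 'y) br_category_scheme"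
    and M :: "('m, 'n, 'k, 'o, 'a) mod_category" +
  fixes \<sigma> :: "'o \<Rightarrow> 'm \<Rightarrow> 'n"
  assumes sigma_closed: "\<lbrakk>x \<in> Ob B; m \<in> Ob M\<rbrakk> \<Longrightarrow> \<sigma> x m \<in> Hom M (x \<star>\<^sub>o\<^bsub>M\<^esub> m) (x \<star>\<^sub>o\<^bsub>M\<^esub> m)"
    and sigma_iso: "\<lbrakk>x \<in> Ob B; m \<in> Ob M\<rbrakk> \<Longrightarrow> iso_arrow M (\<sigma> x m)"
    and sigma_natural: "\<lbrakk>f \<in> Hom B x x'; h \<in> Hom M m m'\<rbrakk> \<Longrightarrow>
      \<sigma> x' m' \<cdot>\<^bsub>M\<^esub> (f \<star>\<^sub>a\<^bsub>M\<^esub> h) = (f \<star>\<^sub>a\<^bsub>M\<^esub> h) \<cdot>\<^bsub>M\<^esub> \<sigma> x m"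
    and sigma_unit: "m \<in> Ob M \<Longrightarrow> \<sigma> (TUnit B) m = Ide M (TUnit B \<star>\<^sub>o\<^bsub>M\<^esub> m)"
    and sigma_act: "\<lbrakk>x \<in> Ob B; y \<in> Ob B; m \<in> Ob M\<rbrakk> \<Longrightarrow>
      MAssoc M y x m \<cdot>\<^bsub>M\<^esub> (inv_braid B y x \<star>\<^sub>a\<^bsub>M\<^esub> Ide M m) \<cdot>\<^bsub>M\<^esub> inv_arrow M (MAssoc M x y m)
          \<cdot>\<^bsub>M\<^esub> \<sigma> x (y \<star>\<^sub>o\<^bsub>M\<^esub> m)
        = (Ide B y \<star>\<^sub>a\<^bsub>M\<^esub> \<sigma> x m) \<cdot>\<^bsub>M\<^esub> MAssoc M y x m \<cdot>\<^bsub>M\<^esub> (Braid B x y \<star>\<^sub>a\<^bsub>M\<^esub> Ide M m)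
            \<cdot>\<^bsub>M\<^esub> inv_arrow M (MAssoc M x y m)"
    and sigma_tensor: "\<lbrakk>x \<in> Ob B; y \<in> Ob B; m \<in> Ob M\<rbrakk> \<Longrightarrow>
      MAssoc M y x m \<cdot>\<^bsub>M\<^esub> (Braid B x y \<star>\<^sub>a\<^bsub>M\<^esub> Ide M m) \<cdot>\<^bsub>M\<^esub> \<sigma> (x \<otimes>\<^sub>o\<^bsub>B\<^esub> y) m
        = \<sigma> y (x \<star>\<^sub>o\<^bsub>M\<^esub> m) \<cdot>\<^bsub>M\<^esub> (Ide B y \<star>\<^sub>a\<^bsub>M\<^esub> \<sigma> x m) \<cdot>\<^bsub>M\<^esub> MAssoc M y x m
            \<cdot>\<^bsub>M\<^esub> (inv_braid B y x \<star>\<^sub>a\<^bsub>M\<^esub> Ide M m)"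
    and sigma_extensional: "\<sigma> \<in> extensional (Ob B)"
    and sigma_extensional': "x \<in> Ob B \<Longrightarrow> \<sigma> x \<in> extensional (Ob M)"

definition Mod_br ::
    "'k ring \<Rightarrow> ('o, 'a, 'k, 'y) br_category_scheme \<Rightarrow>
     (('m, 'n, 'k, 'o, 'a) mod_category \<times> ('o \<Rightarrow> 'm \<Rightarrow> 'n), ('m, 'n, 'm, 'n, 'o) mod_ftor,
        (('m, 'n, 'm, 'n, 'o) mod_ftor, 'm, 'n) transf) two_category" where
  "Mod_br K B = structured_modules K B
     {(M, \<sigma>). braided_module_category K B M \<sigma>}
     (\<lambda>(M, \<sigma>) (N, \<tau>) F. \<forall>x \<in> Ob B. \<forall>m \<in> Ob M.
        FS F x m \<cdot>\<^bsub>N\<^esub> \<tau> x (FO F m) = FA F (\<sigma> x m) \<cdot>\<^bsub>N\<^esub> FS F x m)"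

text \<open>\<open>\<eta> x\<close> is an arrow of \<open>End_mod K B M\<close>, and \<open>Cmp (\<eta> x) m\<close> its component at \<open>m\<close>.\<close>

definition A_mod ::
    "'k ring \<Rightarrow> ('o, 'a, 'k, 'y) br_category_scheme \<Rightarrow>
     (('m, 'n, 'k, 'o, 'a) mod_category \<times>
        ('o \<Rightarrow> (('m, 'n, 'm, 'n, 'o) mod_ftor, 'm, 'n) transf), ('m, 'n, 'm, 'n, 'o) mod_ftor,
        (('m, 'n, 'm, 'n, 'o) mod_ftor, 'm, 'n) transf) two_category" where
  "A_mod K B = structured_modules K B
     {(M, \<eta>). module_category K B M \<and>
        tensor_isomorphism K (op_tensor B) (End_mod K B M) (alpha_plus B M) (alpha_minus B M) \<eta> \<and>
        \<eta> \<in> extensional (Ob B)}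
     (\<lambda>(M, \<eta>) (N, \<theta>) F. \<forall>x \<in> Ob B. \<forall>m \<in> Ob M.
        FS F x m \<cdot>\<^bsub>N\<^esub> Cmp (\<theta> x) (FO F m) = FA F (Cmp (\<eta> x) m) \<cdot>\<^bsub>N\<^esub> FS F x m)"

text \<open>The canonical 2-functor sends \<open>(M, \<sigma>)\<close> to \<open>(M, \<eta>)\<close>, where \<open>\<eta>\<^sub>x\<close> has the components
  \<open>\<sigma>\<^sub>x\<^sub>,\<^sub>m\<close>, and it is the identity on 1-cells and 2-cells.\<close>

definition canonical_two_ftor ::
    "('o, 'a, 'k, 'y) br_category_scheme \<Rightarrow>
     (('m, 'n, 'k, 'o, 'a) mod_category \<times> ('o \<Rightarrow> 'm \<Rightarrow> 'n), ('m, 'n, 'm, 'n, 'o) mod_ftor,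
        (('m, 'n, 'm, 'n, 'o) mod_ftor, 'm, 'n) transf,
      ('m, 'n, 'k, 'o, 'a) mod_category \<times>
        ('o \<Rightarrow> (('m, 'n, 'm, 'n, 'o) mod_ftor, 'm, 'n) transf), ('m, 'n, 'm, 'n, 'o) mod_ftor,
        (('m, 'n, 'm, 'n, 'o) mod_ftor, 'm, 'n) transf) two_ftor" where
  "canonical_two_ftor B =
     \<lparr>TO = (\<lambda>(M, \<sigma>). (M, \<lambda>x \<in> Ob B.
        \<lparr>TDom = alpha_plus_ob B M x, TCod = alpha_minus_ob B M x, Cmp = (\<lambda>m \<in> Ob M. \<sigma> x m)\<rparr>)),
      TH = (\<lambda>x y. \<lparr>FO = (\<lambda>F. F), FA = (\<lambda>t. t)\<rparr>)\<rparr>"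

end

theory Submission
  imports Defs
begin

text \<open>The 2-equivalence is an isomorphism of 2-categories. Both sides have the same right exact module
  functors and the same transformations as cells, and the condition on 1-cells is literally the same
  equation once \<open>\<sigma>\<^sub>x\<^sub>,\<^sub>m\<close> is read as the component at \<open>m\<close> of \<open>\<eta>\<^sub>x\<close>. So everything rests on one bijection: for
  a fixed module category \<open>M\<close>, a braiding \<open>\<sigma>\<close> of \<open>M\<close> is the same thing as an isomorphism of tensor
  functors \<open>\<eta> : \<alpha>\<^sup>+ \<rightarrow> \<alpha>\<^sup>-\<close>. The reduction to this bijection is \<open>relabel_two_equivalence\<close>, and the
  bijection is given by \<open>twist_transf_tensor_iso\<close>, \<open>twist_of_braided\<close>, \<open>twist_of_transf\<close> and
  \<open>twist_transf_of\<close>.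

  The bijection itself matches the axioms one by one. Naturality of \<open>\<sigma>\<close> in both variables is naturality
  of \<open>\<eta>\<close> in \<open>x\<close> together with naturality of each \<open>\<eta>\<^sub>x\<close> in \<open>m\<close>. The module structures of \<open>\<alpha>\<^sup>+(x)\<close> and
  \<open>\<alpha>\<^sup>-(x)\<close> are built from isomorphisms that also occur in the first axiom of a braiding, and moving them to
  the other side turns this axiom into the statement that \<open>\<eta>\<^sub>x\<close> is a module transformation. In the same
  way the second axiom becomes the statement that \<open>\<eta>\<close> is monoidal, and \<open>\<sigma>\<^sub>1 = id\<close> becomes compatibility
  with the units. Invertibility is tested on components.

  Speaking of such isomorphisms presupposes that the alpha-inductions are tensor functors, and this
  is where the coherence of braidings enters. Conjugating the action of the braiding by associativity
  gives arrows \<open>swap x y m\<close> from \<open>x \<star> (y \<star> m)\<close> to \<open>y \<star> (x \<star> m)\<close>. In terms of these the two hexagons say that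
  passing a tensor product is passing its factors one after the other (\<open>hexagon1_act\<close>,
  \<open>hexagon2_act\<close>), which with naturality gives the Yang-Baxter equation (\<open>yang_baxter\<close>) and the
  behaviour at the unit object (\<open>swap_unit\<close>). The axioms of \<open>\<alpha>\<^sup>+\<close> are then short computations with swaps
  (\<open>alpha_tensor_functor\<close>). Since \<open>\<alpha>\<^sup>-\<close> is \<open>\<alpha>\<^sup>+\<close> for the reverse braiding \<open>c\<^sup>-\<^sup>1\<^sub>y\<^sub>,\<^sub>x\<close>, one argument for
  an arbitrary braiding with a chosen inverse covers both.\<close>



section \<open>Calculating with arrows\<close>

text \<open>Membership in \<open>Hom C x y\<close> is split into membership in \<open>Arr C\<close> and the values of \<open>Dom\<close> and \<open>Cod\<close>. A law
  stated with these has no object in its premises that is absent from the equation, so the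
  simplifier can use it as a conditional rewrite rule and settle all composability conditions by
  computing end points.\<close>

lemma Hom_iff: "f \<in> Hom C x y \<longleftrightarrow> f \<in> Arr C \<and> Dom C f = x \<and> Cod C f = y"
  by (auto simp: Hom_def)

context category
begin

lemma dom_ob [simp]: "f \<in> Arr C \<Longrightarrow> Dom C f \<in> Ob C"
  and cod_ob [simp]: "f \<in> Arr C \<Longrightarrow> Cod C f \<in> Ob C"
  by (rule dom_closed cod_closed; assumption)+

lemma ide_arr [simp]:
  assumes "x \<in> Ob C"
  shows "Ide C x \<in> Arr C" "Dom C (Ide C x) = x" "Cod C (Ide C x) = x"
  using ide_closed[OF assms] by (auto simp: Hom_iff)

lemma comp_arr [simp]:
  assumes "f \<in> Arr C" "g \<in> Arr C" "Cod C f = Dom C g"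
  shows "g \<cdot>\<^bsub>C\<^esub> f \<in> Arr C" "Dom C (g \<cdot>\<^bsub>C\<^esub> f) = Dom C f" "Cod C (g \<cdot>\<^bsub>C\<^esub> f) = Cod C g"
  using comp_closed[of f "Dom C f" "Cod C f" g "Cod C g"] assms by (auto simp: Hom_iff)

lemma assoc_arr [simp]:
  "\<lbrakk>f \<in> Arr C; g \<in> Arr C; h \<in> Arr C; Cod C f = Dom C g; Cod C g = Dom C h\<rbrakk>
    \<Longrightarrow> (h \<cdot>\<^bsub>C\<^esub> g) \<cdot>\<^bsub>C\<^esub> f = h \<cdot>\<^bsub>C\<^esub> (g \<cdot>\<^bsub>C\<^esub> f)"
  by (rule comp_assoc[of f "Dom C f" "Cod C f" g "Cod C g" h "Cod C h"]) (auto simp: Hom_iff)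

lemma comp_ide [simp]:
  "\<lbrakk>f \<in> Arr C; Dom C f = x\<rbrakk> \<Longrightarrow> f \<cdot>\<^bsub>C\<^esub> Ide C x = f"
  "\<lbrakk>f \<in> Arr C; Cod C f = x\<rbrakk> \<Longrightarrow> Ide C x \<cdot>\<^bsub>C\<^esub> f = f"
  using comp_ide_right[of f x "Cod C f"] comp_ide_left[of f "Dom C f" x] by (auto simp: Hom_iff)

text \<open>The form in which a relation between composites is applied inside a longer composite,
  composites being associated to the right.\<close>

lemma comp_extend:
  assumes "g \<cdot>\<^bsub>C\<^esub> f = h" "f \<in> Arr C" "g \<in> Arr C" "Cod C f = Dom C g" "k \<in> Arr C" "Cod C k = Dom C f"
  shows "g \<cdot>\<^bsub>C\<^esub> (f \<cdot>\<^bsub>C\<^esub> k) = h \<cdot>\<^bsub>C\<^esub> k"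
  using assms by (auto simp flip: assoc_arr)

lemma inverse_arrows_unique:
  assumes "inverse_arrows C f g" "inverse_arrows C f h"
  shows "g = h"
proof -
  have "g = (h \<cdot>\<^bsub>C\<^esub> f) \<cdot>\<^bsub>C\<^esub> g"
    using assms by (auto simp: inverse_arrows_def Hom_iff simp del: assoc_arr)
  also have "\<dots> = h \<cdot>\<^bsub>C\<^esub> (f \<cdot>\<^bsub>C\<^esub> g)"
    by (rule assoc_arr) (use assms in \<open>auto simp: inverse_arrows_def Hom_iff\<close>)
  also have "\<dots> = h"
    using assms by (auto simp: inverse_arrows_def Hom_iff)
  finally show ?thesis .
qed

lemma inv_arrow_eq: "inverse_arrows C f g \<Longrightarrow> inv_arrow C f = g"
  unfolding inv_arrow_def using inverse_arrows_unique by blast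

lemma inverse_arrows_inv: "iso_arrow C f \<Longrightarrow> inverse_arrows C f (inv_arrow C f)"
  unfolding iso_arrow_def using inv_arrow_eq by auto

lemma iso_arr [dest]: "iso_arrow C f \<Longrightarrow> f \<in> Arr C"
  by (auto simp: iso_arrow_def inverse_arrows_def)

lemma inv_arr [simp]:
  assumes "iso_arrow C f"
  shows "inv_arrow C f \<in> Arr C" "Dom C (inv_arrow C f) = Cod C f" "Cod C (inv_arrow C f) = Dom C f"
    "inv_arrow C f \<cdot>\<^bsub>C\<^esub> f = Ide C (Dom C f)" "f \<cdot>\<^bsub>C\<^esub> inv_arrow C f = Ide C (Cod C f)"
  using inverse_arrows_inv[OF assms] by (auto simp: inverse_arrows_def Hom_iff)

lemma inv_comp_cancel [simp]:
  assumes "iso_arrow C f" "k \<in> Arr C"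
  shows "Cod C k = Dom C f \<Longrightarrow> inv_arrow C f \<cdot>\<^bsub>C\<^esub> (f \<cdot>\<^bsub>C\<^esub> k) = k"
    "Cod C k = Cod C f \<Longrightarrow> f \<cdot>\<^bsub>C\<^esub> (inv_arrow C f \<cdot>\<^bsub>C\<^esub> k) = k"
  using assms iso_arr[OF assms(1)] by (auto simp flip: assoc_arr)

lemma isoI:
  assumes "f \<in> Arr C" "g \<in> Arr C" "Dom C g = Cod C f" "Cod C g = Dom C f"
    "g \<cdot>\<^bsub>C\<^esub> f = Ide C (Dom C f)" "f \<cdot>\<^bsub>C\<^esub> g = Ide C (Cod C f)"
  shows "iso_arrow C f" "inv_arrow C f = g"
proof -
  have "inverse_arrows C f g"
    using assms by (auto simp: inverse_arrows_def Hom_iff)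
  then show "iso_arrow C f" "inv_arrow C f = g"
    by (auto simp: iso_arrow_def inv_arrow_eq)
qed

lemma iso_ide [simp]:
  assumes "x \<in> Ob C" shows "iso_arrow C (Ide C x)" "inv_arrow C (Ide C x) = Ide C x"
  using isoI[of "Ide C x" "Ide C x"] assms by auto

lemma iso_inv [simp]:
  assumes "iso_arrow C f" shows "iso_arrow C (inv_arrow C f)" "inv_arrow C (inv_arrow C f) = f"
  using isoI[of "inv_arrow C f" f] assms by auto

lemma iso_comp [simp]:
  assumes "iso_arrow C f" "iso_arrow C g" "Cod C f = Dom C g"
  shows "iso_arrow C (g \<cdot>\<^bsub>C\<^esub> f)" "inv_arrow C (g \<cdot>\<^bsub>C\<^esub> f) = inv_arrow C f \<cdot>\<^bsub>C\<^esub> inv_arrow C g"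
  using isoI[of "g \<cdot>\<^bsub>C\<^esub> f" "inv_arrow C f \<cdot>\<^bsub>C\<^esub> inv_arrow C g"] assms
    iso_arr[OF assms(1)] iso_arr[OF assms(2)] by auto

lemma cancel_right:
  assumes "iso_arrow C g" "f \<cdot>\<^bsub>C\<^esub> g = f' \<cdot>\<^bsub>C\<^esub> g" "f \<in> Arr C" "f' \<in> Arr C"
    "Dom C f = Cod C g" "Dom C f' = Cod C g"
  shows "f = f'"
proof -
  have "g \<in> Arr C"
    using assms(1) by (rule iso_arr)
  then have "f = (f \<cdot>\<^bsub>C\<^esub> g) \<cdot>\<^bsub>C\<^esub> inv_arrow C g" "f' = (f' \<cdot>\<^bsub>C\<^esub> g) \<cdot>\<^bsub>C\<^esub> inv_arrow C g"
    using assms(1,3-) by simp_all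
  then show ?thesis
    by (simp only: assms(2))
qed

lemma move_inv_left:
  assumes "iso_arrow C g" "g \<cdot>\<^bsub>C\<^esub> f = h" "f \<in> Arr C" "Cod C f = Dom C g"
  shows "f = inv_arrow C g \<cdot>\<^bsub>C\<^esub> h"
  using assms iso_arr[OF assms(1)] by auto

lemma move_inv_right:
  assumes "iso_arrow C g" "f \<cdot>\<^bsub>C\<^esub> g = h" "f \<in> Arr C" "Dom C f = Cod C g"
  shows "f = h \<cdot>\<^bsub>C\<^esub> inv_arrow C g"
  using assms iso_arr[OF assms(1)] by auto

text \<open>Inverting two opposite sides of a commuting square; most passages between an equation and its
  inverse form below are instances.\<close>

lemma inverse_square:
  assumes "g \<cdot>\<^bsub>C\<^esub> a = b \<cdot>\<^bsub>C\<^esub> f" "iso_arrow C f" "iso_arrow C g" "a \<in> Arr C" "b \<in> Arr C"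
    "Dom C a = Dom C f" "Cod C a = Dom C g" "Dom C b = Cod C f" "Cod C b = Cod C g"
  shows "inv_arrow C g \<cdot>\<^bsub>C\<^esub> b = a \<cdot>\<^bsub>C\<^esub> inv_arrow C f"
proof -
  have f: "f \<in> Arr C" "g \<in> Arr C"
    using assms(2,3) by auto
  have "a = inv_arrow C g \<cdot>\<^bsub>C\<^esub> (b \<cdot>\<^bsub>C\<^esub> f)"
    using assms f by (intro move_inv_left) auto
  then show ?thesis
    using assms f by simp
qed

end

context cat_functor
begin

lemma FO_ob [simp]: "x \<in> Ob C \<Longrightarrow> FO F x \<in> Ob D"
  by (rule ob_closed)

lemma FA_arr [simp]:
  assumes "f \<in> Arr C"
  shows "FA F f \<in> Arr D" "Dom D (FA F f) = FO F (Dom C f)" "Cod D (FA F f) = FO F (Cod C f)"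
  using arr_closed[of f "Dom C f" "Cod C f"] assms by (auto simp: Hom_iff)

lemma FA_ide [simp]: "x \<in> Ob C \<Longrightarrow> FA F (Ide C x) = Ide D (FO F x)"
  by (rule preserves_ide)

lemma FA_comp [simp]:
  "\<lbrakk>f \<in> Arr C; g \<in> Arr C; Cod C f = Dom C g\<rbrakk> \<Longrightarrow> FA F (g \<cdot>\<^bsub>C\<^esub> f) = FA F g \<cdot>\<^bsub>D\<^esub> FA F f"
  by (rule preserves_comp[of f "Dom C f" "Cod C f" g "Cod C g"]) (auto simp: Hom_iff)

lemma FA_iso [simp]:
  assumes "iso_arrow C f"
  shows "iso_arrow D (FA F f)" "inv_arrow D (FA F f) = FA F (inv_arrow C f)"
  using cod.isoI[of "FA F f" "FA F (inv_arrow C f)"] assms dom.iso_arr[OF assms]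
  by (auto simp flip: FA_comp)

end

context linear_category
begin

lemma plus_arr [simp]:
  assumes "f \<in> Arr C" "g \<in> Arr C" "Dom C f = Dom C g" "Cod C f = Cod C g"
  shows "Plus C f g \<in> Arr C" "Dom C (Plus C f g) = Dom C g" "Cod C (Plus C f g) = Cod C g"
proof -
  interpret H: Module.module K "Hom_module C (Dom C g) (Cod C g)"
    using assms by (intro hom_module) auto
  have "Plus C f g \<in> Hom C (Dom C g) (Cod C g)"
    using H.a_closed[of f g] assms by (auto simp: Hom_module_def Hom_iff)
  then show "Plus C f g \<in> Arr C" "Dom C (Plus C f g) = Dom C g" "Cod C (Plus C f g) = Cod C g"
    by (auto simp: Hom_iff)
qed

lemma scale_arr [simp]:
  assumes "f \<in> Arr C" "a \<in> carrier K"
  shows "Scale C a f \<in> Arr C" "Dom C (Scale C a f) = Dom C f" "Cod C (Scale C a f) = Cod C f"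
proof -
  interpret H: Module.module K "Hom_module C (Dom C f) (Cod C f)"
    using assms by (intro hom_module) auto
  have "Scale C a f \<in> Hom C (Dom C f) (Cod C f)"
    using H.smult_closed[of a f] assms by (auto simp: Hom_module_def Hom_iff)
  then show "Scale C a f \<in> Arr C" "Dom C (Scale C a f) = Dom C f" "Cod C (Scale C a f) = Cod C f"
    by (auto simp: Hom_iff)
qed

lemma zer_arr [simp]:
  assumes "x \<in> Ob C" "y \<in> Ob C"
  shows "Zer C x y \<in> Arr C" "Dom C (Zer C x y) = x" "Cod C (Zer C x y) = y"
proof -
  interpret H: Module.module K "Hom_module C x y"
    using assms by (intro hom_module) auto
  have "Zer C x y \<in> Hom C x y"
    using H.zero_closed by (auto simp: Hom_module_def)
  then show "Zer C x y \<in> Arr C" "Dom C (Zer C x y) = x" "Cod C (Zer C x y) = y"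
    by (auto simp: Hom_iff)
qed

lemma hom_laws:
  assumes f: "f \<in> Arr C"
  shows "\<lbrakk>g \<in> Arr C; h \<in> Arr C; Dom C g = Dom C f; Dom C h = Dom C f; Cod C g = Cod C f;
     Cod C h = Cod C f\<rbrakk> \<Longrightarrow> Plus C (Plus C f g) h = Plus C f (Plus C g h)"
  and "\<lbrakk>g \<in> Arr C; Dom C g = Dom C f; Cod C g = Cod C f\<rbrakk> \<Longrightarrow> Plus C f g = Plus C g f"
  and "\<lbrakk>Dom C f = x; Cod C f = y\<rbrakk> \<Longrightarrow> Plus C (Zer C x y) f = f"
  and "Plus C (Scale C (\<ominus>\<^bsub>K\<^esub> \<one>\<^bsub>K\<^esub>) f) f = Zer C (Dom C f) (Cod C f)"
  and "\<lbrakk>a \<in> carrier K; b \<in> carrier K\<rbrakk>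
    \<Longrightarrow> Scale C (a \<oplus>\<^bsub>K\<^esub> b) f = Plus C (Scale C a f) (Scale C b f)"
  and "\<lbrakk>g \<in> Arr C; Dom C g = Dom C f; Cod C g = Cod C f; a \<in> carrier K\<rbrakk>
    \<Longrightarrow> Scale C a (Plus C f g) = Plus C (Scale C a f) (Scale C a g)"
  and "\<lbrakk>a \<in> carrier K; b \<in> carrier K\<rbrakk>
    \<Longrightarrow> Scale C (a \<otimes>\<^bsub>K\<^esub> b) f = Scale C a (Scale C b f)"
  and "Scale C \<one>\<^bsub>K\<^esub> f = f"
proof -
  interpret H: Module.module K "Hom_module C (Dom C f) (Cod C f)"
    using f by (intro hom_module) auto
  note [simp] = Hom_module_def Hom_iff
  show "\<lbrakk>g \<in> Arr C; h \<in> Arr C; Dom C g = Dom C f; Dom C h = Dom C f; Cod C g = Cod C f;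
      Cod C h = Cod C f\<rbrakk> \<Longrightarrow> Plus C (Plus C f g) h = Plus C f (Plus C g h)"
    using H.a_assoc[of f g h] f by simp
  show "\<lbrakk>g \<in> Arr C; Dom C g = Dom C f; Cod C g = Cod C f\<rbrakk> \<Longrightarrow> Plus C f g = Plus C g f"
    using H.a_comm[of f g] f by simp
  show "\<lbrakk>Dom C f = x; Cod C f = y\<rbrakk> \<Longrightarrow> Plus C (Zer C x y) f = f"
    using H.l_zero[of f] f by simp
  show "Plus C (Scale C (\<ominus>\<^bsub>K\<^esub> \<one>\<^bsub>K\<^esub>) f) f = Zer C (Dom C f) (Cod C f)"
    using H.smult_l_minus[of "\<one>\<^bsub>K\<^esub>" f] H.smult_one[of f] H.l_neg[of f] f by simp
  show "\<lbrakk>a \<in> carrier K; b \<in> carrier K\<rbrakk>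
    \<Longrightarrow> Scale C (a \<oplus>\<^bsub>K\<^esub> b) f = Plus C (Scale C a f) (Scale C b f)"
    using H.smult_l_distr[of a b f] f by simp
  show "\<lbrakk>g \<in> Arr C; Dom C g = Dom C f; Cod C g = Cod C f; a \<in> carrier K\<rbrakk>
    \<Longrightarrow> Scale C a (Plus C f g) = Plus C (Scale C a f) (Scale C a g)"
    using H.smult_r_distr[of a f g] f by simp
  show "\<lbrakk>a \<in> carrier K; b \<in> carrier K\<rbrakk>
    \<Longrightarrow> Scale C (a \<otimes>\<^bsub>K\<^esub> b) f = Scale C a (Scale C b f)"
    using H.smult_assoc1[of a b f] f by simp
  show "Scale C \<one>\<^bsub>K\<^esub> f = f"
    using H.smult_one[of f] f by simp
qed

lemma comp_plus [simp]:
  "\<lbrakk>f \<in> Arr C; g \<in> Arr C; g' \<in> Arr C; Dom C g = Cod C f; Dom C g' = Cod C f; Cod C g = Cod C g'\<rbrakk>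
    \<Longrightarrow> Plus C g g' \<cdot>\<^bsub>C\<^esub> f = Plus C (g \<cdot>\<^bsub>C\<^esub> f) (g' \<cdot>\<^bsub>C\<^esub> f)"
  "\<lbrakk>f \<in> Arr C; f' \<in> Arr C; g \<in> Arr C; Cod C f = Dom C g; Cod C f' = Dom C g; Dom C f = Dom C f'\<rbrakk>
    \<Longrightarrow> g \<cdot>\<^bsub>C\<^esub> Plus C f f' = Plus C (g \<cdot>\<^bsub>C\<^esub> f) (g \<cdot>\<^bsub>C\<^esub> f')"
  using comp_plus_left[of f "Dom C f" "Cod C f" g "Cod C g" g']
    comp_plus_right[of f "Dom C f" "Cod C f" f' g "Cod C g"]
  by (auto simp: Hom_iff)

lemma comp_scale [simp]:
  "\<lbrakk>a \<in> carrier K; f \<in> Arr C; g \<in> Arr C; Cod C f = Dom C g\<rbrakk>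
    \<Longrightarrow> Scale C a g \<cdot>\<^bsub>C\<^esub> f = Scale C a (g \<cdot>\<^bsub>C\<^esub> f)"
  "\<lbrakk>a \<in> carrier K; f \<in> Arr C; g \<in> Arr C; Cod C f = Dom C g\<rbrakk>
    \<Longrightarrow> g \<cdot>\<^bsub>C\<^esub> Scale C a f = Scale C a (g \<cdot>\<^bsub>C\<^esub> f)"
  using comp_scale_left[of a f "Dom C f" "Cod C f" g "Cod C g"]
    comp_scale_right[of a f "Dom C f" "Cod C f" g "Cod C g"]
  by (auto simp: Hom_iff)

text \<open>Zero arrows are zero multiples, hence whatever respects scalars respects them too.\<close>

lemma scale_zero:
  assumes "f \<in> Hom C x y"
  shows "Scale C \<zero>\<^bsub>K\<^esub> f = Zer C x y"
proof -
  interpret H: Module.module K "Hom_module C x y"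
    using assms by (intro hom_module) (auto simp: Hom_iff)
  show ?thesis
    using H.smult_l_null[of f] assms by (simp add: Hom_module_def)
qed

lemma comp_zer [simp]:
  "\<lbrakk>f \<in> Arr C; Cod C f = y; z \<in> Ob C\<rbrakk> \<Longrightarrow> Zer C y z \<cdot>\<^bsub>C\<^esub> f = Zer C (Dom C f) z"
  "\<lbrakk>f \<in> Arr C; Dom C f = y; x \<in> Ob C\<rbrakk> \<Longrightarrow> f \<cdot>\<^bsub>C\<^esub> Zer C x y = Zer C x (Cod C f)"
proof -
  assume *: "f \<in> Arr C" "Cod C f = y" "z \<in> Ob C"
  then have [simp]: "y \<in> Ob C" by auto
  show "Zer C y z \<cdot>\<^bsub>C\<^esub> f = Zer C (Dom C f) z"
    using comp_scale(1)[of "\<zero>\<^bsub>K\<^esub>" f "Zer C y z"] *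
      scale_zero[of "Zer C y z" y z] scale_zero[of "Zer C y z \<cdot>\<^bsub>C\<^esub> f" "Dom C f" z]
    by (auto simp: Hom_iff)
next
  assume *: "f \<in> Arr C" "Dom C f = y" "x \<in> Ob C"
  then have [simp]: "y \<in> Ob C" by auto
  show "f \<cdot>\<^bsub>C\<^esub> Zer C x y = Zer C x (Cod C f)"
    using comp_scale(2)[of "\<zero>\<^bsub>K\<^esub>" "Zer C x y" f] *
      scale_zero[of "Zer C x y" x y] scale_zero[of "f \<cdot>\<^bsub>C\<^esub> Zer C x y" x "Cod C f"]
    by (auto simp: Hom_iff)
qed

end

context linear_functor
begin

lemma FA_plus [simp]:
  "\<lbrakk>f \<in> Arr C; g \<in> Arr C; Dom C f = Dom C g; Cod C f = Cod C g\<rbrakk>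
    \<Longrightarrow> FA F (Plus C f g) = Plus D (FA F f) (FA F g)"
  by (rule preserves_plus[of f "Dom C f" "Cod C f"]) (auto simp: Hom_iff)

lemma FA_scale [simp]:
  "\<lbrakk>a \<in> carrier K; f \<in> Arr C\<rbrakk> \<Longrightarrow> FA F (Scale C a f) = Scale D a (FA F f)"
  by (rule preserves_scale[of a f "Dom C f" "Cod C f"]) (auto simp: Hom_iff)

end

context bilinear_bifunctor
begin

lemma BO_ob [simp]: "\<lbrakk>x \<in> Ob C; y \<in> Ob D\<rbrakk> \<Longrightarrow> BO x y \<in> Ob E"
  by (rule bi_ob_closed)

lemma BA_arr [simp]:
  assumes "f \<in> Arr C" "g \<in> Arr D"
  shows "BA f g \<in> Arr E" "Dom E (BA f g) = BO (Dom C f) (Dom D g)"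
    "Cod E (BA f g) = BO (Cod C f) (Cod D g)"
  using bi_arr_closed[of f "Dom C f" "Cod C f" g "Dom D g" "Cod D g"] assms by (auto simp: Hom_iff)

lemma BA_ide [simp]: "\<lbrakk>x \<in> Ob C; y \<in> Ob D\<rbrakk> \<Longrightarrow> BA (Ide C x) (Ide D y) = Ide E (BO x y)"
  by (rule bi_ide)

text \<open>Composites of values of a bifunctor are collected into a single value, so that equations
  between them reduce to equations in the two factors.\<close>

lemma BA_comp:
  "\<lbrakk>f \<in> Arr C; f' \<in> Arr C; g \<in> Arr D; g' \<in> Arr D; Cod C f = Dom C f'; Cod D g = Dom D g'\<rbrakk>
    \<Longrightarrow> BA f' g' \<cdot>\<^bsub>E\<^esub> BA f g = BA (f' \<cdot>\<^bsub>C\<^esub> f) (g' \<cdot>\<^bsub>D\<^esub> g)"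
  by (rule bi_comp[symmetric, of f "Dom C f" "Cod C f" f' "Cod C f'" g "Dom D g" "Cod D g" g' "Cod D g'"])
    (auto simp: Hom_iff)

lemma BA_comp_extend:
  "\<lbrakk>f \<in> Arr C; f' \<in> Arr C; g \<in> Arr D; g' \<in> Arr D; Cod C f = Dom C f'; Cod D g = Dom D g';
     k \<in> Arr E; Cod E k = BO (Dom C f) (Dom D g)\<rbrakk>
    \<Longrightarrow> BA f' g' \<cdot>\<^bsub>E\<^esub> (BA f g \<cdot>\<^bsub>E\<^esub> k) = BA (f' \<cdot>\<^bsub>C\<^esub> f) (g' \<cdot>\<^bsub>D\<^esub> g) \<cdot>\<^bsub>E\<^esub> k"
  by (rule target.comp_extend[OF BA_comp]) auto

lemmas BA_collect = BA_comp BA_comp_extend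

lemma BA_iso [simp]:
  assumes "iso_arrow C f" "iso_arrow D g"
  shows "iso_arrow E (BA f g)" "inv_arrow E (BA f g) = BA (inv_arrow C f) (inv_arrow D g)"
  using target.isoI[of "BA f g" "BA (inv_arrow C f) (inv_arrow D g)"] assms
    first.iso_arr[OF assms(1)] second.iso_arr[OF assms(2)]
  by (auto simp: BA_comp)

lemma BA_plus [simp]:
  "\<lbrakk>f \<in> Arr C; f' \<in> Arr C; g \<in> Arr D; Dom C f = Dom C f'; Cod C f = Cod C f'\<rbrakk>
    \<Longrightarrow> BA (Plus C f f') g = Plus E (BA f g) (BA f' g)"
  "\<lbrakk>f \<in> Arr C; g \<in> Arr D; g' \<in> Arr D; Dom D g = Dom D g'; Cod D g = Cod D g'\<rbrakk>
    \<Longrightarrow> BA f (Plus D g g') = Plus E (BA f g) (BA f g')"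
  using bi_plus_left[of f "Dom C f" "Cod C f" f' g "Dom D g" "Cod D g"]
    bi_plus_right[of f "Dom C f" "Cod C f" g "Dom D g" "Cod D g" g']
  by (auto simp: Hom_iff)

lemma BA_scale [simp]:
  "\<lbrakk>a \<in> carrier K; f \<in> Arr C; g \<in> Arr D\<rbrakk> \<Longrightarrow> BA (Scale C a f) g = Scale E a (BA f g)"
  "\<lbrakk>a \<in> carrier K; f \<in> Arr C; g \<in> Arr D\<rbrakk> \<Longrightarrow> BA f (Scale D a g) = Scale E a (BA f g)"
  using bi_scale_left[of a f "Dom C f" "Cod C f" g "Dom D g" "Cod D g"]
    bi_scale_right[of a f "Dom C f" "Cod C f" g "Dom D g" "Cod D g"]
  by (auto simp: Hom_iff)

lemma BA_zer_right [simp]: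
  assumes "f \<in> Arr C" "y \<in> Ob D" "y' \<in> Ob D"
  shows "BA f (Zer D y y') = Zer E (BO (Dom C f) y) (BO (Cod C f) y')"
  using second.scale_zero[of "Zer D y y'" y y']
    target.scale_zero[of "BA f (Zer D y y')" "BO (Dom C f) y" "BO (Cod C f) y'"]
    BA_scale(2)[of "\<zero>\<^bsub>K\<^esub>" f "Zer D y y'"] assms
  by (auto simp: Hom_iff)

end


section \<open>The category of module functors\<close>

context module_category
begin

lemma massoc_arr [simp]:
  assumes "x \<in> Ob B" "y \<in> Ob B" "m \<in> Ob M"
  shows "MAssoc M x y m \<in> Arr M"
    "Dom M (MAssoc M x y m) = (x \<otimes>\<^sub>o\<^bsub>B\<^esub> y) \<star>\<^sub>o\<^bsub>M\<^esub> m" "Cod M (MAssoc M x y m) = x \<star>\<^sub>o\<^bsub>M\<^esub> y \<star>\<^sub>o\<^bsub>M\<^esub> m"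
    "iso_arrow M (MAssoc M x y m)"
  using massoc_closed[OF assms] massoc_iso[OF assms] by (auto simp: Hom_iff)

lemma munit_arr [simp]:
  assumes "m \<in> Ob M"
  shows "MUnit M m \<in> Arr M" "Dom M (MUnit M m) = TUnit B \<star>\<^sub>o\<^bsub>M\<^esub> m" "Cod M (MUnit M m) = m"
    "iso_arrow M (MUnit M m)"
  using munit_closed[OF assms] munit_iso[OF assms] by (auto simp: Hom_iff)

lemma massoc_nat:
  "\<lbrakk>f \<in> Arr B; g \<in> Arr B; h \<in> Arr M; Cod B f = x; Cod B g = y; Cod M h = m\<rbrakk> \<Longrightarrow>
    MAssoc M x y m \<cdot>\<^bsub>M\<^esub> ((f \<otimes>\<^sub>a\<^bsub>B\<^esub> g) \<star>\<^sub>a\<^bsub>M\<^esub> h)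
      = (f \<star>\<^sub>a\<^bsub>M\<^esub> g \<star>\<^sub>a\<^bsub>M\<^esub> h) \<cdot>\<^bsub>M\<^esub> MAssoc M (Dom B f) (Dom B g) (Dom M h)"
  by (rule massoc_natural) (auto simp: Hom_iff)

lemma munit_nat:
  "\<lbrakk>h \<in> Arr M; Cod M h = m\<rbrakk> \<Longrightarrow>
    MUnit M m \<cdot>\<^bsub>M\<^esub> (Ide B (TUnit B) \<star>\<^sub>a\<^bsub>M\<^esub> h) = h \<cdot>\<^bsub>M\<^esub> MUnit M (Dom M h)"
  by (rule munit_natural) (auto simp: Hom_iff)

lemma tunit_ob [simp]: "TUnit B \<in> Ob B"
  by (rule base.unit_closed)

end

lemma right_exactI:
  "(\<And>f q. is_cokernel C f q \<Longrightarrow> is_cokernel D (FA F f) (FA F q)) \<Longrightarrow> right_exact C D F"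
  by (auto simp: right_exact_def)

lemma Fun_mod_simps [simp]:
  "F \<in> Ob (Fun_mod K B M N) \<longleftrightarrow> module_functor K B M N F \<and> right_exact M N F"
  "Dom (Fun_mod K B M N) t = TDom t"
  "Cod (Fun_mod K B M N) t = TCod t"
  "Ide (Fun_mod K B M N) F = \<lparr>TDom = F, TCod = F, Cmp = (\<lambda>m \<in> Ob M. Ide N (FO F m))\<rparr>"
  "Comp (Fun_mod K B M N) s t = \<lparr>TDom = TDom t, TCod = TCod s, Cmp = (\<lambda>m \<in> Ob M. Cmp s m \<cdot>\<^bsub>N\<^esub> Cmp t m)\<rparr>"
  "Plus (Fun_mod K B M N) s t
    = \<lparr>TDom = TDom s, TCod = TCod s, Cmp = (\<lambda>m \<in> Ob M. Plus N (Cmp s m) (Cmp t m))\<rparr>"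
  "Zer (Fun_mod K B M N) F G = \<lparr>TDom = F, TCod = G, Cmp = (\<lambda>m \<in> Ob M. Zer N (FO F m) (FO G m))\<rparr>"
  "Scale (Fun_mod K B M N) a t
    = \<lparr>TDom = TDom t, TCod = TCod t, Cmp = (\<lambda>m \<in> Ob M. Scale N a (Cmp t m))\<rparr>"
  by (auto simp: Fun_mod_def)

lemma Fun_mod_arr_iff:
  "t \<in> Arr (Fun_mod K B M N) \<longleftrightarrow>
    TDom t \<in> Ob (Fun_mod K B M N) \<and> TCod t \<in> Ob (Fun_mod K B M N) \<and> module_transformation B M N t"
  by (auto simp: Fun_mod_def)

locale module_category_pair = dom: module_category K B M + cod: module_category K B N
  for K :: "'k ring" and B :: "('o, 'a, 'k, 'y) mon_category_scheme"
    and M :: "('m, 'n, 'k, 'o, 'a) mod_category" and N :: "('p, 'q, 'k, 'o, 'a) mod_category"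
begin

abbreviation mfun :: "('m, 'n, 'p, 'q, 'o) mod_ftor \<Rightarrow> bool" where
  "mfun F \<equiv> module_functor K B M N F"

abbreviation mtrans :: "(('m, 'n, 'p, 'q, 'o) mod_ftor, 'm, 'q) transf \<Rightarrow> bool" where
  "mtrans t \<equiv> t \<in> Arr (Fun_mod K B M N)"

text \<open>The laws of the functor locales, made available for all module functors \<open>M \<rightarrow> N\<close> at once, without
  interpreting a locale for each of them.\<close>

lemma mfun_simps [simp]:
  assumes "mfun F"
  shows "m \<in> Ob M \<Longrightarrow> FO F m \<in> Ob N"
    "f \<in> Arr M \<Longrightarrow> FA F f \<in> Arr N"
    "f \<in> Arr M \<Longrightarrow> Dom N (FA F f) = FO F (Dom M f)"
    "f \<in> Arr M \<Longrightarrow> Cod N (FA F f) = FO F (Cod M f)"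
    "m \<in> Ob M \<Longrightarrow> FA F (Ide M m) = Ide N (FO F m)"
    "\<lbrakk>f \<in> Arr M; g \<in> Arr M; Cod M f = Dom M g\<rbrakk> \<Longrightarrow> FA F (g \<cdot>\<^bsub>M\<^esub> f) = FA F g \<cdot>\<^bsub>N\<^esub> FA F f"
    "iso_arrow M f \<Longrightarrow> iso_arrow N (FA F f)"
    "iso_arrow M f \<Longrightarrow> inv_arrow N (FA F f) = FA F (inv_arrow M f)"
    "\<lbrakk>f \<in> Arr M; g \<in> Arr M; Dom M f = Dom M g; Cod M f = Cod M g\<rbrakk>
      \<Longrightarrow> FA F (Plus M f g) = Plus N (FA F f) (FA F g)"
    "\<lbrakk>a \<in> carrier K; f \<in> Arr M\<rbrakk> \<Longrightarrow> FA F (Scale M a f) = Scale N a (FA F f)"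
proof -
  interpret module_functor K B M N F by fact
  show "m \<in> Ob M \<Longrightarrow> FO F m \<in> Ob N"
    "f \<in> Arr M \<Longrightarrow> FA F f \<in> Arr N"
    "f \<in> Arr M \<Longrightarrow> Dom N (FA F f) = FO F (Dom M f)"
    "f \<in> Arr M \<Longrightarrow> Cod N (FA F f) = FO F (Cod M f)"
    "m \<in> Ob M \<Longrightarrow> FA F (Ide M m) = Ide N (FO F m)"
    "\<lbrakk>f \<in> Arr M; g \<in> Arr M; Cod M f = Dom M g\<rbrakk> \<Longrightarrow> FA F (g \<cdot>\<^bsub>M\<^esub> f) = FA F g \<cdot>\<^bsub>N\<^esub> FA F f"
    "iso_arrow M f \<Longrightarrow> iso_arrow N (FA F f)"
    "iso_arrow M f \<Longrightarrow> inv_arrow N (FA F f) = FA F (inv_arrow M f)"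
    "\<lbrakk>f \<in> Arr M; g \<in> Arr M; Dom M f = Dom M g; Cod M f = Cod M g\<rbrakk>
      \<Longrightarrow> FA F (Plus M f g) = Plus N (FA F f) (FA F g)"
    "\<lbrakk>a \<in> carrier K; f \<in> Arr M\<rbrakk> \<Longrightarrow> FA F (Scale M a f) = Scale N a (FA F f)"
    by simp_all
qed

lemma mfun_str [simp]:
  assumes "mfun F" "x \<in> Ob B" "m \<in> Ob M"
  shows "FS F x m \<in> Arr N" "Dom N (FS F x m) = x \<star>\<^sub>o\<^bsub>N\<^esub> FO F m" "Cod N (FS F x m) = FO F (x \<star>\<^sub>o\<^bsub>M\<^esub> m)"
    "iso_arrow N (FS F x m)"
  using module_functor.str_closed[OF assms] module_functor.str_iso[OF assms] by (auto simp: Hom_iff)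

lemma mfun_str_nat:
  "\<lbrakk>mfun F; f \<in> Arr B; h \<in> Arr M; Cod B f = x; Cod M h = m\<rbrakk> \<Longrightarrow>
    FS F x m \<cdot>\<^bsub>N\<^esub> (f \<star>\<^sub>a\<^bsub>N\<^esub> FA F h) = FA F (f \<star>\<^sub>a\<^bsub>M\<^esub> h) \<cdot>\<^bsub>N\<^esub> FS F (Dom B f) (Dom M h)"
  by (rule module_functor.str_natural) (auto simp: Hom_iff)

lemma mfun_ext:
  assumes "mfun F"
  shows "FO F \<in> extensional (Ob M)" "FA F \<in> extensional (Arr M)" "FS F \<in> extensional (Ob B)"
    "x \<in> Ob B \<Longrightarrow> FS F x \<in> extensional (Ob M)"
  using module_functor.ob_extensional[OF assms] module_functor.arr_extensional[OF assms]
    module_functor.str_extensional[OF assms] module_functor.str_extensional'[OF assms] by auto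

text \<open>Extensionality makes module functors equal when their values agree; the unit and associativity
  laws of composition hold strictly because of this.\<close>

lemma mfun_eqI:
  fixes F G :: "('m, 'n, 'p, 'q, 'o) mod_ftor"
  assumes "FO F \<in> extensional (Ob M)" "FA F \<in> extensional (Arr M)" "FS F \<in> extensional (Ob B)"
    "\<And>x. x \<in> Ob B \<Longrightarrow> FS F x \<in> extensional (Ob M)"
    and "FO G \<in> extensional (Ob M)" "FA G \<in> extensional (Arr M)" "FS G \<in> extensional (Ob B)"
    "\<And>x. x \<in> Ob B \<Longrightarrow> FS G x \<in> extensional (Ob M)"
    and "\<And>m. m \<in> Ob M \<Longrightarrow> FO F m = FO G m" "\<And>f. f \<in> Arr M \<Longrightarrow> FA F f = FA G f"
    "\<And>x m. \<lbrakk>x \<in> Ob B; m \<in> Ob M\<rbrakk> \<Longrightarrow> FS F x m = FS G x m"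
  shows "F = G"
proof -
  have "FO F = FO G"
    by (rule extensionalityI[OF assms(1,5)]) (rule assms)
  moreover have "FA F = FA G"
    by (rule extensionalityI[OF assms(2,6)]) (rule assms)
  moreover have "FS F = FS G"
  proof (rule extensionalityI)
    fix x assume "x \<in> Ob B"
    then show "FS F x = FS G x"
      by (intro extensionalityI[of _ "Ob M"] assms)
  qed (use assms in blast)+
  ultimately show ?thesis by simp
qed

lemma trans_ends [simp]:
  assumes "mtrans t"
  shows "mfun (TDom t)" "right_exact M N (TDom t)" "mfun (TCod t)" "right_exact M N (TCod t)"
  using assms by (auto simp: Fun_mod_arr_iff)

lemma trans_cmp_hom:
  assumes "mtrans t" "m \<in> Ob M"
  shows "Cmp t m \<in> Hom N (FO (TDom t) m) (FO (TCod t) m)"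
  using assms unfolding Fun_mod_arr_iff module_transformation_def nat_transformation_def by blast

lemma trans_cmp [simp]:
  assumes "mtrans t" "m \<in> Ob M"
  shows "Cmp t m \<in> Arr N" "Dom N (Cmp t m) = FO (TDom t) m" "Cod N (Cmp t m) = FO (TCod t) m"
  using trans_cmp_hom[OF assms] by (auto simp: Hom_iff)

lemma trans_nat:
  "\<lbrakk>mtrans t; f \<in> Arr M; Cod M f = m\<rbrakk>
    \<Longrightarrow> Cmp t m \<cdot>\<^bsub>N\<^esub> FA (TDom t) f = FA (TCod t) f \<cdot>\<^bsub>N\<^esub> Cmp t (Dom M f)"
  unfolding Fun_mod_arr_iff module_transformation_def nat_transformation_def Hom_iff by blast

lemma trans_nat_extend:
  "\<lbrakk>mtrans t; f \<in> Arr M; Cod M f = m; k \<in> Arr N; Cod N k = FO (TDom t) (Dom M f)\<rbrakk>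
    \<Longrightarrow> Cmp t m \<cdot>\<^bsub>N\<^esub> (FA (TDom t) f \<cdot>\<^bsub>N\<^esub> k) = FA (TCod t) f \<cdot>\<^bsub>N\<^esub> (Cmp t (Dom M f) \<cdot>\<^bsub>N\<^esub> k)"
  by (subst cod.comp_extend[OF trans_nat]) auto

lemma trans_str:
  "\<lbrakk>mtrans t; x \<in> Ob B; m \<in> Ob M\<rbrakk>
    \<Longrightarrow> Cmp t (x \<star>\<^sub>o\<^bsub>M\<^esub> m) \<cdot>\<^bsub>N\<^esub> FS (TDom t) x m = FS (TCod t) x m \<cdot>\<^bsub>N\<^esub> (Ide B x \<star>\<^sub>a\<^bsub>N\<^esub> Cmp t m)"
  unfolding Fun_mod_arr_iff module_transformation_def by blast

lemma trans_str_extend: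
  "\<lbrakk>mtrans t; x \<in> Ob B; m \<in> Ob M; k \<in> Arr N; Cod N k = x \<star>\<^sub>o\<^bsub>N\<^esub> FO (TDom t) m\<rbrakk>
    \<Longrightarrow> Cmp t (x \<star>\<^sub>o\<^bsub>M\<^esub> m) \<cdot>\<^bsub>N\<^esub> (FS (TDom t) x m \<cdot>\<^bsub>N\<^esub> k)
      = FS (TCod t) x m \<cdot>\<^bsub>N\<^esub> ((Ide B x \<star>\<^sub>a\<^bsub>N\<^esub> Cmp t m) \<cdot>\<^bsub>N\<^esub> k)"
  by (subst cod.comp_extend[OF trans_str]) auto

lemma trans_ext: "mtrans t \<Longrightarrow> Cmp t \<in> extensional (Ob M)"
  unfolding Fun_mod_arr_iff module_transformation_def by blast

lemma transI:
  assumes "mfun F" "right_exact M N F" "mfun G" "right_exact M N G"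
    and "\<And>m. m \<in> Ob M \<Longrightarrow> c m \<in> Hom N (FO F m) (FO G m)"
    and "\<And>f. f \<in> Arr M \<Longrightarrow> c (Cod M f) \<cdot>\<^bsub>N\<^esub> FA F f = FA G f \<cdot>\<^bsub>N\<^esub> c (Dom M f)"
    and "\<And>x m. \<lbrakk>x \<in> Ob B; m \<in> Ob M\<rbrakk>
      \<Longrightarrow> c (x \<star>\<^sub>o\<^bsub>M\<^esub> m) \<cdot>\<^bsub>N\<^esub> FS F x m = FS G x m \<cdot>\<^bsub>N\<^esub> (Ide B x \<star>\<^sub>a\<^bsub>N\<^esub> c m)"
  shows "mtrans \<lparr>TDom = F, TCod = G, Cmp = (\<lambda>m \<in> Ob M. c m)\<rparr>"
  unfolding Fun_mod_arr_iff module_transformation_def nat_transformation_def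
proof (intro conjI allI impI ballI)
  fix m m' f assume "f \<in> Hom M m m'"
  then show "Cmp \<lparr>TDom = F, TCod = G, Cmp = (\<lambda>m \<in> Ob M. c m)\<rparr> m'
      \<cdot>\<^bsub>N\<^esub> FA (TDom \<lparr>TDom = F, TCod = G, Cmp = (\<lambda>m \<in> Ob M. c m)\<rparr>) f
    = FA (TCod \<lparr>TDom = F, TCod = G, Cmp = (\<lambda>m \<in> Ob M. c m)\<rparr>) f
      \<cdot>\<^bsub>N\<^esub> Cmp \<lparr>TDom = F, TCod = G, Cmp = (\<lambda>m \<in> Ob M. c m)\<rparr> m"
    using assms(6)[of f] by (auto simp: Hom_iff)
qed (simp_all add: assms)

lemma trans_ide: "\<lbrakk>mfun F; right_exact M N F\<rbrakk>
    \<Longrightarrow> mtrans \<lparr>TDom = F, TCod = F, Cmp = (\<lambda>m \<in> Ob M. Ide N (FO F m))\<rparr>"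
  by (intro transI) (auto simp: Hom_iff)

lemma trans_comp:
  assumes "mtrans s" "mtrans t" "TDom s = TCod t"
  shows "mtrans \<lparr>TDom = TDom t, TCod = TCod s, Cmp = (\<lambda>m \<in> Ob M. Cmp s m \<cdot>\<^bsub>N\<^esub> Cmp t m)\<rparr>"
proof (intro transI)
  fix f assume "f \<in> Arr M"
  then show "(Cmp s (Cod M f) \<cdot>\<^bsub>N\<^esub> Cmp t (Cod M f)) \<cdot>\<^bsub>N\<^esub> FA (TDom t) f
      = FA (TCod s) f \<cdot>\<^bsub>N\<^esub> (Cmp s (Dom M f) \<cdot>\<^bsub>N\<^esub> Cmp t (Dom M f))"
    using assms trans_nat_extend[OF assms(1), of f _ "Cmp t (Dom M f)"]
    by (simp add: trans_nat)
next
  fix x m assume "x \<in> Ob B" "m \<in> Ob M"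
  then show "(Cmp s (x \<star>\<^sub>o\<^bsub>M\<^esub> m) \<cdot>\<^bsub>N\<^esub> Cmp t (x \<star>\<^sub>o\<^bsub>M\<^esub> m)) \<cdot>\<^bsub>N\<^esub> FS (TDom t) x m
      = FS (TCod s) x m \<cdot>\<^bsub>N\<^esub> (Ide B x \<star>\<^sub>a\<^bsub>N\<^esub> (Cmp s m \<cdot>\<^bsub>N\<^esub> Cmp t m))"
    using assms trans_str_extend[OF assms(1), of x m "Ide B x \<star>\<^sub>a\<^bsub>N\<^esub> Cmp t m"]
    by (simp add: trans_str cod.act.BA_collect)
qed (use assms in \<open>auto simp: Hom_iff\<close>)

lemma trans_plus:
  assumes "mtrans s" "mtrans t" "TDom s = TDom t" "TCod s = TCod t"
  shows "mtrans \<lparr>TDom = TDom s, TCod = TCod s, Cmp = (\<lambda>m \<in> Ob M. Plus N (Cmp s m) (Cmp t m))\<rparr>"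
proof (intro transI)
  fix f assume "f \<in> Arr M"
  then show "Plus N (Cmp s (Cod M f)) (Cmp t (Cod M f)) \<cdot>\<^bsub>N\<^esub> FA (TDom s) f
      = FA (TCod s) f \<cdot>\<^bsub>N\<^esub> Plus N (Cmp s (Dom M f)) (Cmp t (Dom M f))"
    using assms trans_nat[OF assms(1), of f] trans_nat[OF assms(2), of f] by simp
next
  fix x m assume "x \<in> Ob B" "m \<in> Ob M"
  then show "Plus N (Cmp s (x \<star>\<^sub>o\<^bsub>M\<^esub> m)) (Cmp t (x \<star>\<^sub>o\<^bsub>M\<^esub> m)) \<cdot>\<^bsub>N\<^esub> FS (TDom s) x m
      = FS (TCod s) x m \<cdot>\<^bsub>N\<^esub> (Ide B x \<star>\<^sub>a\<^bsub>N\<^esub> Plus N (Cmp s m) (Cmp t m))"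
    using assms trans_str[OF assms(1), of x m] trans_str[OF assms(2), of x m] by simp
qed (use assms in \<open>auto simp: Hom_iff\<close>)

lemma trans_zer:
  assumes "mfun F" "right_exact M N F" "mfun G" "right_exact M N G"
  shows "mtrans \<lparr>TDom = F, TCod = G, Cmp = (\<lambda>m \<in> Ob M. Zer N (FO F m) (FO G m))\<rparr>"
  using assms by (intro transI) (auto simp: Hom_iff)

lemma trans_scale:
  assumes "mtrans t" "a \<in> carrier K"
  shows "mtrans \<lparr>TDom = TDom t, TCod = TCod t, Cmp = (\<lambda>m \<in> Ob M. Scale N a (Cmp t m))\<rparr>"
  using assms by (intro transI) (auto simp: Hom_iff trans_nat trans_str)

lemmas trans_closed = trans_ide trans_comp trans_plus trans_zer trans_scale

lemma trans_collapse [simp]: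
  "mtrans t \<Longrightarrow> \<lparr>TDom = TDom t, TCod = TCod t, Cmp = (\<lambda>m \<in> Ob M. Cmp t m)\<rparr> = t"
  by (simp add: extensional_restrict[OF trans_ext])

lemma Fun_mod_category: "category (Fun_mod K B M N)"
  by standard (auto simp: Hom_iff trans_closed cong: restrict_cong)

lemma Fun_mod_hom_module:
  assumes "mfun F" "right_exact M N F" "mfun G" "right_exact M N G"
  shows "Module.module K (Hom_module (Fun_mod K B M N) F G)"
proof -
  note [simp] = Hom_module_def Hom_iff trans_closed cod.hom_laws(1,3-)
  note [cong] = restrict_cong
  have [simp]: "\<one>\<^bsub>K\<^esub> \<in> carrier K" "\<ominus>\<^bsub>K\<^esub> \<one>\<^bsub>K\<^esub> \<in> carrier K"
    by simp_all
  have "abelian_group (Hom_module (Fun_mod K B M N) F G)"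
  proof (rule abelian_groupI)
    fix t assume "t \<in> carrier (Hom_module (Fun_mod K B M N) F G)"
    then show "\<exists>s \<in> carrier (Hom_module (Fun_mod K B M N) F G).
        s \<oplus>\<^bsub>Hom_module (Fun_mod K B M N) F G\<^esub> t = \<zero>\<^bsub>Hom_module (Fun_mod K B M N) F G\<^esub>"
      by (intro bexI[of _ "Scale (Fun_mod K B M N) (\<ominus>\<^bsub>K\<^esub> \<one>\<^bsub>K\<^esub>) t"]) auto
  next
    fix s t assume "s \<in> carrier (Hom_module (Fun_mod K B M N) F G)"
      "t \<in> carrier (Hom_module (Fun_mod K B M N) F G)"
    then show "s \<oplus>\<^bsub>Hom_module (Fun_mod K B M N) F G\<^esub> t = t \<oplus>\<^bsub>Hom_module (Fun_mod K B M N) F G\<^esub> s"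
      by (auto simp: cod.hom_laws(2)[of "Cmp s m" "Cmp t m" for m])
  qed (use assms in auto)
  then show ?thesis
    using assms by (intro module.intro module_axioms.intro) (auto simp: dom.base.is_cring)
qed

lemma Fun_mod_linear: "linear_category K (Fun_mod K B M N)"
proof (intro linear_category.intro linear_category_axioms.intro)
  show "field K"
    by (rule dom.base.field_axioms)
  show "category (Fun_mod K B M N)"
    by (rule Fun_mod_category)
qed (simp_all add: Fun_mod_hom_module Hom_iff cong: restrict_cong)

text \<open>The componentwise inverses again form a module transformation, by inverting its two squares.\<close>

lemma trans_iso:
  assumes t: "mtrans t" and iso: "\<And>m. m \<in> Ob M \<Longrightarrow> iso_arrow N (Cmp t m)"
  shows "iso_arrow (Fun_mod K B M N) t"
proof -
  interpret E: linear_category K "Fun_mod K B M N"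
    by (rule Fun_mod_linear)
  let ?s = "\<lparr>TDom = TCod t, TCod = TDom t, Cmp = (\<lambda>m \<in> Ob M. inv_arrow N (Cmp t m))\<rparr>"
  have s: "mtrans ?s"
  proof (rule transI)
    fix f assume "f \<in> Arr M"
    then show "inv_arrow N (Cmp t (Cod M f)) \<cdot>\<^bsub>N\<^esub> FA (TCod t) f = FA (TDom t) f \<cdot>\<^bsub>N\<^esub> inv_arrow N (Cmp t (Dom M f))"
      using t by (intro cod.inverse_square trans_nat iso) auto
  next
    fix x m assume *: "x \<in> Ob B" "m \<in> Ob M"
    then have "inv_arrow N (Cmp t (x \<star>\<^sub>o\<^bsub>M\<^esub> m)) \<cdot>\<^bsub>N\<^esub> FS (TCod t) x m
        = FS (TDom t) x m \<cdot>\<^bsub>N\<^esub> inv_arrow N (Ide B x \<star>\<^sub>a\<^bsub>N\<^esub> Cmp t m)"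
      using t by (intro cod.inverse_square trans_str iso) (auto simp: iso)
    then show "inv_arrow N (Cmp t (x \<star>\<^sub>o\<^bsub>M\<^esub> m)) \<cdot>\<^bsub>N\<^esub> FS (TCod t) x m
        = FS (TDom t) x m \<cdot>\<^bsub>N\<^esub> (Ide B x \<star>\<^sub>a\<^bsub>N\<^esub> inv_arrow N (Cmp t m))"
      using * by (simp add: iso)
  qed (use t iso in \<open>auto simp: Hom_iff\<close>)
  show ?thesis
    by (rule E.isoI(1)[OF t s]) (use t iso in \<open>auto cong: restrict_cong\<close>)
qed

lemma trans_iso_cmp:
  assumes "iso_arrow (Fun_mod K B M N) t" "m \<in> Ob M"
  shows "iso_arrow N (Cmp t m)"
proof -
  interpret E: linear_category K "Fun_mod K B M N"
    by (rule Fun_mod_linear)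
  let ?s = "inv_arrow (Fun_mod K B M N) t"
  have t: "mtrans t" and s: "mtrans ?s" "TDom ?s = TCod t" "TCod ?s = TDom t"
    using E.inv_arr(1-3)[OF assms(1)] E.iso_arr[OF assms(1)] by simp_all
  have "Cmp (?s \<cdot>\<^bsub>Fun_mod K B M N\<^esub> t) m = Cmp (Ide (Fun_mod K B M N) (TDom t)) m"
    "Cmp (t \<cdot>\<^bsub>Fun_mod K B M N\<^esub> ?s) m = Cmp (Ide (Fun_mod K B M N) (TCod t)) m"
    using E.inv_arr(4,5)[OF assms(1)] by simp_all
  then show ?thesis
    using t s assms(2) by (intro cod.isoI(1)[of _ "Cmp ?s m"]) auto
qed

end


section \<open>Composition of module functors\<close>

lemma id_ftor_simps [simp]:
  "FO (id_ftor B M) = (\<lambda>m \<in> Ob M. m)"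
  "FA (id_ftor B M) = (\<lambda>f \<in> Arr M. f)"
  "FS (id_ftor B M) = (\<lambda>x \<in> Ob B. \<lambda>m \<in> Ob M. Ide M (x \<star>\<^sub>o\<^bsub>M\<^esub> m))"
  by (simp_all add: id_ftor_def)

lemma comp_ftor_simps [simp]:
  "FO (comp_ftor B M P G F) = (\<lambda>m \<in> Ob M. FO G (FO F m))"
  "FA (comp_ftor B M P G F) = (\<lambda>f \<in> Arr M. FA G (FA F f))"
  "FS (comp_ftor B M P G F)
    = (\<lambda>x \<in> Ob B. \<lambda>m \<in> Ob M. FA G (FS F x m) \<cdot>\<^bsub>P\<^esub> FS G x (FO F m))"
  by (simp_all add: comp_ftor_def)

lemma hcomp_transf_simps [simp]:
  "TDom (hcomp_transf B M P s t) = comp_ftor B M P (TDom s) (TDom t)"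
  "TCod (hcomp_transf B M P s t) = comp_ftor B M P (TCod s) (TCod t)"
  "Cmp (hcomp_transf B M P s t) = (\<lambda>m \<in> Ob M. Cmp s (FO (TCod t) m) \<cdot>\<^bsub>P\<^esub> FA (TDom s) (Cmp t m))"
  by (simp_all add: hcomp_transf_def)

context module_category
begin

lemma id_ftor_mfun: "module_functor K B M M (id_ftor B M)"
  by unfold_locales (auto simp: Hom_iff)

lemma id_ftor_right_exact: "right_exact M M (id_ftor B M)"
  by (rule right_exactI) (auto simp: is_cokernel_def)

end

locale module_category_triple = MN: module_category_pair K B M N + NP: module_category_pair K B N P
  for K :: "'k ring" and B :: "('o, 'a, 'k, 'y) mon_category_scheme"
    and M :: "('m, 'n, 'k, 'o, 'a) mod_category" and N :: "('p, 'q, 'k, 'o, 'a) mod_category"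
    and P :: "('r, 's, 'k, 'o, 'a) mod_category"
begin

sublocale MP: module_category_pair K B M P ..

lemma comp_mfun:
  assumes F: "MN.mfun F" and G: "NP.mfun G"
  shows "MP.mfun (comp_ftor B M P G F)"
proof unfold_locales
  note [simp] = F G
  fix x x' f m m' h assume *: "f \<in> Hom B x x'" "h \<in> Hom M m m'"
  have "FS (comp_ftor B M P G F) x' m' \<cdot>\<^bsub>P\<^esub> (f \<star>\<^sub>a\<^bsub>P\<^esub> FA (comp_ftor B M P G F) h)
    = FA G (FS F x' m') \<cdot>\<^bsub>P\<^esub> (FS G x' (FO F m') \<cdot>\<^bsub>P\<^esub> (f \<star>\<^sub>a\<^bsub>P\<^esub> FA G (FA F h)))"
    using * by (auto simp: Hom_iff)
  also have "\<dots> = FA G (FS F x' m') \<cdot>\<^bsub>P\<^esub> FA G (f \<star>\<^sub>a\<^bsub>N\<^esub> FA F h) \<cdot>\<^bsub>P\<^esub> FS G x (FO F m)"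
    using * by (auto simp: Hom_iff NP.mfun_str_nat)
  also have "\<dots> = FA G (FS F x' m' \<cdot>\<^bsub>N\<^esub> (f \<star>\<^sub>a\<^bsub>N\<^esub> FA F h)) \<cdot>\<^bsub>P\<^esub> FS G x (FO F m)"
    using * by (auto simp: Hom_iff)
  also have "\<dots> = FA (comp_ftor B M P G F) (f \<star>\<^sub>a\<^bsub>M\<^esub> h) \<cdot>\<^bsub>P\<^esub> FS (comp_ftor B M P G F) x m"
    using * by (auto simp: Hom_iff MN.mfun_str_nat)
  finally show "FS (comp_ftor B M P G F) x' m' \<cdot>\<^bsub>P\<^esub> (f \<star>\<^sub>a\<^bsub>P\<^esub> FA (comp_ftor B M P G F) h)
    = FA (comp_ftor B M P G F) (f \<star>\<^sub>a\<^bsub>M\<^esub> h) \<cdot>\<^bsub>P\<^esub> FS (comp_ftor B M P G F) x m" .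
next
  note [simp] = F G
  fix x y m assume [simp]: "x \<in> Ob B" "y \<in> Ob B" "m \<in> Ob M"
  have "FA (comp_ftor B M P G F) (MAssoc M x y m) \<cdot>\<^bsub>P\<^esub> FS (comp_ftor B M P G F) (x \<otimes>\<^sub>o\<^bsub>B\<^esub> y) m
    = FA G (FA F (MAssoc M x y m) \<cdot>\<^bsub>N\<^esub> FS F (x \<otimes>\<^sub>o\<^bsub>B\<^esub> y) m) \<cdot>\<^bsub>P\<^esub> FS G (x \<otimes>\<^sub>o\<^bsub>B\<^esub> y) (FO F m)"
    by simp
  also have "\<dots> = FA G (FS F x (y \<star>\<^sub>o\<^bsub>M\<^esub> m)) \<cdot>\<^bsub>P\<^esub> (FA G (Ide B x \<star>\<^sub>a\<^bsub>N\<^esub> FS F y m)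
      \<cdot>\<^bsub>P\<^esub> (FA G (MAssoc N x y (FO F m)) \<cdot>\<^bsub>P\<^esub> FS G (x \<otimes>\<^sub>o\<^bsub>B\<^esub> y) (FO F m)))"
    by (simp add: module_functor.str_assoc[OF F] del: MN.cod.assoc_arr)
  also have "\<dots> = FA G (FS F x (y \<star>\<^sub>o\<^bsub>M\<^esub> m)) \<cdot>\<^bsub>P\<^esub> ((FA G (Ide B x \<star>\<^sub>a\<^bsub>N\<^esub> FS F y m)
      \<cdot>\<^bsub>P\<^esub> FS G x (y \<star>\<^sub>o\<^bsub>N\<^esub> FO F m)) \<cdot>\<^bsub>P\<^esub> ((Ide B x \<star>\<^sub>a\<^bsub>P\<^esub> FS G y (FO F m)) \<cdot>\<^bsub>P\<^esub> MAssoc P x y (FO G (FO F m))))"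
    by (simp add: module_functor.str_assoc[OF G])
  also have "\<dots> = FA G (FS F x (y \<star>\<^sub>o\<^bsub>M\<^esub> m)) \<cdot>\<^bsub>P\<^esub> ((FS G x (FO F (y \<star>\<^sub>o\<^bsub>M\<^esub> m))
      \<cdot>\<^bsub>P\<^esub> (Ide B x \<star>\<^sub>a\<^bsub>P\<^esub> FA G (FS F y m))) \<cdot>\<^bsub>P\<^esub> ((Ide B x \<star>\<^sub>a\<^bsub>P\<^esub> FS G y (FO F m)) \<cdot>\<^bsub>P\<^esub> MAssoc P x y (FO G (FO F m))))"
    by (simp add: NP.mfun_str_nat del: NP.cod.assoc_arr)
  also have "\<dots> = FS (comp_ftor B M P G F) x (y \<star>\<^sub>o\<^bsub>M\<^esub> m) \<cdot>\<^bsub>P\<^esub> (Ide B x \<star>\<^sub>a\<^bsub>P\<^esub> FS (comp_ftor B M P G F) y m)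
      \<cdot>\<^bsub>P\<^esub> MAssoc P x y (FO (comp_ftor B M P G F) m)"
    by (simp add: NP.cod.act.BA_collect)
  finally show "FA (comp_ftor B M P G F) (MAssoc M x y m) \<cdot>\<^bsub>P\<^esub> FS (comp_ftor B M P G F) (x \<otimes>\<^sub>o\<^bsub>B\<^esub> y) m
    = FS (comp_ftor B M P G F) x (y \<star>\<^sub>o\<^bsub>M\<^esub> m) \<cdot>\<^bsub>P\<^esub> (Ide B x \<star>\<^sub>a\<^bsub>P\<^esub> FS (comp_ftor B M P G F) y m)
      \<cdot>\<^bsub>P\<^esub> MAssoc P x y (FO (comp_ftor B M P G F) m)" .
next
  note [simp] = F G
  fix m assume [simp]: "m \<in> Ob M"
  have "FA (comp_ftor B M P G F) (MUnit M m) \<cdot>\<^bsub>P\<^esub> FS (comp_ftor B M P G F) (TUnit B) m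
    = FA G (FA F (MUnit M m) \<cdot>\<^bsub>N\<^esub> FS F (TUnit B) m) \<cdot>\<^bsub>P\<^esub> FS G (TUnit B) (FO F m)"
    by simp
  also have "\<dots> = FA G (MUnit N (FO F m)) \<cdot>\<^bsub>P\<^esub> FS G (TUnit B) (FO F m)"
    by (simp only: module_functor.str_unit[OF F \<open>m \<in> Ob M\<close>])
  also have "\<dots> = MUnit P (FO (comp_ftor B M P G F) m)"
    by (simp add: module_functor.str_unit[OF G])
  finally show "FA (comp_ftor B M P G F) (MUnit M m) \<cdot>\<^bsub>P\<^esub> FS (comp_ftor B M P G F) (TUnit B) m
    = MUnit P (FO (comp_ftor B M P G F) m)" .
qed (use F G in \<open>auto simp: Hom_iff\<close>)

lemma comp_right_exact:
  assumes "right_exact M N F" "right_exact N P G"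
  shows "right_exact M P (comp_ftor B M P G F)"
proof (rule right_exactI)
  fix f q assume fq: "is_cokernel M f q"
  then have "f \<in> Arr M" "q \<in> Arr M"
    by (auto simp: is_cokernel_def)
  moreover have "is_cokernel P (FA G (FA F f)) (FA G (FA F q))"
    using assms fq by (simp add: right_exact_def)
  ultimately show "is_cokernel P (FA (comp_ftor B M P G F) f) (FA (comp_ftor B M P G F) q)"
    by simp
qed

lemma hcomp_trans:
  assumes t: "MN.mtrans t" and s: "NP.mtrans s"
  shows "MP.mtrans (hcomp_transf B M P s t)"
  unfolding hcomp_transf_def
proof (rule MP.transI)
  note [simp] = t s
  fix f assume f: "f \<in> Arr M"
  then show "(Cmp s (FO (TCod t) (Cod M f)) \<cdot>\<^bsub>P\<^esub> FA (TDom s) (Cmp t (Cod M f)))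
        \<cdot>\<^bsub>P\<^esub> FA (comp_ftor B M P (TDom s) (TDom t)) f
      = FA (comp_ftor B M P (TCod s) (TCod t)) f
        \<cdot>\<^bsub>P\<^esub> (Cmp s (FO (TCod t) (Dom M f)) \<cdot>\<^bsub>P\<^esub> FA (TDom s) (Cmp t (Dom M f)))"
    using arg_cong[OF MN.trans_nat[OF t f refl], of "FA (TDom s)"]
    by (simp add: NP.trans_nat_extend)
next
  note [simp] = t s
  fix x m assume [simp]: "x \<in> Ob B" "m \<in> Ob M"
  let ?F = "TDom t" and ?F' = "TCod t" and ?G = "TDom s" and ?G' = "TCod s"
  have "FA ?G (Cmp t (x \<star>\<^sub>o\<^bsub>M\<^esub> m)) \<cdot>\<^bsub>P\<^esub> (FA ?G (FS ?F x m) \<cdot>\<^bsub>P\<^esub> FS ?G x (FO ?F m))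
      = FA ?G (Cmp t (x \<star>\<^sub>o\<^bsub>M\<^esub> m) \<cdot>\<^bsub>N\<^esub> FS ?F x m) \<cdot>\<^bsub>P\<^esub> FS ?G x (FO ?F m)"
    by simp
  also have "\<dots> = FA ?G (FS ?F' x m) \<cdot>\<^bsub>P\<^esub> (FA ?G (Ide B x \<star>\<^sub>a\<^bsub>N\<^esub> Cmp t m) \<cdot>\<^bsub>P\<^esub> FS ?G x (FO ?F m))"
    by (simp add: MN.trans_str)
  also have "\<dots> = FA ?G (FS ?F' x m) \<cdot>\<^bsub>P\<^esub> (FS ?G x (FO ?F' m) \<cdot>\<^bsub>P\<^esub> (Ide B x \<star>\<^sub>a\<^bsub>P\<^esub> FA ?G (Cmp t m)))"
    by (simp add: NP.mfun_str_nat)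
  finally show "(Cmp s (FO ?F' (x \<star>\<^sub>o\<^bsub>M\<^esub> m)) \<cdot>\<^bsub>P\<^esub> FA ?G (Cmp t (x \<star>\<^sub>o\<^bsub>M\<^esub> m)))
        \<cdot>\<^bsub>P\<^esub> FS (comp_ftor B M P ?G ?F) x m
      = FS (comp_ftor B M P ?G' ?F') x m
        \<cdot>\<^bsub>P\<^esub> (Ide B x \<star>\<^sub>a\<^bsub>P\<^esub> (Cmp s (FO ?F' m) \<cdot>\<^bsub>P\<^esub> FA ?G (Cmp t m)))"
    by (simp add: NP.trans_nat_extend NP.trans_str_extend NP.cod.act.BA_collect)
qed (use t s in \<open>auto simp: Hom_iff comp_mfun comp_right_exact\<close>)

lemma hcomp_ide:
  assumes "MN.mfun F" "NP.mfun G"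
  shows "hcomp_transf B M P (Ide (Fun_mod K B N P) G) (Ide (Fun_mod K B M N) F)
    = Ide (Fun_mod K B M P) (comp_ftor B M P G F)"
  using assms by (auto simp: hcomp_transf_def intro!: restrict_ext)

lemma interchange:
  assumes "MN.mtrans t" "MN.mtrans t'" "TDom t' = TCod t" "NP.mtrans s" "NP.mtrans s'" "TDom s' = TCod s"
  shows "hcomp_transf B M P (s' \<cdot>\<^bsub>Fun_mod K B N P\<^esub> s) (t' \<cdot>\<^bsub>Fun_mod K B M N\<^esub> t)
    = hcomp_transf B M P s' t' \<cdot>\<^bsub>Fun_mod K B M P\<^esub> hcomp_transf B M P s t"
  using assms NP.trans_nat_extend[OF assms(4), of "Cmp t' m" "FO (TCod t') m" "FA (TDom s) (Cmp t m)" for m]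
  by (auto simp: hcomp_transf_def intro!: restrict_ext)

lemma hcomp_plus_left:
  assumes "MN.mtrans t" "NP.mtrans s" "NP.mtrans s'" "TDom s = TDom s'" "TCod s = TCod s'"
  shows "hcomp_transf B M P (Plus (Fun_mod K B N P) s s') t
    = Plus (Fun_mod K B M P) (hcomp_transf B M P s t) (hcomp_transf B M P s' t)"
  using assms by (auto simp: hcomp_transf_def intro!: restrict_ext)

lemma hcomp_plus_right:
  assumes "MN.mtrans t" "MN.mtrans t'" "NP.mtrans s" "TDom t = TDom t'" "TCod t = TCod t'"
  shows "hcomp_transf B M P s (Plus (Fun_mod K B M N) t t')
    = Plus (Fun_mod K B M P) (hcomp_transf B M P s t) (hcomp_transf B M P s t')"
  using assms by (auto simp: hcomp_transf_def intro!: restrict_ext)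

lemma hcomp_scale:
  assumes "MN.mtrans t" "NP.mtrans s" "a \<in> carrier K"
  shows "hcomp_transf B M P (Scale (Fun_mod K B N P) a s) t
      = Scale (Fun_mod K B M P) a (hcomp_transf B M P s t)"
    "hcomp_transf B M P s (Scale (Fun_mod K B M N) a t)
      = Scale (Fun_mod K B M P) a (hcomp_transf B M P s t)"
  using assms by (auto simp: hcomp_transf_def intro!: restrict_ext)

end

context module_category_pair
begin

lemma comp_ftor_id:
  assumes "mfun F"
  shows "comp_ftor B M N (id_ftor B N) F = F" "comp_ftor B M N F (id_ftor B M) = F"
  using assms by (auto intro!: mfun_eqI simp: mfun_ext)

lemma hcomp_id:
  assumes t: "mtrans t"
  shows "hcomp_transf B M N (Ide (Fun_mod K B N N) (id_ftor B N)) t = t"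
    "hcomp_transf B M N t (Ide (Fun_mod K B M M) (id_ftor B M)) = t"
  using t by (auto simp: hcomp_transf_def comp_ftor_id cong: restrict_cong)

end

lemma comp_ftor_assoc:
  assumes "module_category_triple K B M N P" "module_category_pair K B P Q"
    and F: "module_functor K B M N F" and G: "module_functor K B N P G" and H: "module_functor K B P Q H"
  shows "comp_ftor B M Q (comp_ftor B N Q H G) F = comp_ftor B M Q H (comp_ftor B M P G F)"
proof -
  interpret MNP: module_category_triple K B M N P by fact
  interpret PQ: module_category_pair K B P Q by fact
  show ?thesis
    using F G H by (auto simp: comp_ftor_def intro!: restrict_ext)
qed

lemma hcomp_transf_assoc:
  assumes "module_category_triple K B M N P" "module_category_pair K B P Q"
    and t: "t \<in> Arr (Fun_mod K B M N)" and s: "s \<in> Arr (Fun_mod K B N P)"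
    and r: "r \<in> Arr (Fun_mod K B P Q)"
  shows "hcomp_transf B M Q (hcomp_transf B N Q r s) t = hcomp_transf B M Q r (hcomp_transf B M P s t)"
proof -
  interpret MNP: module_category_triple K B M N P by fact
  interpret PQ: module_category_pair K B P Q by fact
  show ?thesis
    using t s r by (auto simp: hcomp_transf_def comp_ftor_assoc[OF assms(1,2)] intro!: restrict_ext)
qed


section \<open>The monoidal category of module endofunctors\<close>

text \<open>The axioms see only the fields of the record for linear categories. This transfers them to
  records with further fields, such as \<open>End_mod\<close> and \<open>op_tensor\<close>.\<close>

lemma linear_category_cong:
  assumes "Ob C = Ob D" "Arr C = Arr D" "Dom C = Dom D" "Cod C = Cod D" "Ide C = Ide D"
    "Comp C = Comp D" "Plus C = Plus D" "Zer C = Zer D" "Scale C = Scale D"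
  shows "linear_category K C \<longleftrightarrow> linear_category K D"
  unfolding linear_category_def linear_category_axioms_def category_def Hom_module_def Hom_def assms ..

lemma End_mod_simps:
  "Ob (End_mod K B M) = Ob (Fun_mod K B M M)" "Arr (End_mod K B M) = Arr (Fun_mod K B M M)"
  "Dom (End_mod K B M) = Dom (Fun_mod K B M M)" "Cod (End_mod K B M) = Cod (Fun_mod K B M M)"
  "Ide (End_mod K B M) = Ide (Fun_mod K B M M)" "Comp (End_mod K B M) = Comp (Fun_mod K B M M)"
  "Plus (End_mod K B M) = Plus (Fun_mod K B M M)" "Zer (End_mod K B M) = Zer (Fun_mod K B M M)"
  "Scale (End_mod K B M) = Scale (Fun_mod K B M M)"
  "TensorO (End_mod K B M) = comp_ftor B M M" "TensorA (End_mod K B M) = hcomp_transf B M M"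
  "TUnit (End_mod K B M) = id_ftor B M"
  "Assoc (End_mod K B M) F G H = Ide (Fun_mod K B M M) (comp_ftor B M M (comp_ftor B M M F G) H)"
  "LUnit (End_mod K B M) = Ide (Fun_mod K B M M)" "RUnit (End_mod K B M) = Ide (Fun_mod K B M M)"
  by (simp_all add: End_mod_def Let_def)

context module_category
begin

lemma End_mod_linear: "linear_category K (End_mod K B M)"
proof -
  interpret module_category_pair K B M M ..
  show ?thesis
    using Fun_mod_linear linear_category_cong[OF End_mod_simps(1-9)] by blast
qed

text \<open>Composition is strictly associative and unital, so all structural isomorphisms are identities and
  the coherence axioms reduce to equations between identities.\<close>

lemma End_mod_monoidal: "linear_monoidal_category K (End_mod K B M)"
proof -
  interpret E: linear_category K "End_mod K B M"
    by (rule End_mod_linear)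
  interpret MM: module_category_pair K B M M ..
  interpret MMM: module_category_triple K B M M M ..
  let ?E = "End_mod K B M"
  let ?o = "comp_ftor B M M" and ?h = "hcomp_transf B M M"
  have [simp]: "TensorO ?E = ?o" "TensorA ?E = ?h" "TUnit ?E = id_ftor B M"
    "Assoc ?E F G H = Ide ?E (?o (?o F G) H)" "LUnit ?E F = Ide ?E F" "RUnit ?E F = Ide ?E F" for F G H
    by (simp_all add: End_mod_simps)
  have ob [simp]: "F \<in> Ob ?E \<longleftrightarrow> MM.mfun F \<and> right_exact M M F" for F
    by (simp add: End_mod_simps)
  have hom: "t \<in> Hom ?E F G \<longleftrightarrow> MM.mtrans t \<and> TDom t = F \<and> TCod t = G" for t F G
    by (simp add: End_mod_simps Hom_iff)
  have o_ob [simp]: "MM.mfun (?o F G)" "right_exact M M (?o F G)"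
    if "MM.mfun F" "MM.mfun G" "right_exact M M F" "right_exact M M G" for F G
    using that by (auto simp: MMM.comp_mfun MMM.comp_right_exact)
  have id_ob [simp]: "MM.mfun (id_ftor B M)" "right_exact M M (id_ftor B M)"
    by (rule id_ftor_mfun id_ftor_right_exact)+
  have assoc [simp]: "?o (?o F G) H = ?o F (?o G H)" if "MM.mfun F" "MM.mfun G" "MM.mfun H" for F G H
    using that by (intro comp_ftor_assoc[OF MMM.module_category_triple_axioms MM.module_category_pair_axioms])
  have hassoc [simp]: "?h (?h r s) t = ?h r (?h s t)" if "MM.mtrans r" "MM.mtrans s" "MM.mtrans t" for r s t
    using that
    by (intro hcomp_transf_assoc[OF MMM.module_category_triple_axioms MM.module_category_pair_axioms])
  have h_ide [simp]: "?h (Ide ?E F) (Ide ?E G) = Ide ?E (?o F G)" if "MM.mfun F" "MM.mfun G" for F G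
    using MMM.hcomp_ide[of G F] that by (simp add: End_mod_simps del: Fun_mod_simps)
  have h_id [simp]: "?h (Ide ?E (id_ftor B M)) t = t" "?h t (Ide ?E (id_ftor B M)) = t" if "MM.mtrans t" for t
    using MM.hcomp_id[OF that] by (simp_all add: End_mod_simps del: Fun_mod_simps)
  have arr: "t \<in> Arr ?E \<longleftrightarrow> MM.mtrans t" "Dom ?E t = TDom t" "Cod ?E t = TCod t" for t
    by (simp_all add: End_mod_simps)
  note [simp] = E.iso_ide[unfolded ob] E.ide_arr[unfolded ob arr] E.comp_ide[unfolded arr] MM.comp_ftor_id
    MMM.hcomp_trans
  show ?thesis
  proof (intro linear_monoidal_category.intro bilinear_bifunctor.intro bilinear_bifunctor_axioms.intro
      linear_monoidal_category_axioms.intro E.linear_category_axioms)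
    fix f f' g g' and x x' x'' y y' y''
    assume "f \<in> Hom ?E x x'" "f' \<in> Hom ?E x' x''" "g \<in> Hom ?E y y'" "g' \<in> Hom ?E y' y''"
    then show "TensorA ?E (f' \<cdot>\<^bsub>?E\<^esub> f) (g' \<cdot>\<^bsub>?E\<^esub> g) = TensorA ?E f' g' \<cdot>\<^bsub>?E\<^esub> TensorA ?E f g"
      using MMM.interchange[of g g' f f'] by (auto simp: hom End_mod_simps simp del: Fun_mod_simps)
  next
    fix f f' g and x x' y y'
    assume "f \<in> Hom ?E x x'" "f' \<in> Hom ?E x x'" "g \<in> Hom ?E y y'"
    then show "TensorA ?E (Plus ?E f f') g = Plus ?E (TensorA ?E f g) (TensorA ?E f' g)"
      using MMM.hcomp_plus_left[of g f f'] by (auto simp: hom End_mod_simps simp del: Fun_mod_simps)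
  next
    fix f g g' and x x' y y'
    assume "f \<in> Hom ?E x x'" "g \<in> Hom ?E y y'" "g' \<in> Hom ?E y y'"
    then show "TensorA ?E f (Plus ?E g g') = Plus ?E (TensorA ?E f g) (TensorA ?E f g')"
      using MMM.hcomp_plus_right[of g g' f] by (auto simp: hom End_mod_simps simp del: Fun_mod_simps)
  next
    fix a f g and x x' y y'
    assume "a \<in> carrier K" "f \<in> Hom ?E x x'" "g \<in> Hom ?E y y'"
    then show "TensorA ?E (Scale ?E a f) g = Scale ?E a (TensorA ?E f g)"
      using MMM.hcomp_scale[of g f a] by (auto simp: hom End_mod_simps simp del: Fun_mod_simps)
  next
    fix a f g and x x' y y'
    assume "a \<in> carrier K" "f \<in> Hom ?E x x'" "g \<in> Hom ?E y y'"
    then show "TensorA ?E f (Scale ?E a g) = Scale ?E a (TensorA ?E f g)"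
      using MMM.hcomp_scale[of g f a] by (auto simp: hom End_mod_simps simp del: Fun_mod_simps)
  qed (auto simp: hom)
qed

end

lemma op_tensor_simps [simp]:
  "Ob (op_tensor C) = Ob C" "Arr (op_tensor C) = Arr C" "Dom (op_tensor C) = Dom C"
  "Cod (op_tensor C) = Cod C" "Ide (op_tensor C) = Ide C" "Comp (op_tensor C) = Comp C"
  "Plus (op_tensor C) = Plus C" "Zer (op_tensor C) = Zer C" "Scale (op_tensor C) = Scale C"
  "x \<otimes>\<^sub>o\<^bsub>op_tensor C\<^esub> y = y \<otimes>\<^sub>o\<^bsub>C\<^esub> x" "f \<otimes>\<^sub>a\<^bsub>op_tensor C\<^esub> g = g \<otimes>\<^sub>a\<^bsub>C\<^esub> f"
  "TUnit (op_tensor C) = TUnit C" "Assoc (op_tensor C) x y z = inv_arrow C (Assoc C z y x)"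
  "LUnit (op_tensor C) = RUnit C" "RUnit (op_tensor C) = LUnit C"
  by (simp_all add: op_tensor_def)

lemma op_tensor_Hom [simp]: "Hom (op_tensor C) x y = Hom C x y"
  by (simp add: Hom_def)

lemma op_tensor_iso [simp]: "iso_arrow (op_tensor C) f = iso_arrow C f"
  by (simp add: iso_arrow_def inverse_arrows_def)

context linear_monoidal_category
begin

lemma assoc_arrow [simp]:
  assumes "x \<in> Ob C" "y \<in> Ob C" "z \<in> Ob C"
  shows "Assoc C x y z \<in> Arr C" "Dom C (Assoc C x y z) = (x \<otimes>\<^sub>o\<^bsub>C\<^esub> y) \<otimes>\<^sub>o\<^bsub>C\<^esub> z"
    "Cod C (Assoc C x y z) = x \<otimes>\<^sub>o\<^bsub>C\<^esub> (y \<otimes>\<^sub>o\<^bsub>C\<^esub> z)" "iso_arrow C (Assoc C x y z)"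
  using assoc_closed[OF assms] assoc_iso[OF assms] by (auto simp: Hom_iff)

lemma unit_arrow [simp]:
  assumes "x \<in> Ob C"
  shows "LUnit C x \<in> Arr C" "Dom C (LUnit C x) = TUnit C \<otimes>\<^sub>o\<^bsub>C\<^esub> x" "Cod C (LUnit C x) = x"
    "RUnit C x \<in> Arr C" "Dom C (RUnit C x) = x \<otimes>\<^sub>o\<^bsub>C\<^esub> TUnit C" "Cod C (RUnit C x) = x"
  using lunit_closed[OF assms] runit_closed[OF assms] by (auto simp: Hom_iff)

lemma op_tensor_linear: "linear_category K (op_tensor C)"
  using linear_category_axioms linear_category_cong[of "op_tensor C" C K] by simp

text \<open>Reversing the tensor product turns each pentagon and triangle into the one obtained by inverting
  all associativity isomorphisms in it.\<close>

lemma op_tensor_monoidal: "linear_monoidal_category K (op_tensor C)"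
proof (intro linear_monoidal_category.intro bilinear_bifunctor.intro bilinear_bifunctor_axioms.intro
      linear_monoidal_category_axioms.intro op_tensor_linear, unfold op_tensor_simps op_tensor_Hom op_tensor_iso)
  note [simp] = unit_closed
  fix f g h x x' y y' z z'
  assume *: "f \<in> Hom C x x'" "g \<in> Hom C y y'" "h \<in> Hom C z z'"
  then have ob: "x \<in> Ob C" "y \<in> Ob C" "z \<in> Ob C" "x' \<in> Ob C" "y' \<in> Ob C" "z' \<in> Ob C"
    by (auto simp: Hom_iff)
  have "Assoc C z' y' x' \<cdot>\<^bsub>C\<^esub> ((h \<otimes>\<^sub>a\<^bsub>C\<^esub> g) \<otimes>\<^sub>a\<^bsub>C\<^esub> f) = (h \<otimes>\<^sub>a\<^bsub>C\<^esub> (g \<otimes>\<^sub>a\<^bsub>C\<^esub> f)) \<cdot>\<^bsub>C\<^esub> Assoc C z y x"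
    using * by (intro assoc_natural)
  then have "(h \<otimes>\<^sub>a\<^bsub>C\<^esub> g) \<otimes>\<^sub>a\<^bsub>C\<^esub> f = inv_arrow C (Assoc C z' y' x') \<cdot>\<^bsub>C\<^esub> ((h \<otimes>\<^sub>a\<^bsub>C\<^esub> (g \<otimes>\<^sub>a\<^bsub>C\<^esub> f)) \<cdot>\<^bsub>C\<^esub> Assoc C z y x)"
    using * ob by (intro move_inv_left) (auto simp: Hom_iff)
  then show "inv_arrow C (Assoc C z' y' x') \<cdot>\<^bsub>C\<^esub> (h \<otimes>\<^sub>a\<^bsub>C\<^esub> (g \<otimes>\<^sub>a\<^bsub>C\<^esub> f))
      = ((h \<otimes>\<^sub>a\<^bsub>C\<^esub> g) \<otimes>\<^sub>a\<^bsub>C\<^esub> f) \<cdot>\<^bsub>C\<^esub> inv_arrow C (Assoc C z y x)"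
    using * ob by (auto simp: Hom_iff)
next
  fix x y z w assume [simp]: "x \<in> Ob C" "y \<in> Ob C" "z \<in> Ob C" "w \<in> Ob C"
  have "inv_arrow C (Assoc C w z (y \<otimes>\<^sub>o\<^bsub>C\<^esub> x) \<cdot>\<^bsub>C\<^esub> Assoc C (w \<otimes>\<^sub>o\<^bsub>C\<^esub> z) y x)
    = inv_arrow C ((Ide C w \<otimes>\<^sub>a\<^bsub>C\<^esub> Assoc C z y x) \<cdot>\<^bsub>C\<^esub> Assoc C w (z \<otimes>\<^sub>o\<^bsub>C\<^esub> y) x
            \<cdot>\<^bsub>C\<^esub> (Assoc C w z y \<otimes>\<^sub>a\<^bsub>C\<^esub> Ide C x))"
    by (simp only: pentagon \<open>x \<in> Ob C\<close> \<open>y \<in> Ob C\<close> \<open>z \<in> Ob C\<close> \<open>w \<in> Ob C\<close>)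
  then show "inv_arrow C (Assoc C (w \<otimes>\<^sub>o\<^bsub>C\<^esub> z) y x) \<cdot>\<^bsub>C\<^esub> inv_arrow C (Assoc C w z (y \<otimes>\<^sub>o\<^bsub>C\<^esub> x))
    = (inv_arrow C (Assoc C w z y) \<otimes>\<^sub>a\<^bsub>C\<^esub> Ide C x) \<cdot>\<^bsub>C\<^esub> inv_arrow C (Assoc C w (z \<otimes>\<^sub>o\<^bsub>C\<^esub> y) x)
            \<cdot>\<^bsub>C\<^esub> (Ide C w \<otimes>\<^sub>a\<^bsub>C\<^esub> inv_arrow C (Assoc C z y x))"
    by simp
next
  note [simp] = unit_closed
  fix x y assume [simp]: "x \<in> Ob C" "y \<in> Ob C"
  show "(RUnit C y \<otimes>\<^sub>a\<^bsub>C\<^esub> Ide C x) \<cdot>\<^bsub>C\<^esub> inv_arrow C (Assoc C y (TUnit C) x) = Ide C y \<otimes>\<^sub>a\<^bsub>C\<^esub> LUnit C x"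
    using triangle[of y x] by (simp flip: triangle)
qed (auto simp: Hom_iff unit_closed lunit_iso runit_iso lunit_natural runit_natural BA_comp
    intro: lunit_natural runit_natural)

end


section \<open>2-categories of module categories with structure\<close>

lemma full_subcategory_simps [simp]:
  "Ob (full_subcategory C P) = {x \<in> Ob C. P x}"
  "Arr (full_subcategory C P) = {f \<in> Arr C. P (Dom C f) \<and> P (Cod C f)}"
  "Dom (full_subcategory C P) = Dom C" "Cod (full_subcategory C P) = Cod C"
  "Ide (full_subcategory C P) = Ide C" "Comp (full_subcategory C P) = Comp C"
  by (simp_all add: full_subcategory_def)

lemma full_subcategory_category:
  assumes "category C" shows "category (full_subcategory C P)"
proof -
  interpret category C by fact
  show ?thesis
    by standard (auto simp: Hom_iff)
qed

lemma structured_modules_simps [simp]: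
  "Ob2 (structured_modules K B A P) = A"
  "HomC (structured_modules K B A P) x y = full_subcategory (Fun_mod K B (fst x) (fst y)) (P x y)"
  "HC1 (structured_modules K B A P) x y z = comp_ftor B (fst x) (fst z)"
  "HC2 (structured_modules K B A P) x y z = hcomp_transf B (fst x) (fst z)"
  "Id1 (structured_modules K B A P) x = id_ftor B (fst x)"
  by (simp_all add: structured_modules_def)

text \<open>The 2-category of module categories, functors and transformations is restricted to a class of
  1-cells that contains the identities and is closed under composition.\<close>

lemma structured_modules_two_category:
  fixes K :: "'k ring" and B :: "('o, 'a, 'k, 'y) mon_category_scheme"
    and A :: "(('m, 'n, 'k, 'o, 'a) mod_category \<times> 's) set"
  assumes mod: "\<And>x. x \<in> A \<Longrightarrow> module_category K B (fst x)"
    and P_id: "\<And>x. x \<in> A \<Longrightarrow> P x x (id_ftor B (fst x))"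
    and P_comp: "\<And>x y z F G. \<lbrakk>x \<in> A; y \<in> A; z \<in> A; module_functor K B (fst x) (fst y) F;
        module_functor K B (fst y) (fst z) G; P x y F; P y z G\<rbrakk> \<Longrightarrow> P x z (comp_ftor B (fst x) (fst z) G F)"
  shows "two_category (structured_modules K B A P)"
proof -
  have pair: "module_category_pair K B (fst x) (fst y)" if "x \<in> A" "y \<in> A" for x y
    using that by (intro module_category_pair.intro mod)
  have triple: "module_category_triple K B (fst x) (fst y) (fst z)" if "x \<in> A" "y \<in> A" "z \<in> A" for x y z
    using that by (intro module_category_triple.intro pair)
  show ?thesis
    unfolding two_category_def structured_modules_simps full_subcategory_simps
  proof (intro conjI allI impI)
    fix x y assume "x \<in> A" "y \<in> A"
    then show "category (full_subcategory (Fun_mod K B (fst x) (fst y)) (P x y))"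
      by (intro full_subcategory_category module_category_pair.Fun_mod_category pair)
  next
    fix x assume "x \<in> A"
    then show "id_ftor B (fst x) \<in> {F \<in> Ob (Fun_mod K B (fst x) (fst x)). P x x F}"
      by (simp add: P_id module_category.id_ftor_mfun module_category.id_ftor_right_exact[OF mod] mod)
  next
    fix x y z f g
    assume *: "x \<in> A" "y \<in> A" "z \<in> A" "f \<in> {F \<in> Ob (Fun_mod K B (fst x) (fst y)). P x y F}"
      "g \<in> {F \<in> Ob (Fun_mod K B (fst y) (fst z)). P y z F}"
    then interpret module_category_triple K B "fst x" "fst y" "fst z"
      by (intro triple)
    show "comp_ftor B (fst x) (fst z) g f \<in> {F \<in> Ob (Fun_mod K B (fst x) (fst z)). P x z F}"
      using * by (simp add: comp_mfun comp_right_exact P_comp)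
  next
    fix x y z t f f' s g g'
    assume *: "x \<in> A" "y \<in> A" "z \<in> A"
      "t \<in> Hom (full_subcategory (Fun_mod K B (fst x) (fst y)) (P x y)) f f'"
      "s \<in> Hom (full_subcategory (Fun_mod K B (fst y) (fst z)) (P y z)) g g'"
    then interpret module_category_triple K B "fst x" "fst y" "fst z"
      by (intro triple)
    show "hcomp_transf B (fst x) (fst z) s t
        \<in> Hom (full_subcategory (Fun_mod K B (fst x) (fst z)) (P x z))
            (comp_ftor B (fst x) (fst z) g f) (comp_ftor B (fst x) (fst z) g' f')"
      using * by (auto simp: Hom_iff hcomp_trans P_comp)
  next
    fix x y z f g
    assume *: "x \<in> A" "y \<in> A" "z \<in> A" "f \<in> {F \<in> Ob (Fun_mod K B (fst x) (fst y)). P x y F}"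
      "g \<in> {F \<in> Ob (Fun_mod K B (fst y) (fst z)). P y z F}"
    then interpret module_category_triple K B "fst x" "fst y" "fst z"
      by (intro triple)
    show "hcomp_transf B (fst x) (fst z) (Ide (Fun_mod K B (fst y) (fst z)) g)
        (Ide (Fun_mod K B (fst x) (fst y)) f)
      = Ide (Fun_mod K B (fst x) (fst z)) (comp_ftor B (fst x) (fst z) g f)"
      using * by (intro hcomp_ide) auto
  next
    fix x y z t f f' t' f'' s g g' s' g''
    assume *: "x \<in> A" "y \<in> A" "z \<in> A"
      "t \<in> Hom (full_subcategory (Fun_mod K B (fst x) (fst y)) (P x y)) f f'"
      "t' \<in> Hom (full_subcategory (Fun_mod K B (fst x) (fst y)) (P x y)) f' f''"
      "s \<in> Hom (full_subcategory (Fun_mod K B (fst y) (fst z)) (P y z)) g g'"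
      "s' \<in> Hom (full_subcategory (Fun_mod K B (fst y) (fst z)) (P y z)) g' g''"
    then interpret module_category_triple K B "fst x" "fst y" "fst z"
      by (intro triple)
    show "hcomp_transf B (fst x) (fst z) (s' \<cdot>\<^bsub>Fun_mod K B (fst y) (fst z)\<^esub> s)
        (t' \<cdot>\<^bsub>Fun_mod K B (fst x) (fst y)\<^esub> t)
      = hcomp_transf B (fst x) (fst z) s' t'
        \<cdot>\<^bsub>Fun_mod K B (fst x) (fst z)\<^esub> hcomp_transf B (fst x) (fst z) s t"
      using * by (intro interchange) (auto simp: Hom_iff)
  next
    fix x y z w f g h
    assume "x \<in> A" "y \<in> A" "z \<in> A" "w \<in> A" "f \<in> {F \<in> Ob (Fun_mod K B (fst x) (fst y)). P x y F}"
      "g \<in> {F \<in> Ob (Fun_mod K B (fst y) (fst z)). P y z F}"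
      "h \<in> {F \<in> Ob (Fun_mod K B (fst z) (fst w)). P z w F}"
    then show "comp_ftor B (fst x) (fst w) (comp_ftor B (fst y) (fst w) h g) f
      = comp_ftor B (fst x) (fst w) h (comp_ftor B (fst x) (fst z) g f)"
      by (intro comp_ftor_assoc[OF triple pair, of x y z w]) auto
  next
    fix x y z w t s r
    assume "x \<in> A" "y \<in> A" "z \<in> A" "w \<in> A"
      "t \<in> {t \<in> Arr (Fun_mod K B (fst x) (fst y)). P x y (Dom (Fun_mod K B (fst x) (fst y)) t)
        \<and> P x y (Cod (Fun_mod K B (fst x) (fst y)) t)}"
      "s \<in> {t \<in> Arr (Fun_mod K B (fst y) (fst z)). P y z (Dom (Fun_mod K B (fst y) (fst z)) t)
        \<and> P y z (Cod (Fun_mod K B (fst y) (fst z)) t)}"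
      "r \<in> {t \<in> Arr (Fun_mod K B (fst z) (fst w)). P z w (Dom (Fun_mod K B (fst z) (fst w)) t)
        \<and> P z w (Cod (Fun_mod K B (fst z) (fst w)) t)}"
    then show "hcomp_transf B (fst x) (fst w) (hcomp_transf B (fst y) (fst w) r s) t
      = hcomp_transf B (fst x) (fst w) r (hcomp_transf B (fst x) (fst z) s t)"
      by (intro hcomp_transf_assoc[OF triple pair, of x y z w]) auto
  next
    fix x y f assume "x \<in> A" "y \<in> A" "f \<in> {F \<in> Ob (Fun_mod K B (fst x) (fst y)). P x y F}"
    then show "comp_ftor B (fst x) (fst y) (id_ftor B (fst y)) f = f"
      by (intro module_category_pair.comp_ftor_id(1)[OF pair]) auto
  next
    fix x y f assume "x \<in> A" "y \<in> A" "f \<in> {F \<in> Ob (Fun_mod K B (fst x) (fst y)). P x y F}"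
    then show "comp_ftor B (fst x) (fst y) f (id_ftor B (fst x)) = f"
      by (intro module_category_pair.comp_ftor_id(2)[OF pair]) auto
  next
    fix x y t assume "x \<in> A" "y \<in> A"
      "t \<in> {t \<in> Arr (Fun_mod K B (fst x) (fst y)). P x y (Dom (Fun_mod K B (fst x) (fst y)) t)
        \<and> P x y (Cod (Fun_mod K B (fst x) (fst y)) t)}"
    then show "hcomp_transf B (fst x) (fst y) (Ide (Fun_mod K B (fst y) (fst y)) (id_ftor B (fst y))) t = t"
      by (intro module_category_pair.hcomp_id(1)[OF pair]) auto
  next
    fix x y t assume "x \<in> A" "y \<in> A"
      "t \<in> {t \<in> Arr (Fun_mod K B (fst x) (fst y)). P x y (Dom (Fun_mod K B (fst x) (fst y)) t)
        \<and> P x y (Cod (Fun_mod K B (fst x) (fst y)) t)}"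
    then show "hcomp_transf B (fst x) (fst y) t (Ide (Fun_mod K B (fst x) (fst x)) (id_ftor B (fst x))) = t"
      by (intro module_category_pair.hcomp_id(2)[OF pair]) auto
  qed
qed

text \<open>The compatibility of a module functor with families of endomorphisms \<open>s\<^sub>x\<^sub>,\<^sub>m\<close> of \<open>x \<star> m\<close> that
  defines the 1-cells of both 2-categories.\<close>

definition preserves_twist ::
    "('o, 'a, 'k, 'y) mon_category_scheme \<Rightarrow> ('m, 'n, 'k, 'o, 'a) mod_category \<Rightarrow>
     ('p, 'q, 'k, 'o, 'a) mod_category \<Rightarrow> ('o \<Rightarrow> 'm \<Rightarrow> 'n) \<Rightarrow> ('o \<Rightarrow> 'p \<Rightarrow> 'q) \<Rightarrow>
     ('m, 'n, 'p, 'q, 'o) mod_ftor \<Rightarrow> bool" where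
  "preserves_twist B M N s t F \<longleftrightarrow> (\<forall>x \<in> Ob B. \<forall>m \<in> Ob M.
     FS F x m \<cdot>\<^bsub>N\<^esub> t x (FO F m) = FA F (s x m) \<cdot>\<^bsub>N\<^esub> FS F x m)"

definition twist_on ::
    "('o, 'a, 'k, 'y) mon_category_scheme \<Rightarrow> ('m, 'n, 'k, 'o, 'a) mod_category \<Rightarrow>
     ('o \<Rightarrow> 'm \<Rightarrow> 'n) \<Rightarrow> bool" where
  "twist_on B M s \<longleftrightarrow> (\<forall>x \<in> Ob B. \<forall>m \<in> Ob M. s x m \<in> Hom M (x \<star>\<^sub>o\<^bsub>M\<^esub> m) (x \<star>\<^sub>o\<^bsub>M\<^esub> m))"

lemma (in module_category) preserves_twist_id:
  "twist_on B M s \<Longrightarrow> preserves_twist B M M s s (id_ftor B M)"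
  by (auto simp: preserves_twist_def twist_on_def Hom_iff)

text \<open>The square of \<open>G \<circ> F\<close> is the square of \<open>G\<close> at \<open>F m\<close> pasted to the image under \<open>G\<close> of the square of \<open>F\<close>.\<close>

lemma (in module_category_triple) preserves_twist_comp:
  assumes tw: "twist_on B M s" "twist_on B N t" "twist_on B P u" and FG: "MN.mfun F" "NP.mfun G"
    and F: "preserves_twist B M N s t F" and G: "preserves_twist B N P t u G"
  shows "preserves_twist B M P s u (comp_ftor B M P G F)"
  unfolding preserves_twist_def
proof (intro ballI)
  note [simp] = FG
  fix x m assume [simp]: "x \<in> Ob B" "m \<in> Ob M"
  have s [simp]: "s x m \<in> Arr M" "Dom M (s x m) = x \<star>\<^sub>o\<^bsub>M\<^esub> m" "Cod M (s x m) = x \<star>\<^sub>o\<^bsub>M\<^esub> m"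
    using tw(1) by (auto simp: twist_on_def Hom_iff)
  have t [simp]: "t x (FO F m) \<in> Arr N" "Dom N (t x (FO F m)) = x \<star>\<^sub>o\<^bsub>N\<^esub> FO F m"
      "Cod N (t x (FO F m)) = x \<star>\<^sub>o\<^bsub>N\<^esub> FO F m"
    using tw(2) by (auto simp: twist_on_def Hom_iff)
  have u [simp]: "u x (FO G (FO F m)) \<in> Arr P" "Dom P (u x (FO G (FO F m))) = x \<star>\<^sub>o\<^bsub>P\<^esub> FO G (FO F m)"
      "Cod P (u x (FO G (FO F m))) = x \<star>\<^sub>o\<^bsub>P\<^esub> FO G (FO F m)"
    using tw(3) by (auto simp: twist_on_def Hom_iff)
  have eqF: "FS F x m \<cdot>\<^bsub>N\<^esub> t x (FO F m) = FA F (s x m) \<cdot>\<^bsub>N\<^esub> FS F x m"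
    using F by (simp add: preserves_twist_def)
  have eqG: "FS G x (FO F m) \<cdot>\<^bsub>P\<^esub> u x (FO G (FO F m)) = FA G (t x (FO F m)) \<cdot>\<^bsub>P\<^esub> FS G x (FO F m)"
    using G by (simp add: preserves_twist_def)
  have "FS (comp_ftor B M P G F) x m \<cdot>\<^bsub>P\<^esub> u x (FO (comp_ftor B M P G F) m)
      = FA G (FS F x m) \<cdot>\<^bsub>P\<^esub> (FS G x (FO F m) \<cdot>\<^bsub>P\<^esub> u x (FO G (FO F m)))"
    by simp
  also have "\<dots> = FA G (FS F x m \<cdot>\<^bsub>N\<^esub> t x (FO F m)) \<cdot>\<^bsub>P\<^esub> FS G x (FO F m)"
    by (simp add: eqG)
  also have "\<dots> = FA (comp_ftor B M P G F) (s x m) \<cdot>\<^bsub>P\<^esub> FS (comp_ftor B M P G F) x m"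
    by (simp add: eqF)
  finally show "FS (comp_ftor B M P G F) x m \<cdot>\<^bsub>P\<^esub> u x (FO (comp_ftor B M P G F) m)
      = FA (comp_ftor B M P G F) (s x m) \<cdot>\<^bsub>P\<^esub> FS (comp_ftor B M P G F) x m" .
qed

lemma preserves_twist_two_category:
  fixes w :: "'s \<Rightarrow> 'o \<Rightarrow> 'm \<Rightarrow> 'n" and A :: "(('m, 'n, 'k, 'o, 'a) mod_category \<times> 's) set"
  assumes "\<And>M s. (M, s) \<in> A \<Longrightarrow> module_category K B M \<and> twist_on B M (w s)"
  shows "two_category (structured_modules K B A (\<lambda>(M, s) (N, t). preserves_twist B M N (w s) (w t)))"
proof (rule structured_modules_two_category)
  fix x assume x: "x \<in> A"
  obtain M s where [simp]: "x = (M, s)"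
    by (cases x)
  have M: "module_category K B M" "twist_on B M (w s)"
    using assms[of M s] x by simp_all
  then show "module_category K B (fst x)"
    by simp
  show "(case x of (M, s) \<Rightarrow> \<lambda>(N, t). preserves_twist B M N (w s) (w t)) x (id_ftor B (fst x))"
    using module_category.preserves_twist_id[OF M] by simp
next
  fix x y z F G
  assume *: "x \<in> A" "y \<in> A" "z \<in> A" "module_functor K B (fst x) (fst y) F"
    "module_functor K B (fst y) (fst z) G"
    "(case x of (M, s) \<Rightarrow> \<lambda>(N, t). preserves_twist B M N (w s) (w t)) y F"
    "(case y of (M, s) \<Rightarrow> \<lambda>(N, t). preserves_twist B M N (w s) (w t)) z G"
  obtain M s N t P u where xyz: "x = (M, s)" "y = (N, t)" "z = (P, u)"
    by (cases x, cases y, cases z)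
  interpret module_category_triple K B M N P
    using * assms unfolding xyz
    by (intro module_category_triple.intro module_category_pair.intro) auto
  show "(case x of (M, s) \<Rightarrow> \<lambda>(N, t). preserves_twist B M N (w s) (w t)) z
      (comp_ftor B (fst x) (fst z) G F)"
    using * assms unfolding xyz by (auto intro: preserves_twist_comp)
qed

text \<open>The 2-functor that changes objects by \<open>h\<close> and leaves 1-cells and 2-cells as they are. It makes
  sense between 2-categories with the same cells; the canonical 2-functor and its inverse are of
  this form.\<close>

definition relabel ::
    "('x \<Rightarrow> 'y) \<Rightarrow> ('x, 'f, 't, 'y, 'f, 't) two_ftor" where
  "relabel h = \<lparr>TO = h, TH = (\<lambda>x y. \<lparr>FO = (\<lambda>F. F), FA = (\<lambda>t. t)\<rparr>)\<rparr>"

lemma relabel_simps [simp]: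
  "TO (relabel h) = h" "FO (TH (relabel h) x y) F = F" "FA (TH (relabel h) x y) t = t"
  by (simp_all add: relabel_def)

lemma comp_relabel: "comp_two_ftor (relabel g) (relabel h) = relabel (\<lambda>x. g (h x))"
  by (simp add: comp_two_ftor_def relabel_def)

lemma id_relabel: "id_two_ftor = relabel (\<lambda>x. x)"
  by (simp add: id_two_ftor_def relabel_def)

lemma relabel_two_functor:
  assumes "two_category (structured_modules K B A P)" "two_category (structured_modules K B A' P')"
    and "\<And>x. x \<in> A \<Longrightarrow> h x \<in> A' \<and> fst (h x) = fst x"
    and "\<And>x y F. \<lbrakk>x \<in> A; y \<in> A; F \<in> Ob (Fun_mod K B (fst x) (fst y))\<rbrakk>
      \<Longrightarrow> P' (h x) (h y) F \<longleftrightarrow> P x y F"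
  shows "two_functor (structured_modules K B A P) (structured_modules K B A' P') (relabel h)"
proof -
  interpret dom: two_category "structured_modules K B A P" by fact
  interpret cod: two_category "structured_modules K B A' P'" by fact
  show ?thesis
  proof (intro two_functor.intro two_functor_axioms.intro dom.two_category_axioms cod.two_category_axioms)
    fix x y assume "x \<in> Ob2 (structured_modules K B A P)" "y \<in> Ob2 (structured_modules K B A P)"
    then have xy: "x \<in> A" "y \<in> A"
      by simp_all
    let ?C = "full_subcategory (Fun_mod K B (fst x) (fst y)) (P x y)"
    let ?D = "full_subcategory (Fun_mod K B (fst (h x)) (fst (h y))) (P' (h x) (h y))"
    have "category ?C" "category ?D"
      using dom.hom_category[of x y] cod.hom_category[of "h x" "h y"] xy assms(3) by simp_all
    moreover have "Ob ?C = Ob ?D" "Arr ?C = Arr ?D" "Dom ?C = Dom ?D" "Cod ?C = Cod ?D"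
        "Ide ?C = Ide ?D" "Comp ?C = Comp ?D"
      using assms(3)[OF xy(1)] assms(3)[OF xy(2)] assms(4)[OF xy]
      by (auto simp: Fun_mod_arr_iff simp del: Fun_mod_simps(1))
    ultimately show "cat_functor (HomC (structured_modules K B A P) x y)
        (HomC (structured_modules K B A' P') (TO (relabel h) x) (TO (relabel h) y))
        (TH (relabel h) x y)"
      unfolding structured_modules_simps relabel_simps
      by (intro cat_functor.intro cat_functor_axioms.intro) (auto simp: Hom_def)
  qed (use assms(3) in auto)
qed

text \<open>Two such 2-functors with the same values on the objects in question differ only outside of them.
  They need not be equal as functions, so the comparison is by identity 1-cells.\<close>

lemma relabel_natural_isomorphism:
  assumes S: "two_functor (structured_modules K B A P) (structured_modules K B A' P') (relabel g)"
    and T: "two_functor (structured_modules K B A P) (structured_modules K B A' P') (relabel h)"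
    and eq: "\<And>x. x \<in> A \<Longrightarrow> g x = h x"
  shows "two_natural_isomorphism (structured_modules K B A P) (structured_modules K B A' P')
    (relabel g) (relabel h) (\<lambda>x. id_ftor B (fst (h x)))"
proof -
  interpret S: two_functor "structured_modules K B A P" "structured_modules K B A' P'" "relabel g"
    by fact
  interpret T: two_functor "structured_modules K B A P" "structured_modules K B A' P'" "relabel h"
    by fact
  note ob = T.to_closed[unfolded structured_modules_simps(1) relabel_simps]
  note id1 = S.cod.id1_closed[unfolded structured_modules_simps(1)]
  note on_cells = T.th_functor[unfolded structured_modules_simps(1)]
  show ?thesis
  proof (intro two_natural_isomorphism.intro two_natural_isomorphism_axioms.intro S T)
    fix x assume "x \<in> Ob2 (structured_modules K B A P)"
    then have x: "x \<in> A" by simp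
    show "id_ftor B (fst (h x)) \<in> Cell1 (structured_modules K B A' P') (TO (relabel g) x) (TO (relabel h) x)"
      using id1[OF ob[OF x]] by (simp add: eq[OF x])
    show "\<exists>v \<in> Cell1 (structured_modules K B A' P') (TO (relabel h) x) (TO (relabel g) x).
      HC1 (structured_modules K B A' P') (TO (relabel g) x) (TO (relabel h) x) (TO (relabel g) x) v
          (id_ftor B (fst (h x)))
        = Id1 (structured_modules K B A' P') (TO (relabel g) x) \<and>
      HC1 (structured_modules K B A' P') (TO (relabel h) x) (TO (relabel g) x) (TO (relabel h) x)
          (id_ftor B (fst (h x))) v
        = Id1 (structured_modules K B A' P') (TO (relabel h) x)"
      using id1[OF ob[OF x]] S.cod.hc1_id_left[of "h x" "h x" "id_ftor B (fst (h x))"] ob[OF x]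
      by (intro bexI[of _ "id_ftor B (fst (h x))"]) (auto simp: eq[OF x])
  next
    fix x y f
    assume *: "x \<in> Ob2 (structured_modules K B A P)" "y \<in> Ob2 (structured_modules K B A P)"
      "f \<in> Cell1 (structured_modules K B A P) x y"
    then have xy: "x \<in> A" "y \<in> A" by simp_all
    have f: "f \<in> Cell1 (structured_modules K B A' P') (h x) (h y)"
      using cat_functor.ob_closed[OF on_cells[OF xy], of f] *(3) by simp
    show "HC1 (structured_modules K B A' P') (TO (relabel g) x) (TO (relabel g) y) (TO (relabel h) y)
        (id_ftor B (fst (h y))) (FO (TH (relabel g) x y) f)
      = HC1 (structured_modules K B A' P') (TO (relabel g) x) (TO (relabel h) x) (TO (relabel h) y)
          (FO (TH (relabel h) x y) f) (id_ftor B (fst (h x)))"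
      using S.cod.hc1_id_left[of "h x" "h y" f] S.cod.hc1_id_right[of "h x" "h y" f] f
        ob[OF xy(1)] ob[OF xy(2)]
      by (simp add: eq xy)
  next
    fix x y t
    assume *: "x \<in> Ob2 (structured_modules K B A P)" "y \<in> Ob2 (structured_modules K B A P)"
      "t \<in> Cell2 (structured_modules K B A P) x y"
    then have xy: "x \<in> A" "y \<in> A" by simp_all
    have t: "t \<in> Cell2 (structured_modules K B A' P') (h x) (h y)"
      using cat_functor.FA_arr(1)[OF on_cells[OF xy], of t] *(3) by simp
    show "HC2 (structured_modules K B A' P') (TO (relabel g) x) (TO (relabel g) y) (TO (relabel h) y)
        (Id2 (structured_modules K B A' P') (TO (relabel g) y) (TO (relabel h) y) (id_ftor B (fst (h y))))
        (FA (TH (relabel g) x y) t)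
      = HC2 (structured_modules K B A' P') (TO (relabel g) x) (TO (relabel h) x) (TO (relabel h) y)
          (FA (TH (relabel h) x y) t)
          (Id2 (structured_modules K B A' P') (TO (relabel g) x) (TO (relabel h) x) (id_ftor B (fst (h x))))"
      using S.cod.hc2_id_left[of "h x" "h y" t] S.cod.hc2_id_right[of "h x" "h y" t] t
        ob[OF xy(1)] ob[OF xy(2)]
      by (simp add: eq xy del: Fun_mod_simps)
  qed
qed

lemma relabel_two_equivalence:
  assumes C: "two_category (structured_modules K B A P)"
    and D: "two_category (structured_modules K B A' P')"
    and h: "\<And>x. x \<in> A \<Longrightarrow> h x \<in> A' \<and> fst (h x) = fst x \<and> g (h x) = x"
    and g: "\<And>y. y \<in> A' \<Longrightarrow> g y \<in> A \<and> h (g y) = y"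
    and P: "\<And>x y F. \<lbrakk>x \<in> A; y \<in> A; F \<in> Ob (Fun_mod K B (fst x) (fst y))\<rbrakk>
      \<Longrightarrow> P' (h x) (h y) F \<longleftrightarrow> P x y F"
  shows "two_equivalence (structured_modules K B A P) (structured_modules K B A' P') (relabel h)"
proof -
  have fst_g: "fst (g y) = fst y" if "y \<in> A'" for y
    using h[of "g y"] g[OF that] by metis
  have P': "P (g x) (g y) F \<longleftrightarrow> P' x y F"
    if "x \<in> A'" "y \<in> A'" "F \<in> Ob (Fun_mod K B (fst x) (fst y))" for x y F
    using P[of "g x" "g y" F] g[OF that(1)] g[OF that(2)] that fst_g by auto
  have Th: "two_functor (structured_modules K B A P) (structured_modules K B A' P') (relabel h)"
    using h P by (intro relabel_two_functor[OF C D]) auto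
  have Tg: "two_functor (structured_modules K B A' P') (structured_modules K B A P) (relabel g)"
    using g fst_g P' by (intro relabel_two_functor[OF D C]) auto
  have "two_natural_isomorphism (structured_modules K B A P) (structured_modules K B A P)
      id_two_ftor (comp_two_ftor (relabel g) (relabel h)) (\<lambda>x. id_ftor B (fst (g (h x))))"
    unfolding comp_relabel id_relabel
    by (intro relabel_natural_isomorphism relabel_two_functor[OF C C]) (auto simp: h)
  moreover have "two_natural_isomorphism (structured_modules K B A' P') (structured_modules K B A' P')
      (comp_two_ftor (relabel h) (relabel g)) id_two_ftor (\<lambda>x. id_ftor B (fst x))"
    unfolding comp_relabel id_relabel
    by (intro relabel_natural_isomorphism relabel_two_functor[OF D D]) (auto simp: g)
  ultimately show ?thesis
    unfolding two_equivalence_def using Th Tg by blast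
qed


section \<open>Braidings acting on a module category\<close>

text \<open>A braiding together with its inverse, \<open>d x y\<close> being inverse to \<open>c x y\<close>. Keeping the inverse as a
  parameter makes the passage to the reverse braiding exchange the two roles symmetrically, without
  an inverse of an inverse.\<close>

locale braiding = linear_monoidal_category K B
  for K :: "'k ring" and B :: "('o, 'a, 'k, 'y) mon_category_scheme" +
  fixes c d :: "'o \<Rightarrow> 'o \<Rightarrow> 'a"
  assumes c_closed: "\<lbrakk>x \<in> Ob B; y \<in> Ob B\<rbrakk> \<Longrightarrow> c x y \<in> Hom B (x \<otimes>\<^sub>o\<^bsub>B\<^esub> y) (y \<otimes>\<^sub>o\<^bsub>B\<^esub> x)"
    and c_inverse: "\<lbrakk>x \<in> Ob B; y \<in> Ob B\<rbrakk> \<Longrightarrow> inverse_arrows B (c x y) (d x y)"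
    and c_natural: "\<lbrakk>f \<in> Hom B x x'; g \<in> Hom B y y'\<rbrakk> \<Longrightarrow>
      c x' y' \<cdot>\<^bsub>B\<^esub> (f \<otimes>\<^sub>a\<^bsub>B\<^esub> g) = (g \<otimes>\<^sub>a\<^bsub>B\<^esub> f) \<cdot>\<^bsub>B\<^esub> c x y"
    and c_hexagon1: "\<lbrakk>x \<in> Ob B; y \<in> Ob B; z \<in> Ob B\<rbrakk> \<Longrightarrow>
      Assoc B y z x \<cdot>\<^bsub>B\<^esub> c x (y \<otimes>\<^sub>o\<^bsub>B\<^esub> z) \<cdot>\<^bsub>B\<^esub> Assoc B x y z
        = (Ide B y \<otimes>\<^sub>a\<^bsub>B\<^esub> c x z) \<cdot>\<^bsub>B\<^esub> Assoc B y x z \<cdot>\<^bsub>B\<^esub> (c x y \<otimes>\<^sub>a\<^bsub>B\<^esub> Ide B z)"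
    and c_hexagon2: "\<lbrakk>x \<in> Ob B; y \<in> Ob B; z \<in> Ob B\<rbrakk> \<Longrightarrow>
      inv_arrow B (Assoc B z x y) \<cdot>\<^bsub>B\<^esub> c (x \<otimes>\<^sub>o\<^bsub>B\<^esub> y) z \<cdot>\<^bsub>B\<^esub> inv_arrow B (Assoc B x y z)
        = (c x z \<otimes>\<^sub>a\<^bsub>B\<^esub> Ide B y) \<cdot>\<^bsub>B\<^esub> inv_arrow B (Assoc B x z y) \<cdot>\<^bsub>B\<^esub> (Ide B x \<otimes>\<^sub>a\<^bsub>B\<^esub> c y z)"
begin

lemma c_arr [simp]:
  assumes "x \<in> Ob B" "y \<in> Ob B"
  shows "c x y \<in> Arr B" "Dom B (c x y) = x \<otimes>\<^sub>o\<^bsub>B\<^esub> y" "Cod B (c x y) = y \<otimes>\<^sub>o\<^bsub>B\<^esub> x"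
    "iso_arrow B (c x y)" "inv_arrow B (c x y) = d x y"
    "d x y \<in> Arr B" "Dom B (d x y) = y \<otimes>\<^sub>o\<^bsub>B\<^esub> x" "Cod B (d x y) = x \<otimes>\<^sub>o\<^bsub>B\<^esub> y"
    "iso_arrow B (d x y)" "inv_arrow B (d x y) = c x y"
proof -
  show c: "c x y \<in> Arr B" "Dom B (c x y) = x \<otimes>\<^sub>o\<^bsub>B\<^esub> y" "Cod B (c x y) = y \<otimes>\<^sub>o\<^bsub>B\<^esub> x"
    using c_closed[OF assms] by (auto simp: Hom_iff)
  show i: "iso_arrow B (c x y)" "inv_arrow B (c x y) = d x y"
    using c_inverse[OF assms] by (auto simp: iso_arrow_def inv_arrow_eq)
  show "d x y \<in> Arr B" "Dom B (d x y) = y \<otimes>\<^sub>o\<^bsub>B\<^esub> x" "Cod B (d x y) = x \<otimes>\<^sub>o\<^bsub>B\<^esub> y"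
    "iso_arrow B (d x y)" "inv_arrow B (d x y) = c x y"
    using inv_arr(1-3)[OF i(1)] iso_inv[OF i(1)] by (simp_all add: i(2) c)
qed

lemma c_nat:
  "\<lbrakk>f \<in> Arr B; g \<in> Arr B; Cod B f = x; Cod B g = y\<rbrakk> \<Longrightarrow>
    c x y \<cdot>\<^bsub>B\<^esub> (f \<otimes>\<^sub>a\<^bsub>B\<^esub> g) = (g \<otimes>\<^sub>a\<^bsub>B\<^esub> f) \<cdot>\<^bsub>B\<^esub> c (Dom B f) (Dom B g)"
  by (rule c_natural) (auto simp: Hom_iff)

text \<open>Inverting a hexagon of \<open>c\<close> gives the other hexagon for the reverse braiding.\<close>

lemma reverse_braiding: "braiding K B (\<lambda>x y. d y x) (\<lambda>x y. c y x)"
proof (intro braiding.intro braiding_axioms.intro linear_monoidal_category_axioms)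
  fix x y assume "x \<in> Ob B" "y \<in> Ob B"
  then show "d y x \<in> Hom B (x \<otimes>\<^sub>o\<^bsub>B\<^esub> y) (y \<otimes>\<^sub>o\<^bsub>B\<^esub> x)" "inverse_arrows B (d y x) (c y x)"
    using inverse_arrows_inv[of "d y x"] by (auto simp: Hom_iff)
next
  fix f x x' g y y' assume *: "f \<in> Hom B x x'" "g \<in> Hom B y y'"
  then have "inv_arrow B (c y' x') \<cdot>\<^bsub>B\<^esub> (f \<otimes>\<^sub>a\<^bsub>B\<^esub> g) = (g \<otimes>\<^sub>a\<^bsub>B\<^esub> f) \<cdot>\<^bsub>B\<^esub> inv_arrow B (c y x)"
    by (intro inverse_square c_natural) (auto simp: Hom_iff)
  then show "d y' x' \<cdot>\<^bsub>B\<^esub> (f \<otimes>\<^sub>a\<^bsub>B\<^esub> g) = (g \<otimes>\<^sub>a\<^bsub>B\<^esub> f) \<cdot>\<^bsub>B\<^esub> d y x"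
    using * by (auto simp: Hom_iff)
next
  fix x y z assume [simp]: "x \<in> Ob B" "y \<in> Ob B" "z \<in> Ob B"
  show "Assoc B y z x \<cdot>\<^bsub>B\<^esub> d (y \<otimes>\<^sub>o\<^bsub>B\<^esub> z) x \<cdot>\<^bsub>B\<^esub> Assoc B x y z
      = (Ide B y \<otimes>\<^sub>a\<^bsub>B\<^esub> d z x) \<cdot>\<^bsub>B\<^esub> Assoc B y x z \<cdot>\<^bsub>B\<^esub> (d y x \<otimes>\<^sub>a\<^bsub>B\<^esub> Ide B z)"
    using arg_cong[OF c_hexagon2[of y z x], of "inv_arrow B"] by simp
  show "inv_arrow B (Assoc B z x y) \<cdot>\<^bsub>B\<^esub> d z (x \<otimes>\<^sub>o\<^bsub>B\<^esub> y) \<cdot>\<^bsub>B\<^esub> inv_arrow B (Assoc B x y z)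
      = (d z x \<otimes>\<^sub>a\<^bsub>B\<^esub> Ide B y) \<cdot>\<^bsub>B\<^esub> inv_arrow B (Assoc B x z y) \<cdot>\<^bsub>B\<^esub> (Ide B x \<otimes>\<^sub>a\<^bsub>B\<^esub> d z y)"
    using arg_cong[OF c_hexagon1[of z x y], of "inv_arrow B"] by simp
qed

end

context module_category
begin

lemma inv_massoc_nat:
  assumes "f \<in> Arr B" "g \<in> Arr B" "h \<in> Arr M" "Cod B f = x" "Cod B g = y" "Cod M h = m"
  shows "inv_arrow M (MAssoc M x y m) \<cdot>\<^bsub>M\<^esub> (f \<star>\<^sub>a\<^bsub>M\<^esub> g \<star>\<^sub>a\<^bsub>M\<^esub> h)
    = ((f \<otimes>\<^sub>a\<^bsub>B\<^esub> g) \<star>\<^sub>a\<^bsub>M\<^esub> h) \<cdot>\<^bsub>M\<^esub> inv_arrow M (MAssoc M (Dom B f) (Dom B g) (Dom M h))"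
  using assms by (intro inverse_square massoc_nat) auto

text \<open>The pentagon as a rewrite rule for composites associated to the right.\<close>

lemma mpentagon_right:
  assumes "x \<in> Ob B" "y \<in> Ob B" "z \<in> Ob B" "m \<in> Ob M"
  shows "(Ide B x \<star>\<^sub>a\<^bsub>M\<^esub> MAssoc M y z m) \<cdot>\<^bsub>M\<^esub> (MAssoc M x (y \<otimes>\<^sub>o\<^bsub>B\<^esub> z) m
      \<cdot>\<^bsub>M\<^esub> (Assoc B x y z \<star>\<^sub>a\<^bsub>M\<^esub> Ide M m))
    = MAssoc M x y (z \<star>\<^sub>o\<^bsub>M\<^esub> m) \<cdot>\<^bsub>M\<^esub> MAssoc M (x \<otimes>\<^sub>o\<^bsub>B\<^esub> y) z m"
  using mpentagon[OF assms] assms by simp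

text \<open>The unit isomorphism conjugates the action of the unit object into the identity functor.\<close>

lemma act_unit_faithful:
  assumes "f \<in> Arr M" "g \<in> Arr M" "Dom M f = Dom M g" "Cod M f = Cod M g"
    and "Ide B (TUnit B) \<star>\<^sub>a\<^bsub>M\<^esub> f = Ide B (TUnit B) \<star>\<^sub>a\<^bsub>M\<^esub> g"
  shows "f = g"
  using munit_nat[OF assms(1) refl] munit_nat[OF assms(2) refl] assms
  by (intro cancel_right[of "MUnit M (Dom M f)" f g]) auto

text \<open>Kelly's argument: after acting with the unit object the equation becomes a consequence of the
  pentagon, the two triangles and naturality.\<close>

lemma munit_massoc:
  assumes [simp]: "x \<in> Ob B" "m \<in> Ob M"
  shows "MUnit M (x \<star>\<^sub>o\<^bsub>M\<^esub> m) \<cdot>\<^bsub>M\<^esub> MAssoc M (TUnit B) x m = LUnit B x \<star>\<^sub>a\<^bsub>M\<^esub> Ide M m"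
proof (rule act_unit_faithful)
  let ?I = "TUnit B" and ?i = "Ide B (TUnit B)"
  let ?e = "MAssoc M ?I (?I \<otimes>\<^sub>o\<^bsub>B\<^esub> x) m \<cdot>\<^bsub>M\<^esub> (Assoc B ?I ?I x \<star>\<^sub>a\<^bsub>M\<^esub> Ide M m)"
  have "(?i \<star>\<^sub>a\<^bsub>M\<^esub> (MUnit M (x \<star>\<^sub>o\<^bsub>M\<^esub> m) \<cdot>\<^bsub>M\<^esub> MAssoc M ?I x m)) \<cdot>\<^bsub>M\<^esub> ?e
    = (?i \<star>\<^sub>a\<^bsub>M\<^esub> MUnit M (x \<star>\<^sub>o\<^bsub>M\<^esub> m)) \<cdot>\<^bsub>M\<^esub> ((?i \<star>\<^sub>a\<^bsub>M\<^esub> MAssoc M ?I x m) \<cdot>\<^bsub>M\<^esub> MAssoc M ?I (?I \<otimes>\<^sub>o\<^bsub>B\<^esub> x) m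
        \<cdot>\<^bsub>M\<^esub> (Assoc B ?I ?I x \<star>\<^sub>a\<^bsub>M\<^esub> Ide M m))"
    by (simp add: act.BA_comp_extend)
  also have "\<dots> = ((?i \<star>\<^sub>a\<^bsub>M\<^esub> MUnit M (x \<star>\<^sub>o\<^bsub>M\<^esub> m)) \<cdot>\<^bsub>M\<^esub> MAssoc M ?I ?I (x \<star>\<^sub>o\<^bsub>M\<^esub> m))
        \<cdot>\<^bsub>M\<^esub> MAssoc M (?I \<otimes>\<^sub>o\<^bsub>B\<^esub> ?I) x m"
    by (simp add: mpentagon_right)
  also have "\<dots> = (RUnit B ?I \<star>\<^sub>a\<^bsub>M\<^esub> Ide M (x \<star>\<^sub>o\<^bsub>M\<^esub> m)) \<cdot>\<^bsub>M\<^esub> MAssoc M (?I \<otimes>\<^sub>o\<^bsub>B\<^esub> ?I) x m"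
    by (simp add: mtriangle del: assoc_arr)
  also have "\<dots> = MAssoc M ?I x m \<cdot>\<^bsub>M\<^esub> ((RUnit B ?I \<otimes>\<^sub>a\<^bsub>B\<^esub> Ide B x) \<star>\<^sub>a\<^bsub>M\<^esub> Ide M m)"
    by (simp add: massoc_nat)
  also have "\<dots> = MAssoc M ?I x m \<cdot>\<^bsub>M\<^esub> ((?i \<otimes>\<^sub>a\<^bsub>B\<^esub> LUnit B x) \<star>\<^sub>a\<^bsub>M\<^esub> Ide M m) \<cdot>\<^bsub>M\<^esub> (Assoc B ?I ?I x \<star>\<^sub>a\<^bsub>M\<^esub> Ide M m)"
    by (simp add: act.BA_comp flip: base.triangle)
  also have "\<dots> = (?i \<star>\<^sub>a\<^bsub>M\<^esub> (LUnit B x \<star>\<^sub>a\<^bsub>M\<^esub> Ide M m)) \<cdot>\<^bsub>M\<^esub> ?e"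
    by (simp add: massoc_nat)
  finally show "?i \<star>\<^sub>a\<^bsub>M\<^esub> (MUnit M (x \<star>\<^sub>o\<^bsub>M\<^esub> m) \<cdot>\<^bsub>M\<^esub> MAssoc M ?I x m) = ?i \<star>\<^sub>a\<^bsub>M\<^esub> (LUnit B x \<star>\<^sub>a\<^bsub>M\<^esub> Ide M m)"
    by (rule cancel_right[rotated]) simp_all
qed simp_all

end

locale braided_action = module_category K B M + braid: braiding K B c d
  for K :: "'k ring" and B :: "('o, 'a, 'k, 'y) mon_category_scheme"
    and M :: "('m, 'n, 'k, 'o, 'a) mod_category" and c d :: "'o \<Rightarrow> 'o \<Rightarrow> 'a"
begin

text \<open>The action of the braiding on iterated actions. Since \<open>swap\<close> and \<open>unswap\<close> relate products of the form
  \<open>x \<star> (y \<star> m)\<close> only, calculations with them need associators just where a tensor product in \<open>B\<close> is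
  involved. The module structure of \<open>\<alpha>\<^sup>+(x)\<close> is \<open>unswap x y m\<close>.\<close>

definition swap :: "'o \<Rightarrow> 'o \<Rightarrow> 'm \<Rightarrow> 'n" where
  "swap x y m = MAssoc M y x m \<cdot>\<^bsub>M\<^esub> (c x y \<star>\<^sub>a\<^bsub>M\<^esub> Ide M m) \<cdot>\<^bsub>M\<^esub> inv_arrow M (MAssoc M x y m)"

definition unswap :: "'o \<Rightarrow> 'o \<Rightarrow> 'm \<Rightarrow> 'n" where
  "unswap x y m = MAssoc M x y m \<cdot>\<^bsub>M\<^esub> (d x y \<star>\<^sub>a\<^bsub>M\<^esub> Ide M m) \<cdot>\<^bsub>M\<^esub> inv_arrow M (MAssoc M y x m)"

lemma swap_arr [simp]:
  assumes "x \<in> Ob B" "y \<in> Ob B" "m \<in> Ob M"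
  shows "swap x y m \<in> Arr M" "Dom M (swap x y m) = x \<star>\<^sub>o\<^bsub>M\<^esub> y \<star>\<^sub>o\<^bsub>M\<^esub> m"
    "Cod M (swap x y m) = y \<star>\<^sub>o\<^bsub>M\<^esub> x \<star>\<^sub>o\<^bsub>M\<^esub> m" "iso_arrow M (swap x y m)" "inv_arrow M (swap x y m) = unswap x y m"
    "unswap x y m \<in> Arr M" "Dom M (unswap x y m) = y \<star>\<^sub>o\<^bsub>M\<^esub> x \<star>\<^sub>o\<^bsub>M\<^esub> m"
    "Cod M (unswap x y m) = x \<star>\<^sub>o\<^bsub>M\<^esub> y \<star>\<^sub>o\<^bsub>M\<^esub> m" "iso_arrow M (unswap x y m)"
    "inv_arrow M (unswap x y m) = swap x y m"
  using assms by (simp_all add: swap_def unswap_def)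

lemma swap_unswap [simp]:
  assumes "x \<in> Ob B" "y \<in> Ob B" "m \<in> Ob M"
  shows "swap x y m \<cdot>\<^bsub>M\<^esub> unswap x y m = Ide M (y \<star>\<^sub>o\<^bsub>M\<^esub> x \<star>\<^sub>o\<^bsub>M\<^esub> m)"
    "unswap x y m \<cdot>\<^bsub>M\<^esub> swap x y m = Ide M (x \<star>\<^sub>o\<^bsub>M\<^esub> y \<star>\<^sub>o\<^bsub>M\<^esub> m)"
  using inv_arr(4,5)[of "swap x y m"] assms by simp_all

lemma swap_massoc:
  assumes "x \<in> Ob B" "y \<in> Ob B" "m \<in> Ob M"
  shows "swap x y m \<cdot>\<^bsub>M\<^esub> MAssoc M x y m = MAssoc M y x m \<cdot>\<^bsub>M\<^esub> (c x y \<star>\<^sub>a\<^bsub>M\<^esub> Ide M m)"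
  using assms by (simp add: swap_def)

lemma swap_nat:
  assumes "f \<in> Arr B" "g \<in> Arr B" "h \<in> Arr M" "Cod B f = x" "Cod B g = y" "Cod M h = m"
  shows "swap x y m \<cdot>\<^bsub>M\<^esub> (f \<star>\<^sub>a\<^bsub>M\<^esub> g \<star>\<^sub>a\<^bsub>M\<^esub> h)
    = (g \<star>\<^sub>a\<^bsub>M\<^esub> f \<star>\<^sub>a\<^bsub>M\<^esub> h) \<cdot>\<^bsub>M\<^esub> swap (Dom B f) (Dom B g) (Dom M h)"
proof -
  have [simp]: "x \<in> Ob B" "y \<in> Ob B" "m \<in> Ob M"
    using assms by auto
  have "swap x y m \<cdot>\<^bsub>M\<^esub> (f \<star>\<^sub>a\<^bsub>M\<^esub> g \<star>\<^sub>a\<^bsub>M\<^esub> h)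
    = MAssoc M y x m \<cdot>\<^bsub>M\<^esub> (((c x y \<cdot>\<^bsub>B\<^esub> (f \<otimes>\<^sub>a\<^bsub>B\<^esub> g)) \<star>\<^sub>a\<^bsub>M\<^esub> h)
        \<cdot>\<^bsub>M\<^esub> inv_arrow M (MAssoc M (Dom B f) (Dom B g) (Dom M h)))"
    using assms by (simp add: swap_def inv_massoc_nat act.BA_collect)
  also have "\<dots> = (MAssoc M y x m \<cdot>\<^bsub>M\<^esub> ((g \<otimes>\<^sub>a\<^bsub>B\<^esub> f) \<star>\<^sub>a\<^bsub>M\<^esub> h))
        \<cdot>\<^bsub>M\<^esub> ((c (Dom B f) (Dom B g) \<star>\<^sub>a\<^bsub>M\<^esub> Ide M (Dom M h)) \<cdot>\<^bsub>M\<^esub> inv_arrow M (MAssoc M (Dom B f) (Dom B g) (Dom M h)))"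
    using assms by (simp add: braid.c_nat act.BA_collect)
  also have "\<dots> = (g \<star>\<^sub>a\<^bsub>M\<^esub> f \<star>\<^sub>a\<^bsub>M\<^esub> h) \<cdot>\<^bsub>M\<^esub> swap (Dom B f) (Dom B g) (Dom M h)"
    using assms by (simp add: swap_def massoc_nat del: assoc_arr) simp
  finally show ?thesis .
qed

lemma reverse: "braided_action K B M (\<lambda>x y. d y x) (\<lambda>x y. c y x)"
  by (intro braided_action.intro module_category_axioms braid.reverse_braiding)

text \<open>The hexagon acts on \<open>m\<close> inside bracketings of \<open>x\<close>, \<open>y\<close>, \<open>z\<close> as objects of \<open>B\<close>, the claim speaks of iterated
  actions; three pentagons translate between the two. After composing with the isomorphism \<open>?e\<close> from
  \<open>((x \<otimes> y) \<otimes> z) \<star> m\<close>, where the hexagon starts, they apply one after the other.\<close>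

lemma hexagon1_act:
  assumes [simp]: "x \<in> Ob B" "y \<in> Ob B" "z \<in> Ob B" "m \<in> Ob M"
  shows "MAssoc M y z (x \<star>\<^sub>o\<^bsub>M\<^esub> m) \<cdot>\<^bsub>M\<^esub> swap x (y \<otimes>\<^sub>o\<^bsub>B\<^esub> z) m
    = (Ide B y \<star>\<^sub>a\<^bsub>M\<^esub> swap x z m) \<cdot>\<^bsub>M\<^esub> (swap x y (z \<star>\<^sub>o\<^bsub>M\<^esub> m) \<cdot>\<^bsub>M\<^esub> (Ide B x \<star>\<^sub>a\<^bsub>M\<^esub> MAssoc M y z m))"
proof (rule cancel_right)
  let ?m = "Ide M m"
  let ?e = "MAssoc M x (y \<otimes>\<^sub>o\<^bsub>B\<^esub> z) m \<cdot>\<^bsub>M\<^esub> (Assoc B x y z \<star>\<^sub>a\<^bsub>M\<^esub> ?m)"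
  have "(MAssoc M y z (x \<star>\<^sub>o\<^bsub>M\<^esub> m) \<cdot>\<^bsub>M\<^esub> swap x (y \<otimes>\<^sub>o\<^bsub>B\<^esub> z) m) \<cdot>\<^bsub>M\<^esub> ?e
    = (MAssoc M y z (x \<star>\<^sub>o\<^bsub>M\<^esub> m) \<cdot>\<^bsub>M\<^esub> MAssoc M (y \<otimes>\<^sub>o\<^bsub>B\<^esub> z) x m)
        \<cdot>\<^bsub>M\<^esub> ((c x (y \<otimes>\<^sub>o\<^bsub>B\<^esub> z) \<cdot>\<^bsub>B\<^esub> Assoc B x y z) \<star>\<^sub>a\<^bsub>M\<^esub> ?m)"
    by (simp add: swap_def act.BA_comp)
  also have "\<dots> = (Ide B y \<star>\<^sub>a\<^bsub>M\<^esub> MAssoc M z x m) \<cdot>\<^bsub>M\<^esub> (MAssoc M y (z \<otimes>\<^sub>o\<^bsub>B\<^esub> x) m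
        \<cdot>\<^bsub>M\<^esub> ((Assoc B y z x \<cdot>\<^bsub>B\<^esub> c x (y \<otimes>\<^sub>o\<^bsub>B\<^esub> z) \<cdot>\<^bsub>B\<^esub> Assoc B x y z) \<star>\<^sub>a\<^bsub>M\<^esub> ?m))"
    by (simp add: mpentagon act.BA_comp)
  also have "\<dots> = (Ide B y \<star>\<^sub>a\<^bsub>M\<^esub> MAssoc M z x m) \<cdot>\<^bsub>M\<^esub> ((MAssoc M y (z \<otimes>\<^sub>o\<^bsub>B\<^esub> x) m
        \<cdot>\<^bsub>M\<^esub> ((Ide B y \<otimes>\<^sub>a\<^bsub>B\<^esub> c x z) \<star>\<^sub>a\<^bsub>M\<^esub> ?m)) \<cdot>\<^bsub>M\<^esub> ((Assoc B y x z \<cdot>\<^bsub>B\<^esub> (c x y \<otimes>\<^sub>a\<^bsub>B\<^esub> Ide B z)) \<star>\<^sub>a\<^bsub>M\<^esub> ?m))"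
    by (simp only: braid.c_hexagon1 assms) (simp add: act.BA_comp)
  also have "\<dots> = (Ide B y \<star>\<^sub>a\<^bsub>M\<^esub> (MAssoc M z x m \<cdot>\<^bsub>M\<^esub> (c x z \<star>\<^sub>a\<^bsub>M\<^esub> ?m))) \<cdot>\<^bsub>M\<^esub> (MAssoc M y (x \<otimes>\<^sub>o\<^bsub>B\<^esub> z) m
        \<cdot>\<^bsub>M\<^esub> ((Assoc B y x z \<cdot>\<^bsub>B\<^esub> (c x y \<otimes>\<^sub>a\<^bsub>B\<^esub> Ide B z)) \<star>\<^sub>a\<^bsub>M\<^esub> ?m))"
    by (subst massoc_nat) (simp_all add: act.BA_collect)
  also have "\<dots> = (Ide B y \<star>\<^sub>a\<^bsub>M\<^esub> swap x z m) \<cdot>\<^bsub>M\<^esub> (((Ide B y \<star>\<^sub>a\<^bsub>M\<^esub> MAssoc M x z m)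
        \<cdot>\<^bsub>M\<^esub> (MAssoc M y (x \<otimes>\<^sub>o\<^bsub>B\<^esub> z) m \<cdot>\<^bsub>M\<^esub> (Assoc B y x z \<star>\<^sub>a\<^bsub>M\<^esub> ?m))) \<cdot>\<^bsub>M\<^esub> ((c x y \<otimes>\<^sub>a\<^bsub>B\<^esub> Ide B z) \<star>\<^sub>a\<^bsub>M\<^esub> ?m))"
    by (simp add: act.BA_collect flip: swap_massoc)
  also have "\<dots> = (Ide B y \<star>\<^sub>a\<^bsub>M\<^esub> swap x z m) \<cdot>\<^bsub>M\<^esub> ((MAssoc M y x (z \<star>\<^sub>o\<^bsub>M\<^esub> m)
        \<cdot>\<^bsub>M\<^esub> MAssoc M (y \<otimes>\<^sub>o\<^bsub>B\<^esub> x) z m) \<cdot>\<^bsub>M\<^esub> ((c x y \<otimes>\<^sub>a\<^bsub>B\<^esub> Ide B z) \<star>\<^sub>a\<^bsub>M\<^esub> ?m))"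
    by (simp only: mpentagon_right assms)
  also have "\<dots> = (Ide B y \<star>\<^sub>a\<^bsub>M\<^esub> swap x z m) \<cdot>\<^bsub>M\<^esub> ((MAssoc M y x (z \<star>\<^sub>o\<^bsub>M\<^esub> m)
        \<cdot>\<^bsub>M\<^esub> (c x y \<star>\<^sub>a\<^bsub>M\<^esub> Ide M (z \<star>\<^sub>o\<^bsub>M\<^esub> m))) \<cdot>\<^bsub>M\<^esub> MAssoc M (x \<otimes>\<^sub>o\<^bsub>B\<^esub> y) z m)"
    by (simp add: massoc_nat)
  also have "\<dots> = (Ide B y \<star>\<^sub>a\<^bsub>M\<^esub> swap x z m) \<cdot>\<^bsub>M\<^esub> (swap x y (z \<star>\<^sub>o\<^bsub>M\<^esub> m)
        \<cdot>\<^bsub>M\<^esub> (MAssoc M x y (z \<star>\<^sub>o\<^bsub>M\<^esub> m) \<cdot>\<^bsub>M\<^esub> MAssoc M (x \<otimes>\<^sub>o\<^bsub>B\<^esub> y) z m))"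
    by (simp flip: swap_massoc)
  also have "\<dots> = ((Ide B y \<star>\<^sub>a\<^bsub>M\<^esub> swap x z m) \<cdot>\<^bsub>M\<^esub> (swap x y (z \<star>\<^sub>o\<^bsub>M\<^esub> m)
        \<cdot>\<^bsub>M\<^esub> (Ide B x \<star>\<^sub>a\<^bsub>M\<^esub> MAssoc M y z m))) \<cdot>\<^bsub>M\<^esub> ?e"
    by (simp flip: mpentagon_right)
  finally show "(MAssoc M y z (x \<star>\<^sub>o\<^bsub>M\<^esub> m) \<cdot>\<^bsub>M\<^esub> swap x (y \<otimes>\<^sub>o\<^bsub>B\<^esub> z) m) \<cdot>\<^bsub>M\<^esub> ?e = \<dots>" .
qed simp_all

text \<open>The hexagon for \<open>1 \<otimes> 1\<close> and naturality with respect to \<open>1 \<otimes> 1 \<rightarrow> 1\<close> express the same composite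
  with two swaps of \<open>x\<close> and with one. Cancelling the common factor \<open>?e\<close> leaves the claim acted on by the
  unit object, which suffices as this action is faithful.\<close>

lemma swap_unit:
  assumes [simp]: "x \<in> Ob B" "m \<in> Ob M"
  shows "MUnit M (x \<star>\<^sub>o\<^bsub>M\<^esub> m) \<cdot>\<^bsub>M\<^esub> swap x (TUnit B) m = Ide B x \<star>\<^sub>a\<^bsub>M\<^esub> MUnit M m"
proof (rule act_unit_faithful)
  let ?I = "TUnit B" and ?i = "Ide B (TUnit B)"
  let ?e = "swap x ?I (?I \<star>\<^sub>o\<^bsub>M\<^esub> m) \<cdot>\<^bsub>M\<^esub> (Ide B x \<star>\<^sub>a\<^bsub>M\<^esub> MAssoc M ?I ?I m)"
  have "(?i \<star>\<^sub>a\<^bsub>M\<^esub> (Ide B x \<star>\<^sub>a\<^bsub>M\<^esub> MUnit M m)) \<cdot>\<^bsub>M\<^esub> ?e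
    = swap x ?I m \<cdot>\<^bsub>M\<^esub> (Ide B x \<star>\<^sub>a\<^bsub>M\<^esub> ((?i \<star>\<^sub>a\<^bsub>M\<^esub> MUnit M m) \<cdot>\<^bsub>M\<^esub> MAssoc M ?I ?I m))"
    using comp_extend[OF swap_nat[of "Ide B x" ?i "MUnit M m" x ?I m], of "Ide B x \<star>\<^sub>a\<^bsub>M\<^esub> MAssoc M ?I ?I m"]
    by (simp add: act.BA_comp)
  also have "\<dots> = (RUnit B ?I \<star>\<^sub>a\<^bsub>M\<^esub> Ide M (x \<star>\<^sub>o\<^bsub>M\<^esub> m)) \<cdot>\<^bsub>M\<^esub> swap x (?I \<otimes>\<^sub>o\<^bsub>B\<^esub> ?I) m"
    using swap_nat[of "Ide B x" "RUnit B ?I" "Ide M m" x ?I m] by (simp add: mtriangle)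
  also have "\<dots> = (?i \<star>\<^sub>a\<^bsub>M\<^esub> MUnit M (x \<star>\<^sub>o\<^bsub>M\<^esub> m)) \<cdot>\<^bsub>M\<^esub> (MAssoc M ?I ?I (x \<star>\<^sub>o\<^bsub>M\<^esub> m) \<cdot>\<^bsub>M\<^esub> swap x (?I \<otimes>\<^sub>o\<^bsub>B\<^esub> ?I) m)"
    by (simp flip: mtriangle)
  also have "\<dots> = (?i \<star>\<^sub>a\<^bsub>M\<^esub> (MUnit M (x \<star>\<^sub>o\<^bsub>M\<^esub> m) \<cdot>\<^bsub>M\<^esub> swap x ?I m)) \<cdot>\<^bsub>M\<^esub> ?e"
    by (simp add: hexagon1_act act.BA_collect)
  finally have "(?i \<star>\<^sub>a\<^bsub>M\<^esub> (Ide B x \<star>\<^sub>a\<^bsub>M\<^esub> MUnit M m)) \<cdot>\<^bsub>M\<^esub> ?e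
    = (?i \<star>\<^sub>a\<^bsub>M\<^esub> (MUnit M (x \<star>\<^sub>o\<^bsub>M\<^esub> m) \<cdot>\<^bsub>M\<^esub> swap x ?I m)) \<cdot>\<^bsub>M\<^esub> ?e" .
  from this[symmetric]
  show "?i \<star>\<^sub>a\<^bsub>M\<^esub> (MUnit M (x \<star>\<^sub>o\<^bsub>M\<^esub> m) \<cdot>\<^bsub>M\<^esub> swap x ?I m) = ?i \<star>\<^sub>a\<^bsub>M\<^esub> (Ide B x \<star>\<^sub>a\<^bsub>M\<^esub> MUnit M m)"
    by (rule cancel_right[rotated]) simp_all
qed simp_all

end

context braided_action
begin

text \<open>Each fact about \<open>swap\<close> gives one about \<open>unswap\<close> with exchanged indices, by applying it to the
  reverse braiding. In this way the second hexagon need not be translated separately: it is the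
  first one of the reverse braiding, inverted.\<close>

lemma reverse_swap: "braided_action.swap M (\<lambda>x y. d y x) x y m = unswap y x m"
  using braided_action.swap_def[OF reverse] by (simp add: unswap_def)

lemma unswap_nat:
  assumes "f \<in> Arr B" "g \<in> Arr B" "h \<in> Arr M" "Cod B f = x" "Cod B g = y" "Cod M h = m"
  shows "unswap x y m \<cdot>\<^bsub>M\<^esub> (g \<star>\<^sub>a\<^bsub>M\<^esub> f \<star>\<^sub>a\<^bsub>M\<^esub> h)
    = (f \<star>\<^sub>a\<^bsub>M\<^esub> g \<star>\<^sub>a\<^bsub>M\<^esub> h) \<cdot>\<^bsub>M\<^esub> unswap (Dom B f) (Dom B g) (Dom M h)"
  using braided_action.swap_nat[OF reverse, of g f h y x m] assms by (simp add: reverse_swap)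

lemma hexagon1_unswap:
  assumes [simp]: "x \<in> Ob B" "y \<in> Ob B" "z \<in> Ob B" "m \<in> Ob M"
  shows "(Ide B x \<star>\<^sub>a\<^bsub>M\<^esub> MAssoc M y z m) \<cdot>\<^bsub>M\<^esub> unswap x (y \<otimes>\<^sub>o\<^bsub>B\<^esub> z) m
    = unswap x y (z \<star>\<^sub>o\<^bsub>M\<^esub> m) \<cdot>\<^bsub>M\<^esub> ((Ide B y \<star>\<^sub>a\<^bsub>M\<^esub> unswap x z m) \<cdot>\<^bsub>M\<^esub> MAssoc M y z (x \<star>\<^sub>o\<^bsub>M\<^esub> m))"
proof -
  have "inv_arrow M ((Ide B y \<star>\<^sub>a\<^bsub>M\<^esub> swap x z m) \<cdot>\<^bsub>M\<^esub> swap x y (z \<star>\<^sub>o\<^bsub>M\<^esub> m)) \<cdot>\<^bsub>M\<^esub> MAssoc M y z (x \<star>\<^sub>o\<^bsub>M\<^esub> m)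
    = (Ide B x \<star>\<^sub>a\<^bsub>M\<^esub> MAssoc M y z m) \<cdot>\<^bsub>M\<^esub> inv_arrow M (swap x (y \<otimes>\<^sub>o\<^bsub>B\<^esub> z) m)"
    by (rule inverse_square) (simp_all add: hexagon1_act)
  then show ?thesis
    by simp
qed

lemma hexagon2_act:
  assumes "x \<in> Ob B" "y \<in> Ob B" "z \<in> Ob B" "m \<in> Ob M"
  shows "(Ide B z \<star>\<^sub>a\<^bsub>M\<^esub> MAssoc M x y m) \<cdot>\<^bsub>M\<^esub> swap (x \<otimes>\<^sub>o\<^bsub>B\<^esub> y) z m
    = swap x z (y \<star>\<^sub>o\<^bsub>M\<^esub> m) \<cdot>\<^bsub>M\<^esub> ((Ide B x \<star>\<^sub>a\<^bsub>M\<^esub> swap y z m) \<cdot>\<^bsub>M\<^esub> MAssoc M x y (z \<star>\<^sub>o\<^bsub>M\<^esub> m))"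
proof -
  have "braided_action.unswap M (\<lambda>x y. c y x) p q n = swap q p n" for p q n
    using braided_action.unswap_def[OF reverse] by (simp add: swap_def)
  then show ?thesis
    using braided_action.hexagon1_unswap[OF reverse, of z x y m] assms by simp
qed

lemma hexagon2_unswap:
  assumes [simp]: "x \<in> Ob B" "y \<in> Ob B" "z \<in> Ob B" "m \<in> Ob M"
  shows "MAssoc M x y (z \<star>\<^sub>o\<^bsub>M\<^esub> m) \<cdot>\<^bsub>M\<^esub> unswap (x \<otimes>\<^sub>o\<^bsub>B\<^esub> y) z m
    = (Ide B x \<star>\<^sub>a\<^bsub>M\<^esub> unswap y z m) \<cdot>\<^bsub>M\<^esub> (unswap x z (y \<star>\<^sub>o\<^bsub>M\<^esub> m) \<cdot>\<^bsub>M\<^esub> (Ide B z \<star>\<^sub>a\<^bsub>M\<^esub> MAssoc M x y m))"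
  using braided_action.hexagon1_act[OF reverse, of z x y m] by (simp add: reverse_swap)

lemma swap_unit_left:
  assumes [simp]: "x \<in> Ob B" "m \<in> Ob M"
  shows "(Ide B x \<star>\<^sub>a\<^bsub>M\<^esub> MUnit M m) \<cdot>\<^bsub>M\<^esub> swap (TUnit B) x m = MUnit M (x \<star>\<^sub>o\<^bsub>M\<^esub> m)"
proof -
  have "MUnit M (x \<star>\<^sub>o\<^bsub>M\<^esub> m) \<cdot>\<^bsub>M\<^esub> unswap (TUnit B) x m = Ide B x \<star>\<^sub>a\<^bsub>M\<^esub> MUnit M m"
    using braided_action.swap_unit[OF reverse assms] by (simp add: reverse_swap)
  then show ?thesis
    using move_inv_right[of "unswap (TUnit B) x m" "MUnit M (x \<star>\<^sub>o\<^bsub>M\<^esub> m)"] by simp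
qed

text \<open>Both sides pass \<open>z\<close> over the product of \<open>x\<close> and \<open>y\<close> by the second hexagon, and naturality with respect to
  the braiding of \<open>x\<close> and \<open>y\<close> connects them.\<close>

lemma yang_baxter:
  assumes [simp]: "x \<in> Ob B" "y \<in> Ob B" "z \<in> Ob B" "m \<in> Ob M"
  shows "swap y z (x \<star>\<^sub>o\<^bsub>M\<^esub> m) \<cdot>\<^bsub>M\<^esub> ((Ide B y \<star>\<^sub>a\<^bsub>M\<^esub> swap x z m) \<cdot>\<^bsub>M\<^esub> swap x y (z \<star>\<^sub>o\<^bsub>M\<^esub> m))
    = (Ide B z \<star>\<^sub>a\<^bsub>M\<^esub> swap x y m) \<cdot>\<^bsub>M\<^esub> (swap x z (y \<star>\<^sub>o\<^bsub>M\<^esub> m) \<cdot>\<^bsub>M\<^esub> (Ide B x \<star>\<^sub>a\<^bsub>M\<^esub> swap y z m))"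
proof (rule cancel_right)
  let ?a = "MAssoc M x y (z \<star>\<^sub>o\<^bsub>M\<^esub> m)"
  have "(swap y z (x \<star>\<^sub>o\<^bsub>M\<^esub> m) \<cdot>\<^bsub>M\<^esub> ((Ide B y \<star>\<^sub>a\<^bsub>M\<^esub> swap x z m) \<cdot>\<^bsub>M\<^esub> swap x y (z \<star>\<^sub>o\<^bsub>M\<^esub> m))) \<cdot>\<^bsub>M\<^esub> ?a
    = (swap y z (x \<star>\<^sub>o\<^bsub>M\<^esub> m) \<cdot>\<^bsub>M\<^esub> ((Ide B y \<star>\<^sub>a\<^bsub>M\<^esub> swap x z m) \<cdot>\<^bsub>M\<^esub> MAssoc M y x (z \<star>\<^sub>o\<^bsub>M\<^esub> m)))
        \<cdot>\<^bsub>M\<^esub> (c x y \<star>\<^sub>a\<^bsub>M\<^esub> Ide M (z \<star>\<^sub>o\<^bsub>M\<^esub> m))"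
    by (simp add: swap_massoc)
  also have "\<dots> = (Ide B z \<star>\<^sub>a\<^bsub>M\<^esub> MAssoc M y x m)
        \<cdot>\<^bsub>M\<^esub> (swap (y \<otimes>\<^sub>o\<^bsub>B\<^esub> x) z m \<cdot>\<^bsub>M\<^esub> (c x y \<star>\<^sub>a\<^bsub>M\<^esub> Ide M (z \<star>\<^sub>o\<^bsub>M\<^esub> m)))"
    by (simp add: hexagon2_act[symmetric] del: assoc_arr) simp
  also have "\<dots> = (Ide B z \<star>\<^sub>a\<^bsub>M\<^esub> (MAssoc M y x m \<cdot>\<^bsub>M\<^esub> (c x y \<star>\<^sub>a\<^bsub>M\<^esub> Ide M m))) \<cdot>\<^bsub>M\<^esub> swap (x \<otimes>\<^sub>o\<^bsub>B\<^esub> y) z m"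
    using swap_nat[of "c x y" "Ide B z" "Ide M m" "y \<otimes>\<^sub>o\<^bsub>B\<^esub> x" z m] by (simp add: act.BA_collect)
  also have "\<dots> = (Ide B z \<star>\<^sub>a\<^bsub>M\<^esub> swap x y m) \<cdot>\<^bsub>M\<^esub> ((Ide B z \<star>\<^sub>a\<^bsub>M\<^esub> MAssoc M x y m) \<cdot>\<^bsub>M\<^esub> swap (x \<otimes>\<^sub>o\<^bsub>B\<^esub> y) z m)"
    by (simp add: act.BA_collect flip: swap_massoc)
  also have "\<dots> = ((Ide B z \<star>\<^sub>a\<^bsub>M\<^esub> swap x y m) \<cdot>\<^bsub>M\<^esub> (swap x z (y \<star>\<^sub>o\<^bsub>M\<^esub> m) \<cdot>\<^bsub>M\<^esub> (Ide B x \<star>\<^sub>a\<^bsub>M\<^esub> swap y z m))) \<cdot>\<^bsub>M\<^esub> ?a"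
    by (simp add: hexagon2_act)
  finally show "(swap y z (x \<star>\<^sub>o\<^bsub>M\<^esub> m) \<cdot>\<^bsub>M\<^esub> ((Ide B y \<star>\<^sub>a\<^bsub>M\<^esub> swap x z m) \<cdot>\<^bsub>M\<^esub> swap x y (z \<star>\<^sub>o\<^bsub>M\<^esub> m))) \<cdot>\<^bsub>M\<^esub> ?a = \<dots>" .
qed simp_all

end


section \<open>The alpha-inductions are tensor functors\<close>

text \<open>The alpha-induction of an arbitrary braiding. Inserting a braiding and its inverse, in one order
  or the other, gives \<open>\<alpha>\<^sup>+\<close> and \<open>\<alpha>\<^sup>-\<close> by definition, so that nothing needs to be transported along
  an equation that holds on objects of \<open>B\<close> only.\<close>

definition alpha_ob ::
    "('o, 'a, 'k, 'y) mon_category_scheme \<Rightarrow> ('m, 'n, 'k, 'o, 'a) mod_category \<Rightarrow>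
     ('o \<Rightarrow> 'o \<Rightarrow> 'a) \<Rightarrow> 'o \<Rightarrow> ('m, 'n, 'm, 'n, 'o) mod_ftor" where
  "alpha_ob B M d x =
     \<lparr>FO = (\<lambda>m \<in> Ob M. x \<star>\<^sub>o\<^bsub>M\<^esub> m), FA = (\<lambda>f \<in> Arr M. Ide B x \<star>\<^sub>a\<^bsub>M\<^esub> f),
      FS = (\<lambda>y \<in> Ob B. \<lambda>m \<in> Ob M.
        MAssoc M x y m \<cdot>\<^bsub>M\<^esub> (d x y \<star>\<^sub>a\<^bsub>M\<^esub> Ide M m) \<cdot>\<^bsub>M\<^esub> inv_arrow M (MAssoc M y x m))\<rparr>"

definition alpha ::
    "('o, 'a, 'k, 'y) mon_category_scheme \<Rightarrow> ('m, 'n, 'k, 'o, 'a) mod_category \<Rightarrow>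
     ('o \<Rightarrow> 'o \<Rightarrow> 'a) \<Rightarrow> ('o \<Rightarrow> 'o \<Rightarrow> 'a) \<Rightarrow>
     ('o, 'a, ('m, 'n, 'm, 'n, 'o) mod_ftor, (('m, 'n, 'm, 'n, 'o) mod_ftor, 'm, 'n) transf) tensor_ftor"
  where
  "alpha B M c d =
     \<lparr>FO = alpha_ob B M d,
      FA = (\<lambda>f. \<lparr>TDom = alpha_ob B M d (Dom B f), TCod = alpha_ob B M d (Cod B f),
                 Cmp = (\<lambda>m \<in> Ob M. f \<star>\<^sub>a\<^bsub>M\<^esub> Ide M m)\<rparr>),
      FJ = (\<lambda>y x. \<lparr>TDom = comp_ftor B M M (alpha_ob B M d y) (alpha_ob B M d x),
                   TCod = alpha_ob B M d (x \<otimes>\<^sub>o\<^bsub>B\<^esub> y),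
                   Cmp = (\<lambda>m \<in> Ob M.
                     (c y x \<star>\<^sub>a\<^bsub>M\<^esub> Ide M m) \<cdot>\<^bsub>M\<^esub> inv_arrow M (MAssoc M y x m))\<rparr>),
      FU = \<lparr>TDom = id_ftor B M, TCod = alpha_ob B M d (TUnit B),
            Cmp = (\<lambda>m \<in> Ob M. inv_arrow M (MUnit M m))\<rparr>\<rparr>"

lemma alpha_plus_eq:
  "alpha_plus_ob B M = alpha_ob B M (inv_braid B)"
  "alpha_plus B M = alpha B M (Braid B) (inv_braid B)"
  by (simp_all add: fun_eq_iff alpha_plus_def alpha_def alpha_plus_ob_def alpha_ob_def)

lemma alpha_minus_eq:
  "alpha_minus_ob B M = alpha_ob B M (\<lambda>x y. Braid B y x)"
  "alpha_minus B M = alpha B M (\<lambda>x y. inv_braid B y x) (\<lambda>x y. Braid B y x)"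
  by (simp_all add: fun_eq_iff alpha_minus_def alpha_def alpha_minus_ob_def alpha_ob_def)

context braided_action
begin

text \<open>The tensor structure of the alpha-induction, written as a swap; see \<open>merge_eq\<close>.\<close>

definition merge :: "'o \<Rightarrow> 'o \<Rightarrow> 'm \<Rightarrow> 'n" where
  "merge y x m = inv_arrow M (MAssoc M x y m) \<cdot>\<^bsub>M\<^esub> swap y x m"

lemma merge_arr [simp]:
  assumes "x \<in> Ob B" "y \<in> Ob B" "m \<in> Ob M"
  shows "merge y x m \<in> Arr M" "Dom M (merge y x m) = y \<star>\<^sub>o\<^bsub>M\<^esub> x \<star>\<^sub>o\<^bsub>M\<^esub> m"
    "Cod M (merge y x m) = (x \<otimes>\<^sub>o\<^bsub>B\<^esub> y) \<star>\<^sub>o\<^bsub>M\<^esub> m" "iso_arrow M (merge y x m)"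
  using assms by (simp_all add: merge_def)

lemma merge_eq:
  assumes "x \<in> Ob B" "y \<in> Ob B" "m \<in> Ob M"
  shows "(c y x \<star>\<^sub>a\<^bsub>M\<^esub> Ide M m) \<cdot>\<^bsub>M\<^esub> inv_arrow M (MAssoc M y x m) = merge y x m"
  using assms by (simp add: merge_def swap_def)

lemma merge_nat:
  assumes "f \<in> Arr B" "g \<in> Arr B" "h \<in> Arr M" "Cod B f = x" "Cod B g = y" "Cod M h = m"
  shows "merge y x m \<cdot>\<^bsub>M\<^esub> (g \<star>\<^sub>a\<^bsub>M\<^esub> f \<star>\<^sub>a\<^bsub>M\<^esub> h)
    = ((f \<otimes>\<^sub>a\<^bsub>B\<^esub> g) \<star>\<^sub>a\<^bsub>M\<^esub> h) \<cdot>\<^bsub>M\<^esub> merge (Dom B g) (Dom B f) (Dom M h)"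
proof -
  have [simp]: "x \<in> Ob B" "y \<in> Ob B" "m \<in> Ob M"
    using assms by auto
  have "merge y x m \<cdot>\<^bsub>M\<^esub> (g \<star>\<^sub>a\<^bsub>M\<^esub> f \<star>\<^sub>a\<^bsub>M\<^esub> h)
    = (inv_arrow M (MAssoc M x y m) \<cdot>\<^bsub>M\<^esub> (f \<star>\<^sub>a\<^bsub>M\<^esub> g \<star>\<^sub>a\<^bsub>M\<^esub> h)) \<cdot>\<^bsub>M\<^esub> swap (Dom B g) (Dom B f) (Dom M h)"
    using assms by (simp add: merge_def swap_nat)
  also have "\<dots> = ((f \<otimes>\<^sub>a\<^bsub>B\<^esub> g) \<star>\<^sub>a\<^bsub>M\<^esub> h) \<cdot>\<^bsub>M\<^esub> merge (Dom B g) (Dom B f) (Dom M h)"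
    using assms by (simp add: merge_def inv_massoc_nat del: assoc_arr) simp
  finally show ?thesis .
qed

text \<open>This says that the tensor structure consists of module transformations. The second hexagon splits
  the swap of \<open>x \<otimes> y\<close> with \<open>z\<close>, and moving \<open>z\<close> past \<open>y\<close> and \<open>x\<close> before or after these are exchanged is the same
  by the Yang-Baxter equation.\<close>

lemma merge_unswap:
  assumes [simp]: "x \<in> Ob B" "y \<in> Ob B" "z \<in> Ob B" "m \<in> Ob M"
  shows "merge y x (z \<star>\<^sub>o\<^bsub>M\<^esub> m) \<cdot>\<^bsub>M\<^esub> ((Ide B y \<star>\<^sub>a\<^bsub>M\<^esub> unswap x z m) \<cdot>\<^bsub>M\<^esub> unswap y z (x \<star>\<^sub>o\<^bsub>M\<^esub> m))
    = unswap (x \<otimes>\<^sub>o\<^bsub>B\<^esub> y) z m \<cdot>\<^bsub>M\<^esub> (Ide B z \<star>\<^sub>a\<^bsub>M\<^esub> merge y x m)"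
proof -
  have "inv_arrow M (swap x z (y \<star>\<^sub>o\<^bsub>M\<^esub> m) \<cdot>\<^bsub>M\<^esub> (Ide B x \<star>\<^sub>a\<^bsub>M\<^esub> swap y z m)) \<cdot>\<^bsub>M\<^esub> (Ide B z \<star>\<^sub>a\<^bsub>M\<^esub> swap y x m)
    = swap y x (z \<star>\<^sub>o\<^bsub>M\<^esub> m) \<cdot>\<^bsub>M\<^esub> inv_arrow M (swap y z (x \<star>\<^sub>o\<^bsub>M\<^esub> m) \<cdot>\<^bsub>M\<^esub> (Ide B y \<star>\<^sub>a\<^bsub>M\<^esub> swap x z m))"
    by (rule inverse_square) (simp_all add: yang_baxter)
  then have yb: "swap y x (z \<star>\<^sub>o\<^bsub>M\<^esub> m) \<cdot>\<^bsub>M\<^esub> ((Ide B y \<star>\<^sub>a\<^bsub>M\<^esub> unswap x z m) \<cdot>\<^bsub>M\<^esub> unswap y z (x \<star>\<^sub>o\<^bsub>M\<^esub> m))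
    = (Ide B x \<star>\<^sub>a\<^bsub>M\<^esub> unswap y z m) \<cdot>\<^bsub>M\<^esub> (unswap x z (y \<star>\<^sub>o\<^bsub>M\<^esub> m) \<cdot>\<^bsub>M\<^esub> (Ide B z \<star>\<^sub>a\<^bsub>M\<^esub> swap y x m))"
    by simp
  have "MAssoc M x y (z \<star>\<^sub>o\<^bsub>M\<^esub> m) \<cdot>\<^bsub>M\<^esub> (unswap (x \<otimes>\<^sub>o\<^bsub>B\<^esub> y) z m \<cdot>\<^bsub>M\<^esub> (Ide B z \<star>\<^sub>a\<^bsub>M\<^esub> merge y x m))
    = (MAssoc M x y (z \<star>\<^sub>o\<^bsub>M\<^esub> m) \<cdot>\<^bsub>M\<^esub> unswap (x \<otimes>\<^sub>o\<^bsub>B\<^esub> y) z m) \<cdot>\<^bsub>M\<^esub> (Ide B z \<star>\<^sub>a\<^bsub>M\<^esub> merge y x m)"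
    by simp
  also have "\<dots> = (Ide B x \<star>\<^sub>a\<^bsub>M\<^esub> unswap y z m) \<cdot>\<^bsub>M\<^esub> (unswap x z (y \<star>\<^sub>o\<^bsub>M\<^esub> m) \<cdot>\<^bsub>M\<^esub> (Ide B z \<star>\<^sub>a\<^bsub>M\<^esub> swap y x m))"
    by (simp add: hexagon2_unswap del: assoc_arr) (simp add: act.BA_collect merge_def)
  finally have "unswap (x \<otimes>\<^sub>o\<^bsub>B\<^esub> y) z m \<cdot>\<^bsub>M\<^esub> (Ide B z \<star>\<^sub>a\<^bsub>M\<^esub> merge y x m)
    = inv_arrow M (MAssoc M x y (z \<star>\<^sub>o\<^bsub>M\<^esub> m)) \<cdot>\<^bsub>M\<^esub> ((Ide B x \<star>\<^sub>a\<^bsub>M\<^esub> unswap y z m)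
        \<cdot>\<^bsub>M\<^esub> (unswap x z (y \<star>\<^sub>o\<^bsub>M\<^esub> m) \<cdot>\<^bsub>M\<^esub> (Ide B z \<star>\<^sub>a\<^bsub>M\<^esub> swap y x m)))"
    by (rule move_inv_left[rotated]) simp_all
  then show ?thesis
    by (simp add: merge_def flip: yb)
qed

text \<open>Coherence of the tensor structure: on the left the swap of \<open>y \<otimes> x\<close> with \<open>z\<close> splits by the second
  hexagon, on the right that of \<open>x\<close> with \<open>z \<otimes> y\<close> by the first one. The three swaps on either side are the two
  sides of the Yang-Baxter equation, and the associators that remain form a pentagon.\<close>

lemma merge_assoc:
  assumes [simp]: "x \<in> Ob B" "y \<in> Ob B" "z \<in> Ob B" "m \<in> Ob M"
  shows "(inv_arrow B (Assoc B z y x) \<star>\<^sub>a\<^bsub>M\<^esub> Ide M m) \<cdot>\<^bsub>M\<^esub> (merge (y \<otimes>\<^sub>o\<^bsub>B\<^esub> x) z m \<cdot>\<^bsub>M\<^esub> merge x y (z \<star>\<^sub>o\<^bsub>M\<^esub> m))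
    = merge x (z \<otimes>\<^sub>o\<^bsub>B\<^esub> y) m \<cdot>\<^bsub>M\<^esub> (Ide B x \<star>\<^sub>a\<^bsub>M\<^esub> merge y z m)"
proof -
  let ?A = "inv_arrow B (Assoc B z y x) \<star>\<^sub>a\<^bsub>M\<^esub> Ide M m"
  have pent: "?A \<cdot>\<^bsub>M\<^esub> (inv_arrow M (MAssoc M z (y \<otimes>\<^sub>o\<^bsub>B\<^esub> x) m) \<cdot>\<^bsub>M\<^esub> (Ide B z \<star>\<^sub>a\<^bsub>M\<^esub> inv_arrow M (MAssoc M y x m)))
    = inv_arrow M (MAssoc M (z \<otimes>\<^sub>o\<^bsub>B\<^esub> y) x m) \<cdot>\<^bsub>M\<^esub> inv_arrow M (MAssoc M z y (x \<star>\<^sub>o\<^bsub>M\<^esub> m))"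
    using arg_cong[OF mpentagon[of z y x m], of "inv_arrow M"] by simp
  have h1: "swap x (z \<otimes>\<^sub>o\<^bsub>B\<^esub> y) m \<cdot>\<^bsub>M\<^esub> (Ide B x \<star>\<^sub>a\<^bsub>M\<^esub> inv_arrow M (MAssoc M z y m))
    = inv_arrow M (MAssoc M z y (x \<star>\<^sub>o\<^bsub>M\<^esub> m)) \<cdot>\<^bsub>M\<^esub> ((Ide B z \<star>\<^sub>a\<^bsub>M\<^esub> swap x y m) \<cdot>\<^bsub>M\<^esub> swap x z (y \<star>\<^sub>o\<^bsub>M\<^esub> m))"
    using inverse_square[of "MAssoc M z y (x \<star>\<^sub>o\<^bsub>M\<^esub> m)" "swap x (z \<otimes>\<^sub>o\<^bsub>B\<^esub> y) m"
        "(Ide B z \<star>\<^sub>a\<^bsub>M\<^esub> swap x y m) \<cdot>\<^bsub>M\<^esub> swap x z (y \<star>\<^sub>o\<^bsub>M\<^esub> m)" "Ide B x \<star>\<^sub>a\<^bsub>M\<^esub> MAssoc M z y m"]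
    by (simp add: hexagon1_act)
  have h2: "swap (y \<otimes>\<^sub>o\<^bsub>B\<^esub> x) z m \<cdot>\<^bsub>M\<^esub> inv_arrow M (MAssoc M y x (z \<star>\<^sub>o\<^bsub>M\<^esub> m))
    = (Ide B z \<star>\<^sub>a\<^bsub>M\<^esub> inv_arrow M (MAssoc M y x m)) \<cdot>\<^bsub>M\<^esub> (swap y z (x \<star>\<^sub>o\<^bsub>M\<^esub> m) \<cdot>\<^bsub>M\<^esub> (Ide B y \<star>\<^sub>a\<^bsub>M\<^esub> swap x z m))"
    using inverse_square[of "Ide B z \<star>\<^sub>a\<^bsub>M\<^esub> MAssoc M y x m" "swap (y \<otimes>\<^sub>o\<^bsub>B\<^esub> x) z m"
        "swap y z (x \<star>\<^sub>o\<^bsub>M\<^esub> m) \<cdot>\<^bsub>M\<^esub> (Ide B y \<star>\<^sub>a\<^bsub>M\<^esub> swap x z m)" "MAssoc M y x (z \<star>\<^sub>o\<^bsub>M\<^esub> m)"]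
    by (simp add: hexagon2_act)
  have "?A \<cdot>\<^bsub>M\<^esub> (merge (y \<otimes>\<^sub>o\<^bsub>B\<^esub> x) z m \<cdot>\<^bsub>M\<^esub> merge x y (z \<star>\<^sub>o\<^bsub>M\<^esub> m))
    = ?A \<cdot>\<^bsub>M\<^esub> (inv_arrow M (MAssoc M z (y \<otimes>\<^sub>o\<^bsub>B\<^esub> x) m)
        \<cdot>\<^bsub>M\<^esub> ((swap (y \<otimes>\<^sub>o\<^bsub>B\<^esub> x) z m \<cdot>\<^bsub>M\<^esub> inv_arrow M (MAssoc M y x (z \<star>\<^sub>o\<^bsub>M\<^esub> m))) \<cdot>\<^bsub>M\<^esub> swap x y (z \<star>\<^sub>o\<^bsub>M\<^esub> m)))"
    by (simp add: merge_def)
  also have "\<dots> = (?A \<cdot>\<^bsub>M\<^esub> (inv_arrow M (MAssoc M z (y \<otimes>\<^sub>o\<^bsub>B\<^esub> x) m) \<cdot>\<^bsub>M\<^esub> (Ide B z \<star>\<^sub>a\<^bsub>M\<^esub> inv_arrow M (MAssoc M y x m))))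
        \<cdot>\<^bsub>M\<^esub> (swap y z (x \<star>\<^sub>o\<^bsub>M\<^esub> m) \<cdot>\<^bsub>M\<^esub> ((Ide B y \<star>\<^sub>a\<^bsub>M\<^esub> swap x z m) \<cdot>\<^bsub>M\<^esub> swap x y (z \<star>\<^sub>o\<^bsub>M\<^esub> m)))"
    unfolding h2 by simp
  also have "\<dots> = inv_arrow M (MAssoc M (z \<otimes>\<^sub>o\<^bsub>B\<^esub> y) x m) \<cdot>\<^bsub>M\<^esub> ((inv_arrow M (MAssoc M z y (x \<star>\<^sub>o\<^bsub>M\<^esub> m))
        \<cdot>\<^bsub>M\<^esub> ((Ide B z \<star>\<^sub>a\<^bsub>M\<^esub> swap x y m) \<cdot>\<^bsub>M\<^esub> swap x z (y \<star>\<^sub>o\<^bsub>M\<^esub> m))) \<cdot>\<^bsub>M\<^esub> (Ide B x \<star>\<^sub>a\<^bsub>M\<^esub> swap y z m))"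
    unfolding pent by (simp add: yang_baxter)
  also have "\<dots> = merge x (z \<otimes>\<^sub>o\<^bsub>B\<^esub> y) m \<cdot>\<^bsub>M\<^esub> (Ide B x \<star>\<^sub>a\<^bsub>M\<^esub> merge y z m)"
    unfolding h1[symmetric] by (simp add: merge_def act.BA_collect)
  finally show ?thesis .
qed

lemma merge_unit_left:
  assumes [simp]: "x \<in> Ob B" "m \<in> Ob M"
  shows "(RUnit B x \<star>\<^sub>a\<^bsub>M\<^esub> Ide M m) \<cdot>\<^bsub>M\<^esub> (merge (TUnit B) x m \<cdot>\<^bsub>M\<^esub> inv_arrow M (MUnit M (x \<star>\<^sub>o\<^bsub>M\<^esub> m)))
    = Ide M (x \<star>\<^sub>o\<^bsub>M\<^esub> m)"
proof -
  have "(RUnit B x \<star>\<^sub>a\<^bsub>M\<^esub> Ide M m) \<cdot>\<^bsub>M\<^esub> (merge (TUnit B) x m \<cdot>\<^bsub>M\<^esub> inv_arrow M (MUnit M (x \<star>\<^sub>o\<^bsub>M\<^esub> m)))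
    = ((Ide B x \<star>\<^sub>a\<^bsub>M\<^esub> MUnit M m) \<cdot>\<^bsub>M\<^esub> swap (TUnit B) x m) \<cdot>\<^bsub>M\<^esub> inv_arrow M (MUnit M (x \<star>\<^sub>o\<^bsub>M\<^esub> m))"
    by (simp add: merge_def flip: mtriangle)
  also have "\<dots> = Ide M (x \<star>\<^sub>o\<^bsub>M\<^esub> m)"
    by (simp add: swap_unit_left del: assoc_arr)
  finally show ?thesis .
qed

lemma merge_unit_right:
  assumes [simp]: "x \<in> Ob B" "m \<in> Ob M"
  shows "(LUnit B x \<star>\<^sub>a\<^bsub>M\<^esub> Ide M m) \<cdot>\<^bsub>M\<^esub> (merge x (TUnit B) m \<cdot>\<^bsub>M\<^esub> (Ide B x \<star>\<^sub>a\<^bsub>M\<^esub> inv_arrow M (MUnit M m)))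
    = Ide M (x \<star>\<^sub>o\<^bsub>M\<^esub> m)"
proof -
  have "(LUnit B x \<star>\<^sub>a\<^bsub>M\<^esub> Ide M m) \<cdot>\<^bsub>M\<^esub> (merge x (TUnit B) m \<cdot>\<^bsub>M\<^esub> (Ide B x \<star>\<^sub>a\<^bsub>M\<^esub> inv_arrow M (MUnit M m)))
    = (MUnit M (x \<star>\<^sub>o\<^bsub>M\<^esub> m) \<cdot>\<^bsub>M\<^esub> swap x (TUnit B) m) \<cdot>\<^bsub>M\<^esub> (Ide B x \<star>\<^sub>a\<^bsub>M\<^esub> inv_arrow M (MUnit M m))"
    by (simp add: merge_def flip: munit_massoc)
  also have "\<dots> = Ide M (x \<star>\<^sub>o\<^bsub>M\<^esub> m)"
    by (simp add: swap_unit act.BA_comp del: assoc_arr)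
  finally show ?thesis .
qed

lemma inv_munit_act:
  assumes [simp]: "x \<in> Ob B" "m \<in> Ob M"
  shows "inv_arrow M (MUnit M (x \<star>\<^sub>o\<^bsub>M\<^esub> m)) = unswap (TUnit B) x m \<cdot>\<^bsub>M\<^esub> (Ide B x \<star>\<^sub>a\<^bsub>M\<^esub> inv_arrow M (MUnit M m))"
  using arg_cong[OF swap_unit_left[OF assms], of "inv_arrow M"] by simp

lemma inv_munit_nat:
  assumes "f \<in> Arr M"
  shows "inv_arrow M (MUnit M (Cod M f)) \<cdot>\<^bsub>M\<^esub> f
    = (Ide B (TUnit B) \<star>\<^sub>a\<^bsub>M\<^esub> f) \<cdot>\<^bsub>M\<^esub> inv_arrow M (MUnit M (Dom M f))"
  using assms by (intro inverse_square munit_nat) auto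

lemma alpha_ob_simps [simp]:
  "FO (alpha_ob B M d x) = (\<lambda>m \<in> Ob M. x \<star>\<^sub>o\<^bsub>M\<^esub> m)"
  "FA (alpha_ob B M d x) = (\<lambda>f \<in> Arr M. Ide B x \<star>\<^sub>a\<^bsub>M\<^esub> f)"
  "FS (alpha_ob B M d x) = (\<lambda>y \<in> Ob B. \<lambda>m \<in> Ob M. unswap x y m)"
  by (simp_all add: alpha_ob_def unswap_def)

lemma alpha_ob_mfun:
  assumes [simp]: "x \<in> Ob B"
  shows "module_functor K B M M (alpha_ob B M d x)"
proof unfold_locales
  fix f y y' h m m' assume "f \<in> Hom B y y'" "h \<in> Hom M m m'"
  then show "FS (alpha_ob B M d x) y' m' \<cdot>\<^bsub>M\<^esub> (f \<star>\<^sub>a\<^bsub>M\<^esub> FA (alpha_ob B M d x) h)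
    = FA (alpha_ob B M d x) (f \<star>\<^sub>a\<^bsub>M\<^esub> h) \<cdot>\<^bsub>M\<^esub> FS (alpha_ob B M d x) y m"
    by (auto simp: Hom_iff unswap_nat)
next
  fix y z m assume [simp]: "y \<in> Ob B" "z \<in> Ob B" "m \<in> Ob M"
  show "FA (alpha_ob B M d x) (MAssoc M y z m) \<cdot>\<^bsub>M\<^esub> FS (alpha_ob B M d x) (y \<otimes>\<^sub>o\<^bsub>B\<^esub> z) m
    = FS (alpha_ob B M d x) y (z \<star>\<^sub>o\<^bsub>M\<^esub> m) \<cdot>\<^bsub>M\<^esub> (Ide B y \<star>\<^sub>a\<^bsub>M\<^esub> FS (alpha_ob B M d x) z m)
        \<cdot>\<^bsub>M\<^esub> MAssoc M y z (FO (alpha_ob B M d x) m)"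
    by (simp add: hexagon1_unswap)
next
  fix m assume [simp]: "m \<in> Ob M"
  have "(Ide B x \<star>\<^sub>a\<^bsub>M\<^esub> MUnit M m) \<cdot>\<^bsub>M\<^esub> unswap x (TUnit B) m = MUnit M (x \<star>\<^sub>o\<^bsub>M\<^esub> m)"
    using swap_unit[of x m, symmetric] by simp
  then show "FA (alpha_ob B M d x) (MUnit M m) \<cdot>\<^bsub>M\<^esub> FS (alpha_ob B M d x) (TUnit B) m
    = MUnit M (FO (alpha_ob B M d x) m)"
    by simp
qed (auto simp: Hom_iff act.BA_comp)

lemma alpha_ob_right_exact:
  assumes "x \<in> Ob B"
  shows "right_exact M M (alpha_ob B M d x)"
proof (rule right_exactI)
  fix f q assume *: "is_cokernel M f q"
  then have "f \<in> Arr M" "q \<in> Arr M"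
    by (auto simp: is_cokernel_def)
  moreover have "is_cokernel M (Ide B x \<star>\<^sub>a\<^bsub>M\<^esub> f) (Ide B x \<star>\<^sub>a\<^bsub>M\<^esub> q)"
    using act_exact_right[OF assms] * by (simp add: exact_def right_exact_def)
  ultimately show "is_cokernel M (FA (alpha_ob B M d x) f) (FA (alpha_ob B M d x) q)"
    by simp
qed

text \<open>Each axiom, evaluated at an object \<open>m\<close>, is one of the preceding equations about \<open>merge\<close> and \<open>unswap\<close>.\<close>

lemma alpha_tensor_functor:
  "tensor_functor K (op_tensor B) (End_mod K B M) (alpha B M c d)"
proof -
  interpret E: linear_monoidal_category K "End_mod K B M"
    by (rule End_mod_monoidal)
  interpret MM: module_category_pair K B M M ..
  interpret MMM: module_category_triple K B M M M ..
  let ?\<alpha> = "alpha_ob B M d" and ?F = "alpha B M c d" and ?E = "End_mod K B M"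
  have [simp]: "Hom ?E F G = Hom (Fun_mod K B M M) F G" "iso_arrow ?E t = iso_arrow (Fun_mod K B M M) t"
    for F G t
    by (simp_all add: Hom_def iso_arrow_def inverse_arrows_def End_mod_simps)
  note [simp] = alpha_ob_mfun alpha_ob_right_exact id_ftor_mfun id_ftor_right_exact
    MMM.comp_mfun MMM.comp_right_exact base.BO_ob
  have F: "FO ?F = ?\<alpha>"
    "FA ?F f = \<lparr>TDom = ?\<alpha> (Dom B f), TCod = ?\<alpha> (Cod B f), Cmp = (\<lambda>m \<in> Ob M. f \<star>\<^sub>a\<^bsub>M\<^esub> Ide M m)\<rparr>"
    "FU ?F = \<lparr>TDom = id_ftor B M, TCod = ?\<alpha> (TUnit B), Cmp = (\<lambda>m \<in> Ob M. inv_arrow M (MUnit M m))\<rparr>"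
    for f
    by (simp_all add: alpha_def)
  have FJ: "FJ ?F y x = \<lparr>TDom = comp_ftor B M M (?\<alpha> y) (?\<alpha> x), TCod = ?\<alpha> (x \<otimes>\<^sub>o\<^bsub>B\<^esub> y),
      Cmp = (\<lambda>m \<in> Ob M. merge y x m)\<rparr>" if "x \<in> Ob B" "y \<in> Ob B" for x y
    using that by (simp add: alpha_def merge_eq cong: restrict_cong)
  \<comment> \<open>Naturality is also supplied for identities on \<open>m\<close>, in the form in which the identity of \<open>y \<star> m\<close>
    is no longer written as a product of identities.\<close>
  have cell: "MM.mtrans (FA ?F f)" if "f \<in> Arr B" for f
    unfolding F using that
    by (intro MM.transI)
      (auto simp: Hom_iff act.BA_comp unswap_nat unswap_nat[of f _ "Ide M m" for m, simplified])
  have J: "MM.mtrans (FJ ?F y x)" if "x \<in> Ob B" "y \<in> Ob B" for x y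
    unfolding FJ[OF that] using that
    by (intro MM.transI)
      (auto simp: Hom_iff merge_unswap merge_nat[of "Ide B x" "Ide B y", simplified])
  have U: "MM.mtrans (FU ?F)"
    unfolding F
    by (intro MM.transI) (auto simp: Hom_iff inv_munit_act inv_munit_nat)
  note Esimps = End_mod_simps hcomp_transf_def F FJ
  show ?thesis
  proof (intro tensor_functor.intro linear_functor.intro cat_functor.intro tensor_functor_axioms.intro
      linear_functor_axioms.intro cat_functor_axioms.intro base.op_tensor_monoidal
      E.linear_monoidal_category_axioms base.op_tensor_linear End_mod_linear E.category_axioms
      linear_category.axioms(2)[OF base.op_tensor_linear], unfold op_tensor_simps op_tensor_Hom)
    fix x assume "x \<in> Ob B"
    then show "FO ?F x \<in> Ob ?E"
      by (simp add: Esimps)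
    show "FA ?F (Ide B x) = Ide ?E (FO ?F x)"
      using \<open>x \<in> Ob B\<close> by (simp add: Esimps cong: restrict_cong)
  next
    fix f x y assume "f \<in> Hom B x y"
    then show "FA ?F f \<in> Hom ?E (FO ?F x) (FO ?F y)"
      using cell[of f] by (auto simp: Hom_iff F)
  next
    fix f x y g z assume "f \<in> Hom B x y" "g \<in> Hom B y z"
    then show "FA ?F (g \<cdot>\<^bsub>B\<^esub> f) = FA ?F g \<cdot>\<^bsub>?E\<^esub> FA ?F f"
      by (auto simp: Hom_iff Esimps act.BA_comp cong: restrict_cong)
  next
    fix f x y g assume "f \<in> Hom B x y" "g \<in> Hom B x y"
    then show "FA ?F (Plus B f g) = Plus ?E (FA ?F f) (FA ?F g)"
      by (auto simp: Hom_iff Esimps cong: restrict_cong)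
  next
    fix a f x y assume "a \<in> carrier K" "f \<in> Hom B x y"
    then show "FA ?F (Scale B a f) = Scale ?E a (FA ?F f)"
      by (auto simp: Hom_iff Esimps cong: restrict_cong)
  next
    fix x y assume xy: "x \<in> Ob B" "y \<in> Ob B"
    then show "FJ ?F x y \<in> Hom ?E (TensorO ?E (FO ?F x) (FO ?F y)) (FO ?F (y \<otimes>\<^sub>o\<^bsub>B\<^esub> x))"
      using J[of y x] by (simp add: Hom_iff Esimps)
    show "iso_arrow ?E (FJ ?F x y)"
      using J[of y x] xy by (simp add: MM.trans_iso FJ)
  next
    fix f x x' g y y' assume "f \<in> Hom B x x'" "g \<in> Hom B y y'"
    then show "FJ ?F x' y' \<cdot>\<^bsub>?E\<^esub> TensorA ?E (FA ?F f) (FA ?F g) = FA ?F (g \<otimes>\<^sub>a\<^bsub>B\<^esub> f) \<cdot>\<^bsub>?E\<^esub> FJ ?F x y"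
      by (auto simp: Hom_iff Esimps act.BA_comp merge_nat cong: restrict_cong)
  next
    fix x y z assume [simp]: "x \<in> Ob B" "y \<in> Ob B" "z \<in> Ob B"
    show "FA ?F (inv_arrow B (Assoc B z y x)) \<cdot>\<^bsub>?E\<^esub> FJ ?F (y \<otimes>\<^sub>o\<^bsub>B\<^esub> x) z
          \<cdot>\<^bsub>?E\<^esub> TensorA ?E (FJ ?F x y) (Ide ?E (FO ?F z))
        = FJ ?F x (z \<otimes>\<^sub>o\<^bsub>B\<^esub> y) \<cdot>\<^bsub>?E\<^esub> TensorA ?E (Ide ?E (FO ?F x)) (FJ ?F y z)
          \<cdot>\<^bsub>?E\<^esub> Assoc ?E (FO ?F x) (FO ?F y) (FO ?F z)"
      by (simp add: Esimps merge_assoc cong: restrict_cong)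
  next
    show "FU ?F \<in> Hom ?E (TUnit ?E) (FO ?F (TUnit B))"
      using U by (simp add: Hom_iff F End_mod_simps)
    show "iso_arrow ?E (FU ?F)"
      using U by (simp add: MM.trans_iso F)
  next
    fix x assume [simp]: "x \<in> Ob B"
    show "FA ?F (RUnit B x) \<cdot>\<^bsub>?E\<^esub> FJ ?F (TUnit B) x \<cdot>\<^bsub>?E\<^esub> TensorA ?E (FU ?F) (Ide ?E (FO ?F x))
        = LUnit ?E (FO ?F x)"
      by (simp add: Esimps merge_unit_left MM.comp_ftor_id cong: restrict_cong)
    show "FA ?F (LUnit B x) \<cdot>\<^bsub>?E\<^esub> FJ ?F x (TUnit B) \<cdot>\<^bsub>?E\<^esub> TensorA ?E (Ide ?E (FO ?F x)) (FU ?F)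
        = RUnit ?E (FO ?F x)"
      by (simp add: Esimps merge_unit_right MM.comp_ftor_id cong: restrict_cong)
  qed
qed

end


section \<open>Braidings of module categories and isomorphisms of alpha-inductions\<close>

lemma (in braided_tensor_category) braiding_braid: "braiding K B (Braid B) (inv_braid B)"
proof (intro braiding.intro braiding_axioms.intro linear_monoidal_category_axioms)
  fix x y assume "x \<in> Ob B" "y \<in> Ob B"
  then show "inverse_arrows B (Braid B x y) (inv_braid B x y)"
    by (intro inverse_arrows_inv braid_iso)
qed (rule braid_closed braid_natural hexagon1 hexagon2; assumption)+

text \<open>The two directions of the bijection between braidings of \<open>M\<close> and transformations of
  alpha-inductions. Both are restricted to the objects, since equality of the round trips with the
  identity is equality of functions.\<close>

definition twist_transf ::
    "('o, 'a, 'k, 'y) br_category_scheme \<Rightarrow> ('m, 'n, 'k, 'o, 'a) mod_category \<Rightarrow>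
     ('o \<Rightarrow> 'm \<Rightarrow> 'n) \<Rightarrow> 'o \<Rightarrow> (('m, 'n, 'm, 'n, 'o) mod_ftor, 'm, 'n) transf" where
  "twist_transf B M \<sigma> = (\<lambda>x \<in> Ob B.
     \<lparr>TDom = alpha_plus_ob B M x, TCod = alpha_minus_ob B M x, Cmp = (\<lambda>m \<in> Ob M. \<sigma> x m)\<rparr>)"

definition twist_of ::
    "('o, 'a, 'k, 'y) br_category_scheme \<Rightarrow> ('m, 'n, 'k, 'o, 'a) mod_category \<Rightarrow>
     ('o \<Rightarrow> (('m, 'n, 'm, 'n, 'o) mod_ftor, 'm, 'n) transf) \<Rightarrow> 'o \<Rightarrow> 'm \<Rightarrow> 'n" where
  "twist_of B M \<eta> = (\<lambda>x \<in> Ob B. \<lambda>m \<in> Ob M. Cmp (\<eta> x) m)"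

locale module_over_braided = module_category K B M + base: braided_tensor_category K B
  for K :: "'k ring" and B :: "('o, 'a, 'k, 'y) br_category_scheme"
    and M :: "('m, 'n, 'k, 'o, 'a) mod_category"
begin

sublocale plus: braided_action K B M "Braid B" "inv_braid B"
  by (intro braided_action.intro module_category_axioms base.braiding_braid)

text \<open>Here \<open>d x y\<close> is the inverse of \<open>c x y\<close> by definition, so the rule that rewrites the inverse of
  \<open>c x y\<close> to \<open>d x y\<close> has equal sides and would be applied forever.\<close>

declare plus.braid.c_arr(5) [simp del]

abbreviation is_tensor_iso where
  "is_tensor_iso \<eta> \<equiv>
     tensor_isomorphism K (op_tensor B) (End_mod K B M) (alpha_plus B M) (alpha_minus B M) \<eta>"

lemma minus_action: "braided_action K B M (\<lambda>x y. inv_braid B y x) (\<lambda>x y. Braid B y x)"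
  by (rule plus.reverse)

lemma alpha_plus_tensor_functor:
  "tensor_functor K (op_tensor B) (End_mod K B M) (alpha_plus B M)"
  unfolding alpha_plus_eq by (rule plus.alpha_tensor_functor)

lemma alpha_minus_tensor_functor:
  "tensor_functor K (op_tensor B) (End_mod K B M) (alpha_minus B M)"
  unfolding alpha_minus_eq by (rule braided_action.alpha_tensor_functor[OF minus_action])

lemma alpha_plus_ob_simps [simp]:
  "FO (alpha_plus_ob B M x) = (\<lambda>m \<in> Ob M. x \<star>\<^sub>o\<^bsub>M\<^esub> m)"
  "FA (alpha_plus_ob B M x) = (\<lambda>f \<in> Arr M. Ide B x \<star>\<^sub>a\<^bsub>M\<^esub> f)"
  "FS (alpha_plus_ob B M x) = (\<lambda>y \<in> Ob B. \<lambda>m \<in> Ob M. plus.unswap x y m)"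
  by (simp_all add: alpha_plus_ob_def plus.unswap_def)

lemma alpha_minus_ob_simps [simp]:
  "FO (alpha_minus_ob B M x) = (\<lambda>m \<in> Ob M. x \<star>\<^sub>o\<^bsub>M\<^esub> m)"
  "FA (alpha_minus_ob B M x) = (\<lambda>f \<in> Arr M. Ide B x \<star>\<^sub>a\<^bsub>M\<^esub> f)"
  "FS (alpha_minus_ob B M x) = (\<lambda>y \<in> Ob B. \<lambda>m \<in> Ob M. plus.swap y x m)"
  by (simp_all add: alpha_minus_ob_def plus.swap_def)

lemma alpha_ob_cells [simp]:
  assumes "x \<in> Ob B"
  shows "module_functor K B M M (alpha_plus_ob B M x)" "right_exact M M (alpha_plus_ob B M x)"
    "module_functor K B M M (alpha_minus_ob B M x)" "right_exact M M (alpha_minus_ob B M x)"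
  unfolding alpha_plus_eq alpha_minus_eq
  using assms plus.alpha_ob_mfun plus.alpha_ob_right_exact
    braided_action.alpha_ob_mfun[OF minus_action] braided_action.alpha_ob_right_exact[OF minus_action]
  by auto

text \<open>With \<open>s = \<sigma>\<^sub>x\<close> at \<open>y \<star> m\<close> and \<open>t = y \<star> \<sigma>\<^sub>x\<close>, the left side is the first axiom of a braiding of \<open>M\<close>, the
  right side the condition on \<open>\<sigma>\<^sub>x\<close> to be a module transformation \<open>\<alpha>\<^sup>+(x) \<rightarrow> \<alpha>\<^sup>-(x)\<close>.\<close>

lemma sigma_act_iff_transformation:
  assumes [simp]: "x \<in> Ob B" "y \<in> Ob B" "m \<in> Ob M"
    and s [simp]: "s \<in> Arr M" "Dom M s = x \<star>\<^sub>o\<^bsub>M\<^esub> y \<star>\<^sub>o\<^bsub>M\<^esub> m" "Cod M s = x \<star>\<^sub>o\<^bsub>M\<^esub> y \<star>\<^sub>o\<^bsub>M\<^esub> m"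
    and t [simp]: "t \<in> Arr M" "Dom M t = y \<star>\<^sub>o\<^bsub>M\<^esub> x \<star>\<^sub>o\<^bsub>M\<^esub> m" "Cod M t = y \<star>\<^sub>o\<^bsub>M\<^esub> x \<star>\<^sub>o\<^bsub>M\<^esub> m"
  shows "plus.unswap y x m \<cdot>\<^bsub>M\<^esub> s = t \<cdot>\<^bsub>M\<^esub> plus.swap x y m
    \<longleftrightarrow> s \<cdot>\<^bsub>M\<^esub> plus.unswap x y m = plus.swap y x m \<cdot>\<^bsub>M\<^esub> t"
  using inverse_square[of "plus.unswap y x m" s t "plus.swap x y m"]
    inverse_square[of "plus.swap y x m" t s "plus.unswap x y m"] by auto

text \<open>With \<open>s = \<sigma>\<close> at \<open>x \<otimes> y\<close> and \<open>t\<close> the composite of \<open>\<sigma>\<^sub>y\<close> and \<open>y \<star> \<sigma>\<^sub>x\<close>, the left side is the second axiom of a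
  braiding of \<open>M\<close>, the right side the condition on \<open>\<sigma>\<close> to be monoidal at \<open>(y, x)\<close>: its factors at \<open>s\<close> and \<open>t\<close> are
  the tensor structures of \<open>\<alpha>\<^sup>+\<close> and \<open>\<alpha>\<^sup>-\<close>.\<close>

lemma sigma_tensor_iff_monoidal:
  assumes [simp]: "x \<in> Ob B" "y \<in> Ob B" "m \<in> Ob M"
    and s [simp]: "s \<in> Arr M" "Dom M s = (x \<otimes>\<^sub>o\<^bsub>B\<^esub> y) \<star>\<^sub>o\<^bsub>M\<^esub> m" "Cod M s = (x \<otimes>\<^sub>o\<^bsub>B\<^esub> y) \<star>\<^sub>o\<^bsub>M\<^esub> m"
    and t [simp]: "t \<in> Arr M" "Dom M t = y \<star>\<^sub>o\<^bsub>M\<^esub> x \<star>\<^sub>o\<^bsub>M\<^esub> m" "Cod M t = y \<star>\<^sub>o\<^bsub>M\<^esub> x \<star>\<^sub>o\<^bsub>M\<^esub> m"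
  shows "MAssoc M y x m \<cdot>\<^bsub>M\<^esub> (Braid B x y \<star>\<^sub>a\<^bsub>M\<^esub> Ide M m) \<cdot>\<^bsub>M\<^esub> s
      = t \<cdot>\<^bsub>M\<^esub> MAssoc M y x m \<cdot>\<^bsub>M\<^esub> (inv_braid B y x \<star>\<^sub>a\<^bsub>M\<^esub> Ide M m)
    \<longleftrightarrow> s \<cdot>\<^bsub>M\<^esub> ((Braid B y x \<star>\<^sub>a\<^bsub>M\<^esub> Ide M m) \<cdot>\<^bsub>M\<^esub> inv_arrow M (MAssoc M y x m))
      = (inv_braid B x y \<star>\<^sub>a\<^bsub>M\<^esub> Ide M m) \<cdot>\<^bsub>M\<^esub> (inv_arrow M (MAssoc M y x m) \<cdot>\<^bsub>M\<^esub> t)"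
proof -
  let ?e = "MAssoc M y x m \<cdot>\<^bsub>M\<^esub> (Braid B x y \<star>\<^sub>a\<^bsub>M\<^esub> Ide M m)"
  let ?b = "MAssoc M y x m \<cdot>\<^bsub>M\<^esub> (inv_braid B y x \<star>\<^sub>a\<^bsub>M\<^esub> Ide M m)"
  have iso: "iso_arrow M ?e" "iso_arrow M ?b"
    by simp_all
  have "?e \<cdot>\<^bsub>M\<^esub> s = t \<cdot>\<^bsub>M\<^esub> ?b \<longleftrightarrow> s \<cdot>\<^bsub>M\<^esub> inv_arrow M ?b = inv_arrow M ?e \<cdot>\<^bsub>M\<^esub> t"
  proof
    assume "?e \<cdot>\<^bsub>M\<^esub> s = t \<cdot>\<^bsub>M\<^esub> ?b"
    then show "s \<cdot>\<^bsub>M\<^esub> inv_arrow M ?b = inv_arrow M ?e \<cdot>\<^bsub>M\<^esub> t"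
      by (intro inverse_square[symmetric]) simp_all
  next
    assume "s \<cdot>\<^bsub>M\<^esub> inv_arrow M ?b = inv_arrow M ?e \<cdot>\<^bsub>M\<^esub> t"
    then have "inv_arrow M (inv_arrow M ?e) \<cdot>\<^bsub>M\<^esub> s = t \<cdot>\<^bsub>M\<^esub> inv_arrow M (inv_arrow M ?b)"
      by (intro inverse_square[OF sym]) simp_all
    then show "?e \<cdot>\<^bsub>M\<^esub> s = t \<cdot>\<^bsub>M\<^esub> ?b"
      by (simp only: iso_inv(2) iso)
  qed
  then show ?thesis
    by simp
qed

lemma twist_transf_tensor_iso:
  assumes "braided_module_category K B M \<sigma>"
  shows "is_tensor_iso (twist_transf B M \<sigma>)"
proof -
  interpret \<sigma>: braided_module_category K B M \<sigma> by fact
  interpret MM: module_category_pair K B M M ..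
  let ?E = "End_mod K B M" and ?\<eta> = "twist_transf B M \<sigma>"
  have \<sigma> [simp]: "\<sigma> x m \<in> Arr M" "Dom M (\<sigma> x m) = x \<star>\<^sub>o\<^bsub>M\<^esub> m" "Cod M (\<sigma> x m) = x \<star>\<^sub>o\<^bsub>M\<^esub> m"
      "iso_arrow M (\<sigma> x m)" if "x \<in> Ob B" "m \<in> Ob M" for x m
    using \<sigma>.sigma_closed[OF that] \<sigma>.sigma_iso[OF that] by (auto simp: Hom_iff)
  have nat: "\<sigma> x m \<cdot>\<^bsub>M\<^esub> (f \<star>\<^sub>a\<^bsub>M\<^esub> h) = (f \<star>\<^sub>a\<^bsub>M\<^esub> h) \<cdot>\<^bsub>M\<^esub> \<sigma> (Dom B f) (Dom M h)"
    if "f \<in> Arr B" "h \<in> Arr M" "Cod B f = x" "Cod M h = m" for f h x m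
    using that by (intro \<sigma>.sigma_natural) (auto simp: Hom_iff)
  have str: "\<sigma> x (y \<star>\<^sub>o\<^bsub>M\<^esub> m) \<cdot>\<^bsub>M\<^esub> plus.unswap x y m = plus.swap y x m \<cdot>\<^bsub>M\<^esub> (Ide B y \<star>\<^sub>a\<^bsub>M\<^esub> \<sigma> x m)"
    if "x \<in> Ob B" "y \<in> Ob B" "m \<in> Ob M" for x y m
    using \<sigma>.sigma_act[OF that] sigma_act_iff_transformation[OF that, of "\<sigma> x (y \<star>\<^sub>o\<^bsub>M\<^esub> m)" "Ide B y \<star>\<^sub>a\<^bsub>M\<^esub> \<sigma> x m"] that
    by (simp add: plus.swap_def plus.unswap_def)
  have tensor: "\<sigma> (x \<otimes>\<^sub>o\<^bsub>B\<^esub> y) m \<cdot>\<^bsub>M\<^esub> ((Braid B y x \<star>\<^sub>a\<^bsub>M\<^esub> Ide M m) \<cdot>\<^bsub>M\<^esub> inv_arrow M (MAssoc M y x m))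
      = (inv_braid B x y \<star>\<^sub>a\<^bsub>M\<^esub> Ide M m) \<cdot>\<^bsub>M\<^esub> (inv_arrow M (MAssoc M y x m)
          \<cdot>\<^bsub>M\<^esub> (\<sigma> y (x \<star>\<^sub>o\<^bsub>M\<^esub> m) \<cdot>\<^bsub>M\<^esub> (Ide B y \<star>\<^sub>a\<^bsub>M\<^esub> \<sigma> x m)))"
    if "x \<in> Ob B" "y \<in> Ob B" "m \<in> Ob M" for x y m
    using \<sigma>.sigma_tensor[OF that] that
      sigma_tensor_iff_monoidal[OF that, of "\<sigma> (x \<otimes>\<^sub>o\<^bsub>B\<^esub> y) m" "\<sigma> y (x \<star>\<^sub>o\<^bsub>M\<^esub> m) \<cdot>\<^bsub>M\<^esub> (Ide B y \<star>\<^sub>a\<^bsub>M\<^esub> \<sigma> x m)"]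
    by simp
  have mtrans: "MM.mtrans (?\<eta> x)" if "x \<in> Ob B" for x
    unfolding twist_transf_def using that
    by (simp, intro MM.transI) (auto simp: Hom_iff nat str)
  have [simp]: "Hom ?E F G = Hom (Fun_mod K B M M) F G" "iso_arrow ?E t = iso_arrow (Fun_mod K B M M) t"
    for F G t
    by (simp_all add: Hom_def iso_arrow_def inverse_arrows_def End_mod_simps)
  note Esimps = End_mod_simps hcomp_transf_def alpha_plus_def alpha_minus_def twist_transf_def
  show ?thesis
  proof (intro tensor_isomorphism.intro tensor_isomorphism_axioms.intro alpha_plus_tensor_functor
      alpha_minus_tensor_functor)
    show "nat_transformation (op_tensor B) ?E (alpha_plus B M) (alpha_minus B M) ?\<eta>"
      unfolding nat_transformation_def op_tensor_simps op_tensor_Hom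
    proof (intro conjI ballI allI impI)
      fix x assume "x \<in> Ob B"
      then show "?\<eta> x \<in> Hom ?E (FO (alpha_plus B M) x) (FO (alpha_minus B M) x)"
        using mtrans[of x] by (simp add: Hom_iff Esimps)
    next
      fix x y f assume "f \<in> Hom B x y"
      then show "?\<eta> y \<cdot>\<^bsub>?E\<^esub> FA (alpha_plus B M) f = FA (alpha_minus B M) f \<cdot>\<^bsub>?E\<^esub> ?\<eta> x"
        by (auto simp: Hom_iff Esimps nat cong: restrict_cong)
    qed
    fix x assume "x \<in> Ob (op_tensor B)"
    then show "iso_arrow ?E (?\<eta> x)"
      using mtrans[of x] MM.trans_iso[of "?\<eta> x"] by (simp add: twist_transf_def)
  next
    fix x y assume "x \<in> Ob (op_tensor B)" "y \<in> Ob (op_tensor B)"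
    then have [simp]: "x \<in> Ob B" "y \<in> Ob B" by simp_all
    show "?\<eta> (x \<otimes>\<^sub>o\<^bsub>op_tensor B\<^esub> y) \<cdot>\<^bsub>?E\<^esub> FJ (alpha_plus B M) x y
        = FJ (alpha_minus B M) x y \<cdot>\<^bsub>?E\<^esub> TensorA ?E (?\<eta> x) (?\<eta> y)"
      by (simp add: Esimps tensor cong: restrict_cong)
  next
    show "?\<eta> (TUnit (op_tensor B)) \<cdot>\<^bsub>?E\<^esub> FU (alpha_plus B M) = FU (alpha_minus B M)"
      by (simp add: Esimps \<sigma>.sigma_unit cong: restrict_cong)
  qed
qed

lemma tensor_iso_cells:
  assumes "is_tensor_iso \<eta>" "x \<in> Ob B"
  shows "\<eta> x \<in> Arr (Fun_mod K B M M)" "TDom (\<eta> x) = alpha_plus_ob B M x"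
    "TCod (\<eta> x) = alpha_minus_ob B M x"
proof -
  have "\<eta> x \<in> Hom (End_mod K B M) (FO (alpha_plus B M) x) (FO (alpha_minus B M) x)"
    using tensor_isomorphism.natural[OF assms(1)] assms(2) by (simp add: nat_transformation_def)
  then show "\<eta> x \<in> Arr (Fun_mod K B M M)" "TDom (\<eta> x) = alpha_plus_ob B M x"
    "TCod (\<eta> x) = alpha_minus_ob B M x"
    by (simp_all add: Hom_iff End_mod_simps alpha_plus_def alpha_minus_def)
qed

text \<open>The converse direction reads the components of the axioms of \<open>\<eta>\<close>. Naturality in both variables at once
  is obtained from the two separate ones by factoring \<open>f \<star> h\<close>.\<close>

lemma twist_of_braided:
  assumes iso: "is_tensor_iso \<eta>"
  shows "braided_module_category K B M (twist_of B M \<eta>)"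
proof -
  interpret MM: module_category_pair K B M M ..
  interpret \<eta>: tensor_isomorphism K "op_tensor B" "End_mod K B M" "alpha_plus B M" "alpha_minus B M" \<eta>
    by (rule iso)
  note cells [simp] = tensor_iso_cells[OF iso]
  let ?E = "End_mod K B M"
  let ?s = "\<lambda>x m. Cmp (\<eta> x) m"
  note Esimps = End_mod_simps hcomp_transf_def alpha_plus_def alpha_minus_def
  have s [simp]: "?s x m \<in> Arr M" "Dom M (?s x m) = x \<star>\<^sub>o\<^bsub>M\<^esub> m" "Cod M (?s x m) = x \<star>\<^sub>o\<^bsub>M\<^esub> m"
    if "x \<in> Ob B" "m \<in> Ob M" for x m
    using that by simp_all
  have s_iso: "iso_arrow M (?s x m)" if "x \<in> Ob B" "m \<in> Ob M" for x m
    using \<eta>.iso[of x] that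
    by (intro MM.trans_iso_cmp) (simp_all add: iso_arrow_def inverse_arrows_def Hom_def End_mod_simps)
  have nat_m: "?s x m \<cdot>\<^bsub>M\<^esub> (Ide B x \<star>\<^sub>a\<^bsub>M\<^esub> h) = (Ide B x \<star>\<^sub>a\<^bsub>M\<^esub> h) \<cdot>\<^bsub>M\<^esub> ?s x (Dom M h)"
    if "x \<in> Ob B" "h \<in> Arr M" "Cod M h = m" for x h m
    using MM.trans_nat[OF cells(1) that(2,3), of x] that by simp
  have nat_x: "?s x' m \<cdot>\<^bsub>M\<^esub> (f \<star>\<^sub>a\<^bsub>M\<^esub> Ide M m) = (f \<star>\<^sub>a\<^bsub>M\<^esub> Ide M m) \<cdot>\<^bsub>M\<^esub> ?s x m"
    if "f \<in> Hom B x x'" "m \<in> Ob M" for f x x' m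
  proof -
    have "\<eta> x' \<cdot>\<^bsub>?E\<^esub> FA (alpha_plus B M) f = FA (alpha_minus B M) f \<cdot>\<^bsub>?E\<^esub> \<eta> x"
      using \<eta>.natural that(1) by (simp add: nat_transformation_def)
    from arg_cong[OF this, of "\<lambda>t. Cmp t m"] show ?thesis
      using that(2) by (simp add: Esimps)
  qed
  have str: "?s x (y \<star>\<^sub>o\<^bsub>M\<^esub> m) \<cdot>\<^bsub>M\<^esub> plus.unswap x y m = plus.swap y x m \<cdot>\<^bsub>M\<^esub> (Ide B y \<star>\<^sub>a\<^bsub>M\<^esub> ?s x m)"
    if "x \<in> Ob B" "y \<in> Ob B" "m \<in> Ob M" for x y m
    using MM.trans_str[OF cells(1) that(2,3), of x] that by simp
  have tensor: "?s (x \<otimes>\<^sub>o\<^bsub>B\<^esub> y) m \<cdot>\<^bsub>M\<^esub> ((Braid B y x \<star>\<^sub>a\<^bsub>M\<^esub> Ide M m) \<cdot>\<^bsub>M\<^esub> inv_arrow M (MAssoc M y x m))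
      = (inv_braid B x y \<star>\<^sub>a\<^bsub>M\<^esub> Ide M m) \<cdot>\<^bsub>M\<^esub> (inv_arrow M (MAssoc M y x m)
          \<cdot>\<^bsub>M\<^esub> (?s y (x \<star>\<^sub>o\<^bsub>M\<^esub> m) \<cdot>\<^bsub>M\<^esub> (Ide B y \<star>\<^sub>a\<^bsub>M\<^esub> ?s x m)))"
    if "x \<in> Ob B" "y \<in> Ob B" "m \<in> Ob M" for x y m
    using arg_cong[OF \<eta>.monoidal[of y x], of "\<lambda>t. Cmp t m"] that by (simp add: Esimps)
  have unit: "?s (TUnit B) m = Ide M (TUnit B \<star>\<^sub>o\<^bsub>M\<^esub> m)" if "m \<in> Ob M" for m
  proof -
    have "?s (TUnit B) m \<cdot>\<^bsub>M\<^esub> inv_arrow M (MUnit M m) = inv_arrow M (MUnit M m)"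
      using arg_cong[OF \<eta>.monoidal_unit, of "\<lambda>t. Cmp t m"] that by (simp add: Esimps)
    then show ?thesis
      using that by (intro cancel_right[of "inv_arrow M (MUnit M m)" "?s (TUnit B) m"]) simp_all
  qed
  have \<sigma> [simp]: "twist_of B M \<eta> x m = ?s x m" if "x \<in> Ob B" "m \<in> Ob M" for x m
    using that by (simp add: twist_of_def)
  show ?thesis
  proof (intro braided_module_category.intro braided_module_category_axioms.intro
      base.braided_tensor_category_axioms module_category_axioms)
    fix x m assume "x \<in> Ob B" "m \<in> Ob M"
    then show "twist_of B M \<eta> x m \<in> Hom M (x \<star>\<^sub>o\<^bsub>M\<^esub> m) (x \<star>\<^sub>o\<^bsub>M\<^esub> m)" "iso_arrow M (twist_of B M \<eta> x m)"
      by (simp_all add: Hom_iff s_iso)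
  next
    fix f x x' h m m' assume *: "f \<in> Hom B x x'" "h \<in> Hom M m m'"
    then have [simp]: "f \<in> Arr B" "Dom B f = x" "Cod B f = x'" "x \<in> Ob B" "x' \<in> Ob B"
        "h \<in> Arr M" "Dom M h = m" "Cod M h = m'" "m \<in> Ob M" "m' \<in> Ob M"
      by (auto simp: Hom_iff)
    have "?s x' m' \<cdot>\<^bsub>M\<^esub> (f \<star>\<^sub>a\<^bsub>M\<^esub> h) = (?s x' m' \<cdot>\<^bsub>M\<^esub> (f \<star>\<^sub>a\<^bsub>M\<^esub> Ide M m')) \<cdot>\<^bsub>M\<^esub> (Ide B x \<star>\<^sub>a\<^bsub>M\<^esub> h)"
      by (simp add: act.BA_comp)
    also have "\<dots> = (f \<star>\<^sub>a\<^bsub>M\<^esub> h) \<cdot>\<^bsub>M\<^esub> ?s x m"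
      by (simp add: nat_x[OF *(1)] nat_m act.BA_comp_extend)
    finally show "twist_of B M \<eta> x' m' \<cdot>\<^bsub>M\<^esub> (f \<star>\<^sub>a\<^bsub>M\<^esub> h) = (f \<star>\<^sub>a\<^bsub>M\<^esub> h) \<cdot>\<^bsub>M\<^esub> twist_of B M \<eta> x m"
      by simp
  next
    fix m assume "m \<in> Ob M"
    then show "twist_of B M \<eta> (TUnit B) m = Ide M (TUnit B \<star>\<^sub>o\<^bsub>M\<^esub> m)"
      by (simp add: unit)
  next
    fix x y m assume xym: "x \<in> Ob B" "y \<in> Ob B" "m \<in> Ob M"
    show "MAssoc M y x m \<cdot>\<^bsub>M\<^esub> (inv_braid B y x \<star>\<^sub>a\<^bsub>M\<^esub> Ide M m) \<cdot>\<^bsub>M\<^esub> inv_arrow M (MAssoc M x y m)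
          \<cdot>\<^bsub>M\<^esub> twist_of B M \<eta> x (y \<star>\<^sub>o\<^bsub>M\<^esub> m)
        = (Ide B y \<star>\<^sub>a\<^bsub>M\<^esub> twist_of B M \<eta> x m) \<cdot>\<^bsub>M\<^esub> MAssoc M y x m \<cdot>\<^bsub>M\<^esub> (Braid B x y \<star>\<^sub>a\<^bsub>M\<^esub> Ide M m)
            \<cdot>\<^bsub>M\<^esub> inv_arrow M (MAssoc M x y m)"
      using str[OF xym] sigma_act_iff_transformation[OF xym, of "?s x (y \<star>\<^sub>o\<^bsub>M\<^esub> m)" "Ide B y \<star>\<^sub>a\<^bsub>M\<^esub> ?s x m"] xym
      by (simp add: plus.swap_def plus.unswap_def)
    show "MAssoc M y x m \<cdot>\<^bsub>M\<^esub> (Braid B x y \<star>\<^sub>a\<^bsub>M\<^esub> Ide M m) \<cdot>\<^bsub>M\<^esub> twist_of B M \<eta> (x \<otimes>\<^sub>o\<^bsub>B\<^esub> y) m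
        = twist_of B M \<eta> y (x \<star>\<^sub>o\<^bsub>M\<^esub> m) \<cdot>\<^bsub>M\<^esub> (Ide B y \<star>\<^sub>a\<^bsub>M\<^esub> twist_of B M \<eta> x m) \<cdot>\<^bsub>M\<^esub> MAssoc M y x m
            \<cdot>\<^bsub>M\<^esub> (inv_braid B y x \<star>\<^sub>a\<^bsub>M\<^esub> Ide M m)"
      using tensor[OF xym] xym
        sigma_tensor_iff_monoidal[OF xym, of "?s (x \<otimes>\<^sub>o\<^bsub>B\<^esub> y) m" "?s y (x \<star>\<^sub>o\<^bsub>M\<^esub> m) \<cdot>\<^bsub>M\<^esub> (Ide B y \<star>\<^sub>a\<^bsub>M\<^esub> ?s x m)"]
      by simp
  qed (simp_all add: twist_of_def)
qed

lemma twist_of_transf: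
  assumes "braided_module_category K B M \<sigma>"
  shows "twist_of B M (twist_transf B M \<sigma>) = \<sigma>"
proof -
  interpret \<sigma>: braided_module_category K B M \<sigma> by fact
  have "twist_of B M (twist_transf B M \<sigma>) x = \<sigma> x" if "x \<in> Ob B" for x
    using that extensional_restrict[OF \<sigma>.sigma_extensional'[OF that]]
    by (simp add: twist_of_def twist_transf_def cong: restrict_cong)
  then show ?thesis
    by (intro extensionalityI[OF _ \<sigma>.sigma_extensional]) (simp_all add: twist_of_def)
qed

lemma twist_transf_of:
  assumes iso: "is_tensor_iso \<eta>" and ext: "\<eta> \<in> extensional (Ob B)"
  shows "twist_transf B M (twist_of B M \<eta>) = \<eta>"
proof -
  interpret MM: module_category_pair K B M M ..
  have "twist_transf B M (twist_of B M \<eta>) x = \<eta> x" if "x \<in> Ob B" for x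
    using that MM.trans_collapse[OF tensor_iso_cells(1)[OF iso that]]
    by (simp add: twist_transf_def twist_of_def tensor_iso_cells[OF iso] cong: restrict_cong)
  then show ?thesis
    by (intro extensionalityI[OF _ ext]) (simp_all add: twist_transf_def)
qed

end

theorem proposition4p9:
  fixes K :: "'k ring"
    and B :: "('o, 'a, 'k) br_category"
  assumes "algebraically_closed K"
    and "braided_tensor_category K B"
  shows "two_equivalence
    (Mod_br K B ::
      (('m, 'n, 'k, 'o, 'a) mod_category \<times> ('o \<Rightarrow> 'm \<Rightarrow> 'n), ('m, 'n, 'm, 'n, 'o) mod_ftor,
        (('m, 'n, 'm, 'n, 'o) mod_ftor, 'm, 'n) transf) two_category)
    (A_mod K B)
    (canonical_two_ftor B)"
proof -
  let ?A = "{(M, \<sigma>). braided_module_category K B M \<sigma>} :: (('m, 'n, 'k, 'o, 'a) mod_category \<times> _) set"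
  let ?A' = "{(M, \<eta>). module_category K B M \<and>
      tensor_isomorphism K (op_tensor B) (End_mod K B M) (alpha_plus B M) (alpha_minus B M) \<eta> \<and>
      \<eta> \<in> extensional (Ob B)} :: (('m, 'n, 'k, 'o, 'a) mod_category \<times> _) set"
  let ?P = "\<lambda>(M, \<sigma>) (N, \<tau>). preserves_twist B M N \<sigma> \<tau>"
  let ?w = "\<lambda>\<eta> x. Cmp (\<eta> x)"
  let ?P' = "\<lambda>(M, \<eta>) (N, \<theta>). preserves_twist B M N (?w \<eta>) (?w \<theta>)"
  let ?h = "\<lambda>(M, \<sigma>). (M, twist_transf B M \<sigma>)"
  let ?g = "\<lambda>(M, \<eta>). (M, twist_of B M \<eta>)"
  have over: "module_over_braided K B M" if "module_category K B M" for M :: "('m, 'n, 'k, 'o, 'a) mod_category"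
    using that assms(2) by (intro module_over_braided.intro)
  have braided: "module_category K B M" if "braided_module_category K B M \<sigma>"
    for M :: "('m, 'n, 'k, 'o, 'a) mod_category" and \<sigma>
    using that by (simp add: braided_module_category_def)
  have "Mod_br K B = structured_modules K B ?A ?P"
    unfolding Mod_br_def preserves_twist_def by (simp add: case_prod_beta)
  moreover have "A_mod K B = structured_modules K B ?A' ?P'"
    unfolding A_mod_def preserves_twist_def by (simp add: case_prod_beta)
  moreover have "(canonical_two_ftor B ::
      (('m, 'n, 'k, 'o, 'a) mod_category \<times> _, _, _, _, _, _) two_ftor) = relabel ?h"
    by (simp add: canonical_two_ftor_def relabel_def twist_transf_def)
  moreover have "two_equivalence (structured_modules K B ?A ?P) (structured_modules K B ?A' ?P') (relabel ?h)"
  proof (rule relabel_two_equivalence[where g = ?g])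
    show "two_category (structured_modules K B ?A ?P)"
      using preserves_twist_two_category[of ?A K B "\<lambda>\<sigma>. \<sigma>"] braided
      by (auto simp: twist_on_def braided_module_category.sigma_closed)
  next
    show "two_category (structured_modules K B ?A' ?P')"
    proof (rule preserves_twist_two_category)
      fix M \<eta> assume *: "(M, \<eta>) \<in> ?A'"
      then interpret module_over_braided K B M
        by (intro over) simp
      interpret \<sigma>: braided_module_category K B M "twist_of B M \<eta>"
        using * by (intro twist_of_braided) simp
      show "module_category K B M \<and> twist_on B M (?w \<eta>)"
        using * \<sigma>.sigma_closed by (simp add: twist_on_def twist_of_def)
    qed
  next
    fix p assume "p \<in> ?A"
    then obtain M \<sigma> where p: "p = (M, \<sigma>)" and *: "braided_module_category K B M \<sigma>"
      by auto
    interpret module_over_braided K B M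
      using * by (intro over braided)
    show "?h p \<in> ?A' \<and> fst (?h p) = fst p \<and> ?g (?h p) = p"
      using twist_transf_tensor_iso[OF *] twist_of_transf[OF *] module_category_axioms
      by (simp add: p) (simp add: twist_transf_def)
  next
    fix q assume "q \<in> ?A'"
    then obtain M \<eta> where q: "q = (M, \<eta>)" and M: "module_category K B M"
      and *: "tensor_isomorphism K (op_tensor B) (End_mod K B M) (alpha_plus B M) (alpha_minus B M) \<eta>"
        "\<eta> \<in> extensional (Ob B)"
      by auto
    interpret module_over_braided K B M
      by (intro over M)
    show "?g q \<in> ?A \<and> ?h (?g q) = q"
      using twist_of_braided[OF *(1)] twist_transf_of[OF *] by (simp add: q)
  next
    fix p q F
    assume "p \<in> ?A" "q \<in> ?A" and F: "F \<in> Ob (Fun_mod K B (fst p) (fst q))"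
    then obtain M \<sigma> N \<tau> where pq: "p = (M, \<sigma>)" "q = (N, \<tau>)"
      and *: "braided_module_category K B M \<sigma>" "braided_module_category K B N \<tau>"
      by auto
    interpret M: module_over_braided K B M
      using *(1) by (intro over braided)
    interpret N: module_over_braided K B N
      using *(2) by (intro over braided)
    interpret module_category_pair K B M N ..
    show "?P' (?h p) (?h q) F \<longleftrightarrow> ?P p q F"
      using F by (simp add: pq preserves_twist_def twist_transf_def)
  qed
  ultimately show ?thesis
    by simp
qed

end
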